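(* Under the Markovian switching setup in the context, assume additionally that all roots of $s^{n-1}+b_{n-1}s^{n-2}+\dots+b_2s+b_1=0$ lie strictly inside the unit circle. Then: (i) if $\beta>\frac{1}{2f_M\pi_{\min}}\big(\frac{\gamma\lambda_G^2}{\lambda_2^3}+\gamma\alpha\big)$, then $\lim_{t\to\infty}E[\|x_i(t)-\bar x(t)\|^2]=0$ for all $i=1,\dots,N$; (ii) if $\gamma>\frac1{\lambda_2}$ and $\beta>\frac{1}{2f_M\pi_{\min}}\big(\frac{\gamma^2\lambda_G^2}{\lambda_2^2(\gamma\lambda_2-1)}+\gamma\alpha+1\big)$, then $E[\|x_i(t)-\bar x(t)\|^2]=O(1/t)$ for all $i=1,\dots,N$.
   Context: Fix integers $n\ge 2$ and $N\ge 2$. Let $a_1,\dots,a_n\in\mathbb{R}$, let $A\in\mathbb{R}^{n\times n}$ be the matrix with $A_{k,k+1}=1$ for $k=1,\dots,n-1$, last row $(a_1,a_2,\dots,a_n)$, and all other entries $0$, and let $B=(0,\dots,0,1)^T\in\mathbb{R}^n$. There are $N$ agents with dynamics $x_i(t+1)=Ax_i(t)+Bu_i(t)$, $i=1,\dots,N$, where $x_i(t)\in\mathbb{R}^n$ and $u_i(t)\in\mathbb{R}$; write $\bar x(t)=\frac1N\sum_{i=1}^N x_i(t)$. Gains: real numbers $b_1,\dots,b_{n-1}$, $K_2=[b_1,\dots,b_{n-1},1]$, $K_1=[-a_1+b_1,\,-a_2+b_2-b_1,\,\dots,\,-a_{n-1}+b_{n-1}-b_{n-2},\,-a_n-b_{n-1}+1]$.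 Switching topologies: $G_1,\dots,G_h$ are undirected graphs on $\{1,\dots,N\}$ with edge sets $E_1,\dots,E_h$ and Laplacians $L_1,\dots,L_h$; their union $G'$ (edge set $E_1\cup\dots\cup E_h$) is connected. $N_i'$ is the neighbor set of $i$ in $G'$, $d_i'=|N_i'|$, $d'_{\max}=\max_i d_i'$; $N_i^{(u)}$ is the neighbor set of $i$ in $G_u$. $\{m(t)\}$ is a homogeneous Markov chain on $\{1,\dots,h\}$ with irreducible aperiodic transition matrix, stationary distribution $\pi=(\pi_1,\dots,\pi_h)$, $\pi_{\min}=\min_u\pi_u$, independent of the noises. $\check L=\sum_u\pi_uL_u$ has eigenvalues $0=\lambda_1<\lambda_2\le\dots\le\lambda_N$. Communication: for every ordered pair $(i,j)$ with $j\in N_i'$ and every $t$, $s_{ij}(t)=1$ if $K_2x_j(t)+d_{ij}(t)\le c_{ij}$ and $0$ otherwise, with fixed thresholds $c_{ij}\in\mathbb R$ and noises $d_{ij}(t)$ i.i.d. $N(0,\sigma^2)$, $\sigma>0$; $F,f$ are the distribution function and density of $N(0,\sigma^2)$. Algorithm: fix $\beta>0$, $\gamma>0$, an integer $t_0>\gamma d'_{\max}-1$, deterministic $x_i(t_0+1)=x_i^0$, $\hat z_{ij}(t_0)=\hat z^0_{ij}$ ($j\in N_i'$), and $M>0$ with $|K_2x_i^0|\le M$, $|\hat z^0_{ij}|\le M$. $\Pi_M(\zeta)=\max\{-M,\min\{M,\zeta\}\}$. For $t\ge t_0+1$, all $i$ and $j\in N_i'$: $\hat z_{ij}(t)=\Pi_M\big(\hat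 z_{ij}(t-1)+\tfrac{\beta}{t}\mathbb 1\{j\in N_i^{(m(t))}\}(F(c_{ij}-\hat z_{ij}(t-1))-s_{ij}(t))\big)$, $u_i(t)=K_1x_i(t)+\frac{\gamma}{t+1}\sum_{j\in N_i^{(m(t))}}(\hat z_{ij}(t)-K_2x_i(t))$. Constants: enumerate the $d'=\sum_id_i'$ ordered pairs $(i,j)$, $j\in N_i'$, as $p=1,\dots,d'$. $Q\in\mathbb R^{d'\times N}$ with $Q_{p,k}=1$ if pair $p$ has second component $k$, else $0$; $W_u\in\mathbb R^{N\times d'}$ with $(W_u)_{k,p}=1$ if pair $p=(k,j)$ has first component $k$ and $\{k,j\}\in E_u$, else $0$; $J_N=I_N-\frac1N\mathbf 1\mathbf 1^T$. With spectral norm $\|\cdot\|$ (Euclidean norm for vectors): $\lambda_G=\max_u\|J_NW_u\|^2$, $\lambda_{QW}=\max_u\|QW_u\|^2$, $\lambda_{QL}=\max_u\|QL_u\|^2$, $\alpha=2\sqrt{\lambda_{QW}}+\lambda_{QL}\lambda_2/\lambda_G$, $f_M=\min_{(i,j):\,j\in N_i'}f(|c_{ij}|+M)$. $O(1/t)$ means bounded by $C/t$ for a constant $C$ and all $t\ge t_0+1$. *)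

theory Defs
  imports "HOL-Probability.Probability" "Jordan_Normal_Form.Char_Poly"
begin

text \<open>Agent dynamics (JNF vectors/matrices, 0-based indices: component k
  corresponds to the paper's component k+1).\<close>

definition sysA :: "nat \<Rightarrow> (nat \<Rightarrow> real) \<Rightarrow> real mat" where
  "sysA n a = mat n n (\<lambda>(k, l). if k = n - 1 then a (l + 1) else if l = k + 1 then 1 else 0)"

definition sysB :: "nat \<Rightarrow> real vec" where
  "sysB n = vec n (\<lambda>k. if k = n - 1 then 1 else 0)"

text \<open>b extended by b_0 = 0 and b_n = 1.\<close>
definition bext :: "nat \<Rightarrow> (nat \<Rightarrow> real) \<Rightarrow> nat \<Rightarrow> real" where
  "bext n b j = (if j = 0 then 0 else if j = n then 1 else b j)"

text \<open>K2 = [b_1, ..., b_(n-1), 1]\<close>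
definition gainK2 :: "nat \<Rightarrow> (nat \<Rightarrow> real) \<Rightarrow> real vec" where
  "gainK2 n b = vec n (\<lambda>k. bext n b (k + 1))"

text \<open>K1 = [-a_1+b_1, -a_2+b_2-b_1, ..., -a_(n-1)+b_(n-1)-b_(n-2), -a_n-b_(n-1)+1]\<close>
definition gainK1 :: "nat \<Rightarrow> (nat \<Rightarrow> real) \<Rightarrow> (nat \<Rightarrow> real) \<Rightarrow> real vec" where
  "gainK1 n a b = vec n (\<lambda>k. - a (k + 1) + bext n b (k + 1) - bext n b k)"

text \<open>s^(n-1) + b_(n-1) s^(n-2) + ... + b_2 s + b_1\<close>
definition gain_poly :: "nat \<Rightarrow> (nat \<Rightarrow> real) \<Rightarrow> real poly" where
  "gain_poly n b = monom 1 (n - 1) + (\<Sum>k<n - 1. monom (b (k + 1)) k)"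

text \<open>Graphs: agents 1..N, topologies u = 1..h, undirected edge sets E u of 2-element sets.\<close>

definition nbr :: "(nat \<Rightarrow> nat set set) \<Rightarrow> nat \<Rightarrow> nat \<Rightarrow> nat set" where
  "nbr E u i = {j. {i, j} \<in> E u}"

definition nbr_union :: "nat \<Rightarrow> (nat \<Rightarrow> nat set set) \<Rightarrow> nat \<Rightarrow> nat set" where
  "nbr_union h E i = {j. \<exists>u\<in>{1..h}. {i, j} \<in> E u}"

definition pairs :: "nat \<Rightarrow> nat \<Rightarrow> (nat \<Rightarrow> nat set set) \<Rightarrow> (nat \<times> nat) set" where
  "pairs N h E = {(i, j). i \<in> {1..N} \<and> j \<in> nbr_union h E i}"

definition undirected_graphs :: "nat \<Rightarrow> nat \<Rightarrow> (nat \<Rightarrow> nat set set) \<Rightarrow> bool" where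
  "undirected_graphs N h E \<longleftrightarrow> (\<forall>u\<in>{1..h}. \<forall>e\<in>E u. e \<subseteq> {1..N} \<and> card e = 2)"

definition union_connected :: "nat \<Rightarrow> nat \<Rightarrow> (nat \<Rightarrow> nat set set) \<Rightarrow> bool" where
  "union_connected N h E \<longleftrightarrow>
     (\<forall>i\<in>{1..N}. \<forall>j\<in>{1..N}. (i, j) \<in> {(k, l). l \<in> nbr_union h E k}\<^sup>*)"

definition dmax :: "nat \<Rightarrow> nat \<Rightarrow> (nat \<Rightarrow> nat set set) \<Rightarrow> nat" where
  "dmax N h E = Max ((\<lambda>i. card (nbr_union h E i)) ` {1..N})"

text \<open>Matrices with rows/columns indexed by finite sets, as functions.\<close>

definition laplacian :: "(nat \<Rightarrow> nat set set) \<Rightarrow> nat \<Rightarrow> nat \<Rightarrow> nat \<Rightarrow> real" where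
  "laplacian E u i k = (if i = k then real (card (nbr E u i)) else if {i, k} \<in> E u then -1 else 0)"

definition Qmat :: "nat \<times> nat \<Rightarrow> nat \<Rightarrow> real" where
  "Qmat p k = (if snd p = k then 1 else 0)"

definition Wmat :: "(nat \<Rightarrow> nat set set) \<Rightarrow> nat \<Rightarrow> nat \<Rightarrow> nat \<times> nat \<Rightarrow> real" where
  "Wmat E u k p = (if fst p = k \<and> {fst p, snd p} \<in> E u then 1 else 0)"

definition Jmat :: "nat \<Rightarrow> nat \<Rightarrow> nat \<Rightarrow> real" where
  "Jmat N i k = (if i = k then 1 else 0) - 1 / real N"

definition mprod :: "'s set \<Rightarrow> ('r \<Rightarrow> 's \<Rightarrow> real) \<Rightarrow> ('s \<Rightarrow> 'c \<Rightarrow> real) \<Rightarrow> 'r \<Rightarrow> 'c \<Rightarrow> real" where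
  "mprod S A B r c = (\<Sum>s\<in>S. A r s * B s c)"

text \<open>Spectral norm (operator norm induced by the Euclidean norm) of a matrix with row
  index set R and column index set C.\<close>
definition opnorm :: "'r set \<Rightarrow> 'c set \<Rightarrow> ('r \<Rightarrow> 'c \<Rightarrow> real) \<Rightarrow> real" where
  "opnorm R C A = Sup {sqrt (\<Sum>r\<in>R. (\<Sum>c\<in>C. A r c * x c)\<^sup>2) | x. (\<Sum>c\<in>C. (x c)\<^sup>2) \<le> 1}"

definition lamG :: "nat \<Rightarrow> nat \<Rightarrow> (nat \<Rightarrow> nat set set) \<Rightarrow> real" where
  "lamG N h E = Max ((\<lambda>u. (opnorm {1..N} (pairs N h E) (mprod {1..N} (Jmat N) (Wmat E u)))\<^sup>2) ` {1..h})"

definition lamQW :: "nat \<Rightarrow> nat \<Rightarrow> (nat \<Rightarrow> nat set set) \<Rightarrow> real" where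
  "lamQW N h E = Max ((\<lambda>u. (opnorm (pairs N h E) (pairs N h E) (mprod {1..N} Qmat (Wmat E u)))\<^sup>2) ` {1..h})"

definition lamQL :: "nat \<Rightarrow> nat \<Rightarrow> (nat \<Rightarrow> nat set set) \<Rightarrow> real" where
  "lamQL N h E = Max ((\<lambda>u. (opnorm (pairs N h E) {1..N} (mprod {1..N} Qmat (laplacian E u)))\<^sup>2) ` {1..h})"

text \<open>Averaged Laplacian as a JNF matrix (0-based), and its second smallest eigenvalue
  (eigenvalues counted with multiplicity = roots of the characteristic polynomial).\<close>
definition Lcheck :: "nat \<Rightarrow> nat \<Rightarrow> (nat \<Rightarrow> nat set set) \<Rightarrow> (nat \<Rightarrow> real) \<Rightarrow> real mat" where
  "Lcheck N h E \<pi> = mat N N (\<lambda>(i, k). \<Sum>u\<in>{1..h}. \<pi> u * laplacian E u (i + 1) (k + 1))"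

definition lam2 :: "nat \<Rightarrow> nat \<Rightarrow> (nat \<Rightarrow> nat set set) \<Rightarrow> (nat \<Rightarrow> real) \<Rightarrow> real" where
  "lam2 N h E \<pi> = sorted_list_of_multiset (proots (char_poly (Lcheck N h E \<pi>))) ! 1"

definition alpha_const :: "nat \<Rightarrow> nat \<Rightarrow> (nat \<Rightarrow> nat set set) \<Rightarrow> (nat \<Rightarrow> real) \<Rightarrow> real" where
  "alpha_const N h E \<pi> = 2 * sqrt (lamQW N h E) + lamQL N h E * lam2 N h E \<pi> / lamG N h E"

text \<open>Gaussian N(0, sigma^2): density f and distribution function F.\<close>
definition gauss_F :: "real \<Rightarrow> real \<Rightarrow> real" where
  "gauss_F \<sigma> z = measure (density lborel (\<lambda>y. ennreal (normal_density 0 \<sigma> y))) {..z}"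

definition fM_const :: "nat \<Rightarrow> nat \<Rightarrow> (nat \<Rightarrow> nat set set) \<Rightarrow> real \<Rightarrow> (nat \<Rightarrow> nat \<Rightarrow> real) \<Rightarrow> real \<Rightarrow> real" where
  "fM_const N h E \<sigma> c M = Min ((\<lambda>(i, j). normal_density 0 \<sigma> (\<bar>c i j\<bar> + M)) ` pairs N h E)"

definition proj :: "real \<Rightarrow> real \<Rightarrow> real" where
  "proj M \<zeta> = max (- M) (min M \<zeta>)"

text \<open>Markov chain on states 1..h with transition probabilities P u v.\<close>

definition tmat :: "nat \<Rightarrow> (nat \<Rightarrow> nat \<Rightarrow> real) \<Rightarrow> real mat" where
  "tmat h P = mat h h (\<lambda>(u, v). P (u + 1) (v + 1))"

definition stochastic :: "nat \<Rightarrow> (nat \<Rightarrow> nat \<Rightarrow> real) \<Rightarrow> bool" where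
  "stochastic h P \<longleftrightarrow> (\<forall>u\<in>{1..h}. (\<forall>v\<in>{1..h}. P u v \<ge> 0) \<and> (\<Sum>v\<in>{1..h}. P u v) = 1)"

definition irreducible_tm :: "nat \<Rightarrow> (nat \<Rightarrow> nat \<Rightarrow> real) \<Rightarrow> bool" where
  "irreducible_tm h P \<longleftrightarrow>
     (\<forall>u\<in>{1..h}. \<forall>v\<in>{1..h}. \<exists>k>0. (tmat h P ^\<^sub>m k) $$ (u - 1, v - 1) > 0)"

definition aperiodic_tm :: "nat \<Rightarrow> (nat \<Rightarrow> nat \<Rightarrow> real) \<Rightarrow> bool" where
  "aperiodic_tm h P \<longleftrightarrow>
     (\<forall>u\<in>{1..h}. Gcd {k. k > 0 \<and> (tmat h P ^\<^sub>m k) $$ (u - 1, u - 1) > 0} = 1)"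

definition stationary :: "nat \<Rightarrow> (nat \<Rightarrow> nat \<Rightarrow> real) \<Rightarrow> (nat \<Rightarrow> real) \<Rightarrow> bool" where
  "stationary h P \<pi> \<longleftrightarrow> (\<forall>u\<in>{1..h}. \<pi> u \<ge> 0) \<and> (\<Sum>u\<in>{1..h}. \<pi> u) = 1 \<and>
     (\<forall>v\<in>{1..h}. (\<Sum>u\<in>{1..h}. \<pi> u * P u v) = \<pi> v)"

text \<open>Homogeneous Markov chain m(0), m(1), ... (arbitrary initial law) with transition P.\<close>
definition hom_markov_chain ::
  "'w measure \<Rightarrow> nat \<Rightarrow> (nat \<Rightarrow> nat \<Rightarrow> real) \<Rightarrow> (nat \<Rightarrow> 'w \<Rightarrow> nat) \<Rightarrow> bool" where
  "hom_markov_chain Mp h P m \<longleftrightarrow>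
     (\<forall>t. m t \<in> measurable Mp (count_space UNIV)) \<and>
     (\<forall>t. \<forall>\<omega>\<in>space Mp. m t \<omega> \<in> {1..h}) \<and>
     (\<forall>t (s :: nat \<Rightarrow> nat).
        measure Mp {\<omega> \<in> space Mp. \<forall>k\<le>Suc t. m k \<omega> = s k}
        = measure Mp {\<omega> \<in> space Mp. \<forall>k\<le>t. m k \<omega> = s k} * P (s t) (s (Suc t)))"

text \<open>Squared Euclidean distance of x_i to the average of x_1..x_N.\<close>
definition cons_err :: "nat \<Rightarrow> nat \<Rightarrow> (nat \<Rightarrow> real vec) \<Rightarrow> nat \<Rightarrow> real" where
  "cons_err n N x i = (\<Sum>k<n. (x i $ k - (\<Sum>j\<in>{1..N}. x j $ k) / real N)\<^sup>2)"

end

theory Submission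
  imports Defs "HOL-Computational_Algebra.Fundamental_Theorem_Algebra"
begin

text \<open>
  The gains are chosen so that the output \<open>y\<^sub>i = K\<^sub>2 x\<^sub>i\<close> obeys the scalar recursion
  \<open>y\<^sub>i(t+1) = y\<^sub>i(t) + \<gamma>/(t+1) \<Sum>\<^sub>j (z\<^sub>i\<^sub>j(t) - y\<^sub>i(t))\<close>. Outputs and estimates stay in \<open>[-M, M]\<close>, so
  all second-order terms are \<open>O(1/t\<^sup>2)\<close> uniformly in the sample point.
  Let \<open>\<delta>\<close> be the deviation of \<open>y\<close> from its mean and \<open>e\<close> the vector of estimation errors. The drifts of
  \<open>E|\<delta>|\<^sup>2\<close> and \<open>E|e|\<^sup>2\<close> contain the factors \<open>L\<close> and \<open>1{j \<in> N\<^sub>i}\<close> evaluated at the current state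
  \<open>m(t)\<close> of the chain. Writing \<open>1{v = u} - \<pi>\<^sub>u = \<nu>(v) - (P \<nu>)(v)\<close> (Poisson equation), the Markov property
  turns the effect of replacing these factors by their stationary means into a telescoping term plus
  \<open>O(1/t)\<close>. Telescoping terms only perturb the Lyapunov function by \<open>O(1/t)\<close>, which costs neither the
  convergence nor the rate.
  The two averaged inequalities, with Young's inequality for the cross terms, form a linear system
  whose coupling matrix exceeds \<open>0\<close> (case (i)) or the identity (case (ii)) exactly under the stated
  lower bounds for \<open>\<beta>\<close>; hence a weighted
  sum \<open>X = E|\<delta>|\<^sup>2 + w E|e|\<^sup>2\<close> satisfies \<open>X(t+1) \<le> (1 - l/t) X(t) + \<dots>\<close> with \<open>l > 0\<close> in case (i) and
  \<open>l > 1\<close> in case (ii). Finally, the first component of \<open>x\<^sub>i\<close> minus the average solves a linear recurrence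
  with characteristic polynomial \<open>s\<^sup>n\<^sup>-\<^sup>1 + b\<^sub>n\<^sub>-\<^sub>1 s\<^sup>n\<^sup>-\<^sup>2 + \<dots> + b\<^sub>1\<close> and input \<open>\<delta>\<^sub>i\<close>, and the other components are
  its shifts.
\<close>

section \<open>Recursions with step size of order 1/t\<close>

text \<open>The active edge set and the errors are correlated through the past of the chain, and
  inactive pairs do not update, so nothing contracts in a single step; contraction holds only on
  average. This shapes the filtration: \<open>past t\<close> knows the chain up to and including t
  but the noises only before t, and \<open>e\<close> compares the output at t with the estimate of t
  - 1, so that it belongs to \<open>past t\<close> while the noise at t is still fresh. The outputs
  are driven by the estimate of time t instead; the discrepancy is O(1/t) and ends up in the
  second-order terms. The constants reflect how the cross terms are split. Of the mean dissipation 2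
  \<open>l2\<close> of the disagreement, \<open>l2\<close> pays for its cross term with the
  estimation error, at the price \<open>lG / l2\<close> on the other side. The split in the error
  drift is chosen to give the same price, which leaves \<open>al\<close>. The symmetric matrix with
  diagonal \<gamma> \<open>l2\<close>, 2 \<beta> \<open>fM\<close> \<open>pmin\<close> - \<gamma>
  \<open>al\<close> and off-diagonal -\<gamma> \<open>lG / l2\<close> must exceed l times the
  identity: (\<gamma> \<open>l2\<close> - l)(2 \<beta> \<open>fM\<close> \<open>pmin\<close> -
  \<gamma> \<open>al\<close> - l) > (\<gamma> \<open>lG / l2\<close>)^2 and \<gamma>
  \<open>l2\<close> > l, with l = 0 and l = 1 in the two cases.\<close>

lemma inverse_step_bound:
  assumes "t \<ge> (1::nat)"
  shows "1 / real t - 1 / real (Suc t) \<le> 1 / (real t)\<^sup>2" "0 \<le> 1 / real t - 1 / real (Suc t)"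
proof -
  have "1 / real t - 1 / real (Suc t) = 1 / (real t * real (Suc t))"
    using assms by (simp add: field_simps)
  also have "\<dots> \<le> 1 / (real t * real t)"
    using assms by (intro divide_left_mono mult_left_mono mult_pos_pos) auto
  finally show "1 / real t - 1 / real (Suc t) \<le> 1 / (real t)\<^sup>2" by (simp add: power2_eq_square)
  show "0 \<le> 1 / real t - 1 / real (Suc t)"
    using assms by (simp add: field_simps)
qed

text \<open>The product of the factors 1 - l/j behaves like t^(-l): 1 - l/t <= exp(-l/t), and ln(1 +
  1/t) <= 1/t turns the right-hand side into at most (t/(t+1))^l. The condition
  \<open>real T \<ge> l\<close> keeps the factors nonnegative, so that the inductive bound survives
  multiplication by them.\<close>

lemma decay_powr:
  fixes Z :: "nat \<Rightarrow> real"
  assumes l: "0 < l" and T: "T \<ge> 1" "real T \<ge> l"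
    and rec: "\<And>t. t \<ge> T \<Longrightarrow> Z (Suc t) \<le> (1 - l / real t) * Z t"
    and t: "t \<ge> T"
  shows "Z t \<le> max 0 (Z T) * (real T powr l) * real t powr (- l)"
  using t
proof (induction t rule: dec_induct)
  case base
  have "real T powr l * real T powr (-l) = 1"
    using T by (simp add: powr_minus field_simps)
  then show ?case by (simp add: mult.assoc)
next
  case (step t)
  have t: "real t \<ge> 1" "real t \<ge> l" "t \<ge> T" using step T by auto
  let ?K = "max 0 (Z T) * (real T powr l)"
  have K: "?K \<ge> 0" by simp
  have "ln (1 + 1 / real t) \<le> 1 / real t"
    using t by (intro ln_add_one_self_le_self) auto
  moreover have "real (Suc t) / real t = 1 + 1 / real t" using t by (simp add: field_simps)
  moreover have "ln (real (Suc t) / real t) = ln (real (Suc t)) - ln (real t)"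
    using t by (subst ln_div) auto
  ultimately have ln: "ln (real (Suc t)) - ln (real t) \<le> 1 / real t" by simp
  have "1 - l / real t \<le> exp (- (l / real t))"
    using exp_ge_add_one_self[of "- (l / real t)"] by simp
  also have "\<dots> \<le> exp (- l * (ln (real (Suc t)) - ln (real t)))"
    using mult_left_mono[OF ln, of l] l by simp
  also have "\<dots> = real (Suc t) powr (-l) * real t powr l"
    using t by (simp add: powr_def mult_exp_exp algebra_simps)
  finally have 1: "1 - l / real t \<le> real (Suc t) powr (-l) * real t powr l" .
  have 0: "0 \<le> 1 - l / real t" using t by (simp add: field_simps)
  have "Z (Suc t) \<le> (1 - l / real t) * Z t" using rec t by auto
  also have "\<dots> \<le> (1 - l / real t) * (?K * real t powr (-l))"
    using step.IH 0 by (intro mult_left_mono) auto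
  also have "\<dots> \<le> (real (Suc t) powr (-l) * real t powr l) * (?K * real t powr (-l))"
    using 1 K by (intro mult_right_mono) auto
  also have "\<dots> = ?K * real (Suc t) powr (-l) * (real t powr l * real t powr (-l))" by (simp add: ac_simps)
  also have "real t powr l * real t powr (-l) = 1"
    using t by (simp add: powr_minus field_simps)
  finally show ?case by simp
qed

text \<open>Summation by parts: moving G(t)/t into the unknown leaves only G(t+1)(1/t - 1/(t+1)) and
  l G(t)/t^2, both of order 1/t^2. A bounded telescoping perturbation with weight 1/t thus costs no
  more than the quadratic remainder that is already present.\<close>

lemma telescoping_shift:
  fixes X G :: "nat \<Rightarrow> real"
  assumes t: "t \<ge> 1" and l: "l \<ge> 0" and G: "\<bar>G t\<bar> \<le> B" "\<bar>G (Suc t)\<bar> \<le> B"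
    and rec: "X (Suc t) \<le> (1 - l / real t) * X t + (G (Suc t) - G t) / real t + C / (real t)\<^sup>2"
  shows "X (Suc t) - G (Suc t) / real (Suc t)
    \<le> (1 - l / real t) * (X t - G t / real t) + (C + B + l * B) / (real t)\<^sup>2"
proof -
  have "G (Suc t) * (1 / real t - 1 / real (Suc t)) \<le> \<bar>G (Suc t)\<bar> * (1 / real t - 1 / real (Suc t))"
    using inverse_step_bound[OF t] by (intro mult_right_mono) auto
  also have "\<dots> \<le> B * (1 / (real t)\<^sup>2)"
    using inverse_step_bound[OF t] G by (intro mult_mono) auto
  finally have 1: "G (Suc t) * (1 / real t - 1 / real (Suc t)) \<le> B / (real t)\<^sup>2" by simp
  have "- (l * B) \<le> l * G t"
    using mult_left_mono[of "-B" "G t" l] l G by auto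
  then have 2: "- (l * B) / (real t)\<^sup>2 \<le> l * G t / (real t)\<^sup>2" by (intro divide_right_mono) auto
  have "X (Suc t) - G (Suc t) / real (Suc t) \<le>
     (1 - l / real t) * X t - G t / real t + G (Suc t) * (1 / real t - 1 / real (Suc t)) + C / (real t)\<^sup>2"
    using rec by (simp add: diff_divide_distrib right_diff_distrib)
  also have "\<dots> \<le> (1 - l / real t) * X t - G t / real t + B / (real t)\<^sup>2 + C / (real t)\<^sup>2"
    using 1 by simp
  also have "\<dots> \<le> (1 - l / real t) * X t - G t / real t + B / (real t)\<^sup>2 + C / (real t)\<^sup>2
      + (l * B / (real t)\<^sup>2 + l * G t / (real t)\<^sup>2)"
    using 2 by simp
  also have "\<dots> = (1 - l / real t) * (X t - G t / real t) + (C + B + l * B) / (real t)\<^sup>2"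
    by (simp add: algebra_simps add_divide_distrib power2_eq_square)
  finally show ?thesis .
qed

theorem perturbed_recursion_tendsto_0:
  fixes X G :: "nat \<Rightarrow> real"
  assumes l: "0 < l" and nn: "\<And>t. X t \<ge> 0" and T: "T \<ge> 1"
    and G: "\<And>t. t \<ge> T \<Longrightarrow> \<bar>G t\<bar> \<le> B"
    and rec: "\<And>t. t \<ge> T \<Longrightarrow>
      X (Suc t) \<le> (1 - l / real t) * X t + (G (Suc t) - G t) / real t + C / (real t)\<^sup>2"
  shows "X \<longlonglongrightarrow> 0"
proof -
  \<comment> \<open>A smaller rate is admissible because X is nonnegative. The cap 1/2 keeps the
    homogeneous decay t^(-k) slower than 1/t, so that the forcing D/t^2 can be absorbed by a
    multiple of 1/t.\<close>
  define k where "k = min l (1/2)"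
  have k: "0 < k" "k \<le> 1/2" "k \<le> l" using l by (auto simp: k_def)
  define D where "D = \<bar>C\<bar> + B + k * B"
  have B: "B \<ge> 0" using G[of T] by simp
  have D: "D \<ge> 0" using B k by (simp add: D_def)
  define Y where "Y t = X t - G t / real t" for t
  define S where "S = Suc (max T 4)"
  have Yrec: "Y (Suc t) \<le> (1 - k / real t) * Y t + D / (real t)\<^sup>2" if t: "t \<ge> S" for t
  proof -
    have tt: "t \<ge> T" "t \<ge> 1" "t \<ge> 4" using t by (auto simp: S_def)
    have "X (Suc t) \<le> (1 - l / real t) * X t + (G (Suc t) - G t) / real t + C / (real t)\<^sup>2"
      using rec tt by auto
    also have "\<dots> \<le> (1 - k / real t) * X t + (G (Suc t) - G t) / real t + \<bar>C\<bar> / (real t)\<^sup>2"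
      using k nn[of t] by (intro add_mono mult_right_mono divide_right_mono) (auto intro: divide_right_mono)
    finally show ?thesis
      unfolding Y_def D_def using telescoping_shift[of t k G B X "\<bar>C\<bar>"] G tt k by auto
  qed
  \<comment> \<open>The added 4D/t makes the recursion homogeneous: with k <= 1/2 and t >= 4, D/t^2
    + 4Dk/t^2 <= 3D/t^2 <= 4D(1/t - 1/(t+1)).\<close>
  define Z where "Z t = Y t + (4 * D) / real t" for t
  have Zrec: "Z (Suc t) \<le> (1 - k / real t) * Z t" if t: "t \<ge> S" for t
  proof -
    have tt: "t \<ge> 4" using t by (auto simp: S_def)
    then have rt: "real t \<ge> 4" by simp
    have "4 * (real t)\<^sup>2 - (real t)\<^sup>2 - 2 * (real t)\<^sup>2 \<ge> 3 * real t"
      using rt mult_mono[of 4 "real t" "real t" "real t"] by (simp add: power2_eq_square)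
    then have "3 * (real t * (real t + 1)) \<le> 4 * (real t)\<^sup>2" by (simp add: power2_eq_square algebra_simps)
    then have "3 / (real t)\<^sup>2 \<le> 4 / (real t * real (Suc t))"
      using rt by (simp add: divide_simps power2_eq_square)
    also have "\<dots> = 4 / real t - 4 / real (Suc t)" using rt by (simp add: field_simps)
    finally have "D * (3 / (real t)\<^sup>2) \<le> D * (4 / real t - 4 / real (Suc t))"
      using D by (rule mult_left_mono)
    moreover have "4 * D * k / (real t)\<^sup>2 \<le> 2 * D / (real t)\<^sup>2"
      using k D mult_left_mono[of k "1/2" D] by (intro divide_right_mono) auto
    moreover have "D * (3 / (real t)\<^sup>2) = D / (real t)\<^sup>2 + 2 * D / (real t)\<^sup>2"
      by (simp add: add_divide_distrib[symmetric])
    moreover have "D * (4 / real t - 4 / real (Suc t)) = 4 * D / real t - 4 * D / real (Suc t)"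
      by (simp add: right_diff_distrib mult.commute)
    ultimately have *: "D / (real t)\<^sup>2 + 4 * D / real (Suc t) \<le> 4 * D / real t - 4 * D * k / (real t)\<^sup>2"
      by linarith
    have "Z (Suc t) \<le> (1 - k / real t) * Y t + (D / (real t)\<^sup>2 + 4 * D / real (Suc t))"
      using Yrec[OF t] by (simp add: Z_def)
    also have "\<dots> \<le> (1 - k / real t) * Y t + (4 * D / real t - 4 * D * k / (real t)\<^sup>2)"
      using * by simp
    also have "\<dots> = (1 - k / real t) * Z t"
      by (simp add: Z_def algebra_simps power2_eq_square diff_divide_distrib)
    finally show ?thesis .
  qed
  define K where "K = max 0 (Z S) * (real S powr k)"
  have Zb: "Z t \<le> K * real t powr (-k)" if "t \<ge> S" for t
    unfolding K_def using k Zrec that by (intro decay_powr) (auto simp: S_def)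
  have XK: "X t \<le> K * real t powr (-k) + B / real t" if t: "t \<ge> S" for t
  proof -
    have "T \<le> t" using t by (simp add: S_def)
    then have "G t / real t \<le> B / real t" using G[of t] by (intro divide_right_mono) auto
    moreover have "0 \<le> 4 * D / real t" using D by simp
    ultimately show ?thesis using Zb[OF t] unfolding Z_def Y_def by linarith
  qed
  have "(\<lambda>t. real t powr (-k)) \<longlonglongrightarrow> 0"
    using k by (intro tendsto_neg_powr filterlim_real_sequentially) auto
  then have "(\<lambda>t. K * real t powr (-k) + B / real t) \<longlonglongrightarrow> K * 0 + 0"
    by (intro tendsto_intros lim_const_over_n)
  then have lim: "(\<lambda>t. K * real t powr (-k) + B / real t) \<longlonglongrightarrow> 0" by simp
  show ?thesis
    by (rule tendsto_sandwich[OF _ _ tendsto_const lim])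
      (auto simp: nn eventually_sequentially intro!: XK exI[of _ S])
qed

text \<open>For l > 1 the sequence K/t is a supersolution as soon as (l - 1) K dominates the
  forcing: the surplus l - 1 of the decay over the rate 1/t pays for D/t^2.\<close>

theorem perturbed_recursion_bigo:
  fixes X G :: "nat \<Rightarrow> real"
  assumes l: "1 < l" and T: "T \<ge> 1"
    and G: "\<And>t. t \<ge> T \<Longrightarrow> \<bar>G t\<bar> \<le> B"
    and rec: "\<And>t. t \<ge> T \<Longrightarrow>
      X (Suc t) \<le> (1 - l / real t) * X t + (G (Suc t) - G t) / real t + C / (real t)\<^sup>2"
  shows "\<exists>K. \<forall>t\<ge>T. X t \<le> K / real t"
proof -
  define D where "D = \<bar>C\<bar> + B + l * B"
  have B: "B \<ge> 0" using G[of T] by simp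
  have D: "D \<ge> 0" using B l by (simp add: D_def)
  define Y where "Y t = X t - G t / real t" for t
  obtain S where S: "S \<ge> T" "real S \<ge> l"
    by (metis max.cobounded1 max.cobounded2 of_nat_le_iff real_arch_simple order_trans)
  have Yrec: "Y (Suc t) \<le> (1 - l / real t) * Y t + D / (real t)\<^sup>2" if t: "t \<ge> S" for t
  proof -
    have tt: "t \<ge> T" "t \<ge> 1" using t S T by auto
    have "X (Suc t) \<le> (1 - l / real t) * X t + (G (Suc t) - G t) / real t + C / (real t)\<^sup>2"
      using rec tt by auto
    also have "\<dots> \<le> (1 - l / real t) * X t + (G (Suc t) - G t) / real t + \<bar>C\<bar> / (real t)\<^sup>2"
      by (intro add_mono divide_right_mono) auto
    finally show ?thesis
      unfolding Y_def D_def using telescoping_shift[of t l G B X "\<bar>C\<bar>"] G tt l by auto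
  qed
  \<comment> \<open>The first entry makes K/t a supersolution, the second starts the induction at
    S.\<close>
  define K where "K = max (D / (l - 1)) (real S * Y S)"
  have K: "D / (l - 1) \<le> K" "real S * Y S \<le> K" by (auto simp: K_def)
  have K0: "K \<ge> 0" using K(1) D l by (meson diff_gt_0_iff_gt divide_nonneg_pos order_trans)
  have DK: "D \<le> (l - 1) * K" using K(1) l by (simp add: field_simps)
  have Yb: "Y t \<le> K / real t" if "t \<ge> S" for t
    using that
  proof (induction t rule: dec_induct)
    case base
    then show ?case using K S T by (simp add: field_simps)
  next
    case (step t)
    have t: "real t \<ge> 1" "real t \<ge> l" "t \<ge> S" using step S T by auto
    have "Y (Suc t) \<le> (1 - l / real t) * Y t + D / (real t)\<^sup>2" using Yrec t by auto
    also have "\<dots> \<le> (1 - l / real t) * (K / real t) + (l - 1) * K / (real t)\<^sup>2"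
      using step.IH t DK by (intro add_mono mult_left_mono divide_right_mono) (auto simp: field_simps)
    also have "\<dots> = K * (1 / real t - 1 / (real t)\<^sup>2)"
      using t by (simp add: field_simps power2_eq_square)
    also have "\<dots> \<le> K * (1 / real (Suc t))"
      using inverse_step_bound[of t] t K0 by (intro mult_left_mono) auto
    finally show ?case by simp
  qed
  \<comment> \<open>The sum covers the finitely many times before S, where 1 - l/t may still be
    negative; K + B accounts for the shift by G(t)/t.\<close>
  define K' where "K' = max 0 (K + B) + (\<Sum>t\<in>{T..<S}. \<bar>X t\<bar> * real t)"
  have "X t \<le> K' / real t" if t: "t \<ge> T" for t
  proof (cases "t \<ge> S")
    case True
    have "G t / real t \<le> B / real t" using G[of t] t by (intro divide_right_mono) auto
    then have "X t \<le> (K + B) / real t" using Yb[OF True] by (simp add: Y_def add_divide_distrib)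
    also have "\<dots> \<le> K' / real t"
      unfolding K'_def by (intro divide_right_mono add_increasing2 sum_nonneg) auto
    finally show ?thesis .
  next
    case False
    have "X t * real t \<le> \<bar>X t\<bar> * real t" by (intro mult_right_mono) auto
    also have "\<dots> \<le> (\<Sum>t\<in>{T..<S}. \<bar>X t\<bar> * real t)"
      using False t by (intro member_le_sum) auto
    also have "\<dots> \<le> K'" by (simp add: K'_def)
    finally show ?thesis using t T by (simp add: field_simps)
  qed
  then show ?thesis by blast
qed

section \<open>Operator norms\<close>

lemma opnorm_bdd_above:
  assumes "finite R" "finite C"
  shows "bdd_above {sqrt (\<Sum>r\<in>R. (\<Sum>c\<in>C. A r c * x c)\<^sup>2) | x. (\<Sum>c\<in>C. (x c)\<^sup>2) \<le> (1::real)}"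
proof (rule bdd_aboveI, safe)
  fix x :: "'b \<Rightarrow> real" assume x: "(\<Sum>c\<in>C. (x c)\<^sup>2) \<le> 1"
  show "sqrt (\<Sum>r\<in>R. (\<Sum>c\<in>C. A r c * x c)\<^sup>2) \<le> sqrt (\<Sum>r\<in>R. (\<Sum>c\<in>C. (A r c)\<^sup>2))"
  proof (intro real_sqrt_le_mono sum_mono)
    fix r
    have "(\<Sum>c\<in>C. A r c * x c)\<^sup>2 \<le> (\<Sum>c\<in>C. (A r c)\<^sup>2) * (\<Sum>c\<in>C. (x c)\<^sup>2)"
      by (rule Cauchy_Schwarz_ineq_sum)
    also have "\<dots> \<le> (\<Sum>c\<in>C. (A r c)\<^sup>2) * 1"
      using x by (intro mult_left_mono sum_nonneg) auto
    finally show "(\<Sum>c\<in>C. A r c * x c)\<^sup>2 \<le> (\<Sum>c\<in>C. (A r c)\<^sup>2)" by simp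
  qed
qed

lemma opnorm_upper:
  assumes "finite R" "finite C" "(\<Sum>c\<in>C. (x c)\<^sup>2) \<le> 1"
  shows "sqrt (\<Sum>r\<in>R. (\<Sum>c\<in>C. A r c * x c)\<^sup>2) \<le> opnorm R C A"
  unfolding opnorm_def using assms by (intro cSup_upper opnorm_bdd_above) auto

lemma opnorm_bound:
  assumes fin: "finite R" "finite C"
  shows "sqrt (\<Sum>r\<in>R. (\<Sum>c\<in>C. A r c * x c)\<^sup>2) \<le> opnorm R C A * sqrt (\<Sum>c\<in>C. (x c)\<^sup>2)"
proof (cases "(\<Sum>c\<in>C. (x c)\<^sup>2) = 0")
  case True
  then have "\<forall>c\<in>C. x c = 0" using fin by (subst (asm) sum_nonneg_eq_0_iff) auto
  then show ?thesis by (simp cong: sum.cong)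
next
  case False
  define q where "q = sqrt (\<Sum>c\<in>C. (x c)\<^sup>2)"
  have q2: "q\<^sup>2 = (\<Sum>c\<in>C. (x c)\<^sup>2)" unfolding q_def by (simp add: sum_nonneg)
  have q: "q > 0" using False by (simp add: q_def sum_nonneg order_less_le)
  have "(\<Sum>c\<in>C. (x c / q)\<^sup>2) = 1"
    using q by (simp add: power_divide sum_divide_distrib[symmetric] q2[symmetric])
  then have "sqrt (\<Sum>r\<in>R. (\<Sum>c\<in>C. A r c * (x c / q))\<^sup>2) \<le> opnorm R C A"
    using fin by (intro opnorm_upper) auto
  also have "(\<Sum>r\<in>R. (\<Sum>c\<in>C. A r c * (x c / q))\<^sup>2) = (\<Sum>r\<in>R. (\<Sum>c\<in>C. A r c * x c)\<^sup>2) / q\<^sup>2"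
    by (simp add: sum_divide_distrib[symmetric] power_divide)
  finally show ?thesis using q unfolding q_def[symmetric] by (simp add: real_sqrt_divide field_simps)
qed

lemma Cauchy_Schwarz_sqrt:
  fixes v w :: "'a \<Rightarrow> real"
  shows "\<bar>\<Sum>r\<in>R. v r * w r\<bar> \<le> sqrt (\<Sum>r\<in>R. (v r)\<^sup>2) * sqrt (\<Sum>r\<in>R. (w r)\<^sup>2)"
proof -
  have "sqrt ((\<Sum>r\<in>R. v r * w r)\<^sup>2) \<le> sqrt ((\<Sum>r\<in>R. (v r)\<^sup>2) * (\<Sum>r\<in>R. (w r)\<^sup>2))"
    by (intro real_sqrt_le_mono Cauchy_Schwarz_ineq_sum)
  then show ?thesis by (simp add: real_sqrt_mult)
qed

lemma bilinear_form_le_opnorm: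
  assumes fin: "finite R" "finite C"
  shows "\<bar>\<Sum>r\<in>R. v r * (\<Sum>c\<in>C. A r c * x c)\<bar>
    \<le> opnorm R C A * sqrt (\<Sum>r\<in>R. (v r)\<^sup>2) * sqrt (\<Sum>c\<in>C. (x c)\<^sup>2)"
proof -
  have "\<bar>\<Sum>r\<in>R. v r * (\<Sum>c\<in>C. A r c * x c)\<bar>
     \<le> sqrt (\<Sum>r\<in>R. (v r)\<^sup>2) * sqrt (\<Sum>r\<in>R. (\<Sum>c\<in>C. A r c * x c)\<^sup>2)"
    by (rule Cauchy_Schwarz_sqrt)
  also have "\<dots> \<le> sqrt (\<Sum>r\<in>R. (v r)\<^sup>2) * (opnorm R C A * sqrt (\<Sum>c\<in>C. (x c)\<^sup>2))"
    using fin by (intro mult_left_mono opnorm_bound) (auto simp: sum_nonneg)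
  finally show ?thesis by (simp add: ac_simps)
qed

text \<open>The constants \<open>lamG\<close>, \<open>lamQW\<close> and \<open>lamQL\<close> are
  maxima of squared norms over the topologies, so their square roots bound the form for whichever
  topology is active.\<close>

lemma bilinear_form_le_Max_opnorm:
  assumes fin: "finite R" "finite C" and U: "finite U" "u \<in> U"
  shows "\<bar>\<Sum>r\<in>R. v r * (\<Sum>c\<in>C. A u r c * x c)\<bar>
    \<le> sqrt (Max ((\<lambda>u. (opnorm R C (A u))\<^sup>2) ` U)) * sqrt (\<Sum>r\<in>R. (v r)\<^sup>2) * sqrt (\<Sum>c\<in>C. (x c)\<^sup>2)"
proof -
  have "(opnorm R C (A u))\<^sup>2 \<le> Max ((\<lambda>u. (opnorm R C (A u))\<^sup>2) ` U)" using U by (intro Max_ge) auto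
  then have "opnorm R C (A u) \<le> sqrt (Max ((\<lambda>u. (opnorm R C (A u))\<^sup>2) ` U))"
    by (rule real_le_rsqrt)
  then have "opnorm R C (A u) * sqrt (\<Sum>r\<in>R. (v r)\<^sup>2) * sqrt (\<Sum>c\<in>C. (x c)\<^sup>2)
      \<le> sqrt (Max ((\<lambda>u. (opnorm R C (A u))\<^sup>2) ` U)) * sqrt (\<Sum>r\<in>R. (v r)\<^sup>2) * sqrt (\<Sum>c\<in>C. (x c)\<^sup>2)"
    by (intro mult_right_mono) (auto simp: sum_nonneg)
  with bilinear_form_le_opnorm[OF fin, of v "A u" x] show ?thesis by linarith
qed

section \<open>The spectral gap of a connected Laplacian\<close>

text \<open>Compactness gives a minimizer v of the quadratic form on the unit sphere of the sum-zero
  subspace. It is an eigenvector because the residual g = Lv - \<mu>v is itself sum-zero, hence an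
  admissible variation, and minimality along v - \<tau>g leaves no room for a nonzero |g|^2. This
  single eigenpair is all that the spectral gap requires.\<close>

lemma Rayleigh_minimizer:
  fixes L :: "nat \<Rightarrow> nat \<Rightarrow> real"
  assumes N: "N \<ge> 2"
    and sym: "\<And>i j. i < N \<Longrightarrow> j < N \<Longrightarrow> L i j = L j i"
    and rows: "\<And>i. i < N \<Longrightarrow> (\<Sum>j<N. L i j) = 0"
  obtains v \<mu> where "(\<Sum>i<N. (v i)\<^sup>2) = 1" "(\<Sum>i<N. v i) = 0"
    "\<And>i. i < N \<Longrightarrow> (\<Sum>j<N. L i j * v j) = \<mu> * v i"
    "\<And>w. (\<Sum>i<N. w i) = 0 \<Longrightarrow> \<mu> * (\<Sum>i<N. (w i)\<^sup>2) \<le> (\<Sum>i<N. w i * (\<Sum>j<N. L i j * w j))"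
proof -
  define q :: "(nat \<Rightarrow> real) \<Rightarrow> real" where "q w = (\<Sum>i<N. w i * (\<Sum>j<N. L i j * w j))" for w
  \<comment> \<open>Coordinates from N on are fixed at 0, so that S is a closed part of a product of
    compact sets.\<close>
  define S :: "(nat \<Rightarrow> real) set" where
    "S = (PiE UNIV (\<lambda>i. if i < N then {-1..1} else {0})) \<inter> {w. (\<Sum>i<N. w i) = 0} \<inter> {w. (\<Sum>i<N. (w i)\<^sup>2) = 1}"
  have c1: "compact (PiE UNIV (\<lambda>i. if i < N then {-1..1} else {0::real}))"
    unfolding compactin_euclidean_iff[symmetric] euclidean_product_topology[symmetric] compactin_PiE
    by (auto simp: compactin_euclidean_iff)
  have cont: "continuous_on A (\<lambda>w::nat \<Rightarrow> real. w i)" for i A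
    by (rule continuous_on_subset[OF continuous_on_product_coordinates]) auto
  have c2: "closed {w::nat\<Rightarrow>real. (\<Sum>i<N. w i) = 0}" "closed {w::nat\<Rightarrow>real. (\<Sum>i<N. (w i)\<^sup>2) = 1}"
    by (intro closed_Collect_eq continuous_intros cont)+
  have cS: "compact S" unfolding S_def by (intro compact_Int_closed c1 c2)
  have nS: "S \<noteq> {}"
  proof -
    define w :: "nat \<Rightarrow> real" where "w i = (if i = 0 then 1 / sqrt 2 else if i = 1 then - 1 / sqrt 2 else 0)" for i
    have s: "{..<N} = insert 0 (insert 1 {2..<N})" using N by auto
    have z: "(\<Sum>i\<in>{2..<N}. g (w i)) = 0" if "g 0 = 0" for g :: "real \<Rightarrow> real"
      using that by (intro sum.neutral) (auto simp: w_def)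
    have "(\<Sum>i<N. w i) = 0" using z[of "\<lambda>x. x"] unfolding s by (simp add: w_def)
    moreover have "(\<Sum>i<N. (w i)\<^sup>2) = 1"
      using z[of "\<lambda>x. x\<^sup>2"] unfolding s by (simp add: w_def power_divide)
    moreover have "w i \<in> (if i < N then {-1..1} else {0})" for i
      using N by (auto simp: w_def intro: order_trans[of _ 0])
    ultimately have "w \<in> S" by (auto simp: S_def)
    then show ?thesis by auto
  qed
  have "continuous_on S q" unfolding q_def by (intro continuous_intros cont)
  from continuous_attains_inf[OF cS nS this]
  obtain v where v: "v \<in> S" "\<And>w. w \<in> S \<Longrightarrow> q v \<le> q w" by auto
  define \<mu> where "\<mu> = q v"
  have v1: "(\<Sum>i<N. (v i)\<^sup>2) = 1" and v0: "(\<Sum>i<N. v i) = 0" using v by (auto simp: S_def)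
  \<comment> \<open>Homogeneity carries minimality from the sphere to all sum-zero vectors; the
    rescaled vector is cut off beyond N in order to lie in S.\<close>
  have min: "\<mu> * (\<Sum>i<N. (w i)\<^sup>2) \<le> q w" if w: "(\<Sum>i<N. w i) = 0" for w
  proof (cases "(\<Sum>i<N. (w i)\<^sup>2) = 0")
    case True
    then have "\<forall>i<N. w i = 0" by (subst (asm) sum_nonneg_eq_0_iff) auto
    then show ?thesis using True by (simp add: q_def)
  next
    case False
    define r where "r = sqrt (\<Sum>i<N. (w i)\<^sup>2)"
    have r2: "r\<^sup>2 = (\<Sum>i<N. (w i)\<^sup>2)" unfolding r_def by (simp add: sum_nonneg)
    have r: "r > 0" using False by (simp add: r_def sum_nonneg order_less_le)
    define w' where "w' i = (if i < N then w i / r else 0)" for i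
    have e1: "(\<Sum>i<N. (w' i)\<^sup>2) = 1"
      using r by (simp add: w'_def power_divide sum_divide_distrib[symmetric] r2[symmetric])
    have "(w' i)\<^sup>2 \<le> 1" if "i < N" for i
      unfolding e1[symmetric] using that by (intro member_le_sum) auto
    then have e2: "\<bar>w' i\<bar> \<le> 1" if "i < N" for i using that by (simp add: abs_square_le_1)
    have "w' i \<in> (if i < N then {-1..1} else {0})" for i
      using e2[of i] by (auto simp: abs_le_iff) (auto simp: w'_def)
    moreover have "(\<Sum>i<N. w' i) = 0"
      using w by (simp add: w'_def sum_divide_distrib[symmetric])
    ultimately have "w' \<in> S" using e1 by (auto simp: S_def)
    then have "\<mu> \<le> q w'" using v by (simp add: \<mu>_def)
    also have "q w' = q w / r\<^sup>2"
      unfolding q_def w'_def sum_divide_distrib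
      by (intro sum.cong refl) (simp add: sum_divide_distrib[symmetric] power2_eq_square)
    finally show ?thesis using r unfolding r2[symmetric] by (simp add: field_simps)
  qed
  define Lv where "Lv i = (\<Sum>j<N. L i j * v j)" for i
  define g where "g i = Lv i - \<mu> * v i" for i
  \<comment> \<open>Symmetry turns zero row sums into zero column sums, so L maps into the sum-zero
    subspace.\<close>
  have "(\<Sum>i<N. Lv i) = (\<Sum>j<N. (\<Sum>i<N. L i j) * v j)"
    unfolding Lv_def sum_distrib_right by (rule sum.swap)
  also have "\<dots> = 0"
  proof (rule sum.neutral, safe)
    fix j assume j: "j < N"
    have "(\<Sum>i<N. L i j) = (\<Sum>i<N. L j i)" using j by (intro sum.cong refl sym) auto
    then show "(\<Sum>i<N. L i j) * v j = 0" using rows[OF j] by simp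
  qed
  finally have Lv0: "(\<Sum>i<N. Lv i) = 0" .
  have g0: "(\<Sum>i<N. g i) = 0"
    unfolding g_def sum_subtractf Lv0 sum_distrib_left[symmetric] v0 by simp
  define G where "G = (\<Sum>i<N. (g i)\<^sup>2)"
  have symf: "(\<Sum>i<N. v i * (\<Sum>j<N. L i j * g j)) = (\<Sum>i<N. g i * Lv i)"
  proof -
    have "(\<Sum>i<N. v i * (\<Sum>j<N. L i j * g j)) = (\<Sum>i<N. \<Sum>j<N. v i * L i j * g j)"
      by (simp add: sum_distrib_left ac_simps)
    also have "\<dots> = (\<Sum>j<N. \<Sum>i<N. v i * L i j * g j)" by (rule sum.swap)
    also have "\<dots> = (\<Sum>j<N. \<Sum>i<N. g j * (L j i * v i))"
      by (intro sum.cong refl) (simp add: sym ac_simps)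
    also have "\<dots> = (\<Sum>i<N. g i * Lv i)" by (simp add: Lv_def sum_distrib_left)
    finally show ?thesis .
  qed
  have expand: "q (\<lambda>i. v i - \<tau> * g i) = \<mu> - 2 * \<tau> * (\<Sum>i<N. g i * Lv i) + \<tau>\<^sup>2 * q g" for \<tau>
  proof -
    have "(\<Sum>j<N. L i j * (v j - \<tau> * g j)) = Lv i - \<tau> * (\<Sum>j<N. L i j * g j)" for i
      by (simp add: Lv_def sum_subtractf right_diff_distrib sum_distrib_left ac_simps)
    then have "q (\<lambda>i. v i - \<tau> * g i) = (\<Sum>i<N. (v i - \<tau> * g i) * (Lv i - \<tau> * (\<Sum>j<N. L i j * g j)))"
      unfolding q_def by simp
    also have "\<dots> = (\<Sum>i<N. v i * Lv i - \<tau> * (v i * (\<Sum>j<N. L i j * g j)) - \<tau> * (g i * Lv i)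
        + \<tau>\<^sup>2 * (g i * (\<Sum>j<N. L i j * g j)))"
      by (intro sum.cong refl) (simp add: algebra_simps power2_eq_square)
    also have "\<dots> = (\<Sum>i<N. v i * Lv i) - \<tau> * (\<Sum>i<N. v i * (\<Sum>j<N. L i j * g j))
         - \<tau> * (\<Sum>i<N. g i * Lv i) + \<tau>\<^sup>2 * (\<Sum>i<N. g i * (\<Sum>j<N. L i j * g j))"
      by (simp only: sum.distrib sum_subtractf sum_distrib_left)
    also have "\<dots> = \<mu> - 2 * \<tau> * (\<Sum>i<N. g i * Lv i) + \<tau>\<^sup>2 * q g"
      unfolding symf by (simp add: \<mu>_def q_def Lv_def)
    finally show ?thesis .
  qed
  have expand2: "(\<Sum>i<N. (v i - \<tau> * g i)\<^sup>2) = 1 - 2 * \<tau> * (\<Sum>i<N. g i * v i) + \<tau>\<^sup>2 * G" for \<tau>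
  proof -
    have "(\<Sum>i<N. (v i - \<tau> * g i)\<^sup>2) = (\<Sum>i<N. (v i)\<^sup>2 - 2 * \<tau> * (g i * v i) + \<tau>\<^sup>2 * (g i)\<^sup>2)"
      by (intro sum.cong refl) (simp add: algebra_simps power2_eq_square)
    also have "\<dots> = (\<Sum>i<N. (v i)\<^sup>2) - 2 * \<tau> * (\<Sum>i<N. g i * v i) + \<tau>\<^sup>2 * (\<Sum>i<N. (g i)\<^sup>2)"
      by (simp only: sum.distrib sum_subtractf sum_distrib_left)
    finally show ?thesis by (simp add: v1 G_def)
  qed
  have Gd: "G = (\<Sum>i<N. g i * Lv i) - \<mu> * (\<Sum>i<N. g i * v i)"
    unfolding G_def sum_distrib_left sum_subtractf[symmetric]
    by (intro sum.cong refl) (simp add: g_def power2_eq_square algebra_simps)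
  \<comment> \<open>Minimality at v - \<tau>g: by \<open>Gd\<close> the first-order gain is
    2\<tau>|g|^2, so it must be dominated by the second-order term for every \<tau>.\<close>
  have key: "2 * \<tau> * G \<le> \<tau>\<^sup>2 * (q g - \<mu> * G)" for \<tau>
  proof -
    have "(\<Sum>i<N. v i - \<tau> * g i) = 0"
      by (simp add: sum_subtractf v0 g0 sum_distrib_left[symmetric])
    from min[OF this] show ?thesis unfolding expand expand2 Gd by (simp add: algebra_simps)
  qed
  have "G \<le> 0"
  proof (rule ccontr)
    assume "\<not> G \<le> 0"
    \<comment> \<open>D is any positive bound of the second-order coefficient; at \<tau> = G/D the
      linear term wins unless G <= 0.\<close>
    define D where "D = \<bar>q g - \<mu> * G\<bar> + 1"
    have D: "D > 0" "q g - \<mu> * G \<le> D" by (auto simp: D_def)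
    have "2 * (G / D) * G \<le> (G / D)\<^sup>2 * D"
      using key[of "G / D"] mult_left_mono[OF D(2), of "(G / D)\<^sup>2"] by simp
    then have "2 * (G * G / D) \<le> G * G / D" using D by (simp add: power2_eq_square)
    then have "G * G / D \<le> 0" by simp
    then show False using \<open>\<not> G \<le> 0\<close> D by (simp add: divide_le_0_iff mult_le_0_iff)
  qed
  moreover have "G \<ge> 0" by (simp add: G_def sum_nonneg)
  ultimately have "G = 0" by simp
  then have "\<forall>i<N. g i = 0" unfolding G_def by (subst (asm) sum_nonneg_eq_0_iff) auto
  then have eig: "\<And>i. i < N \<Longrightarrow> (\<Sum>j<N. L i j * v j) = \<mu> * v i" by (simp add: g_def Lv_def)
  show ?thesis by (rule that[of v \<mu>]) (use v1 v0 eig min in \<open>auto simp: q_def\<close>)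
qed

text \<open>Adding all rows of XI - A to the first produces a row of X's, because the columns of A
  sum to 0, and X factors out of the determinant. At 0 the remaining factor is the determinant of -L
  with its first row replaced by ones; a kernel vector of that matrix is sum-zero and annihilated by
  all rows of L but the first, hence by all. So 0 is a root of multiplicity one, which matters
  because \<open>lam2\<close> is read off a list of roots with multiplicity.\<close>

lemma char_poly_simple_zero:
  fixes L :: "nat \<Rightarrow> nat \<Rightarrow> real"
  assumes N: "N \<ge> 1"
    and cols: "\<And>j. j < N \<Longrightarrow> (\<Sum>i<N. L i j) = 0"
    and ker: "\<And>v. (\<And>i. i < N \<Longrightarrow> (\<Sum>j<N. L i j * v j) = 0) \<Longrightarrow> (\<Sum>i<N. v i) = 0 \<Longrightarrow> (\<forall>i<N. v i = 0)"
  defines "A \<equiv> mat N N (\<lambda>(i, j). L i j)"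
  shows "\<exists>q. char_poly A = [:0, 1:] * q \<and> poly q 0 \<noteq> 0"
proof -
  let ?X = "[:0, 1 :: real:]"
  define C where "C = char_poly_matrix A"
  have A: "A \<in> carrier_mat N N" by (simp add: A_def)
  have C: "C \<in> carrier_mat N N" using A by (simp add: C_def)
  have Cij: "C $$ (i, j) = (if i = j then ?X else 0) + [: - L i j :]" if "i < N" "j < N" for i j
    using that A by (auto simp: C_def char_poly_matrix_def A_def)
  \<comment> \<open>The row operation as a factorization R C = Dg M: R adds the rows, Dg carries the
    extracted X in its corner, and both are triangular.\<close>
  define R :: "real poly mat" where "R = mat N N (\<lambda>(i, j). if i = 0 \<or> i = j then 1 else 0)"
  define Dg :: "real poly mat" where "Dg = mat N N (\<lambda>(i, j). if i = j then (if i = 0 then ?X else 1) else 0)"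
  define M :: "real poly mat" where "M = mat N N (\<lambda>(i, j). if i = 0 then 1 else C $$ (i, j))"
  have car: "R \<in> carrier_mat N N" "Dg \<in> carrier_mat N N" "M \<in> carrier_mat N N"
    by (auto simp: R_def Dg_def M_def)
  have RC: "R * C = Dg * M"
  proof (rule eq_matI)
    fix i j assume "i < dim_row (Dg * M)" "j < dim_col (Dg * M)"
    then have ij: "i < N" "j < N" using car by auto
    have 1: "(R * C) $$ (i, j) = (\<Sum>k<N. R $$ (i, k) * C $$ (k, j))"
      using ij car C by (auto simp: scalar_prod_def atLeast0LessThan intro!: sum.cong)
    have 2: "(Dg * M) $$ (i, j) = (\<Sum>k<N. Dg $$ (i, k) * M $$ (k, j))"
      using ij car by (auto simp: scalar_prod_def atLeast0LessThan intro!: sum.cong)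
    have "(Dg * M) $$ (i, j) = (\<Sum>k<N. if k = i then (if i = 0 then ?X else 1) * M $$ (i, j) else 0)"
      unfolding 2 using ij by (intro sum.cong refl) (auto simp: Dg_def)
    also have "\<dots> = (if i = 0 then ?X else 1) * M $$ (i, j)" using ij by simp
    finally have 3: "(Dg * M) $$ (i, j) = (if i = 0 then ?X else 1) * M $$ (i, j)" .
    show "(R * C) $$ (i, j) = (Dg * M) $$ (i, j)"
    proof (cases "i = 0")
      case True
      have "(R * C) $$ (i, j) = (\<Sum>k<N. (if k = j then ?X else 0) + [: - L k j :])"
        unfolding 1 using ij True by (intro sum.cong refl) (auto simp: R_def Cij)
      also have "\<dots> = ?X + (\<Sum>k<N. [: - L k j :])" using ij by (simp add: sum.distrib)
      also have "(\<Sum>k<N. [: - L k j :]) = [: - (\<Sum>k<N. L k j) :]"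
        by (induction N) auto
      finally show ?thesis using cols[OF ij(2)] True ij unfolding 3 by (simp add: M_def)
    next
      case False
      have "(R * C) $$ (i, j) = (\<Sum>k<N. if k = i then C $$ (i, j) else 0)"
        unfolding 1 using ij False by (intro sum.cong refl) (auto simp: R_def)
      then show ?thesis using ij False unfolding 3 by (simp add: M_def)
    qed
  qed (use car C in auto)
  have "det R = prod_list (diag_mat R)"
    by (rule det_upper_triangular[OF _ car(1)]) (auto simp: R_def upper_triangular_def)
  also have "\<dots> = 1" by (intro prod_list_neutral) (auto simp: diag_mat_def R_def)
  finally have dR: "det R = 1" .
  have "det Dg = prod_list (diag_mat Dg)"
    by (rule det_upper_triangular[OF _ car(2)]) (auto simp: Dg_def upper_triangular_def)
  also have "diag_mat Dg = map (\<lambda>i. if i = 0 then ?X else 1) [0..<N]"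
    by (auto simp: diag_mat_def Dg_def)
  also have "[0..<N] = 0 # [1..<N]" using N by (simp add: upt_conv_Cons)
  also have "prod_list (map (\<lambda>i. if i = 0 then ?X else 1) (0 # [1..<N])) = ?X"
  proof -
    have "prod_list (map (\<lambda>i. if i = 0 then ?X else 1) [1..<N]) = 1"
      by (intro prod_list_neutral) auto
    then show ?thesis by simp
  qed
  finally have dD: "det Dg = ?X" .
  have "det R * det C = det Dg * det M"
    using RC det_mult[OF car(1) C] det_mult[OF car(2) car(3)] by simp
  then have cp: "char_poly A = ?X * det M" by (simp add: dR dD char_poly_def C_def)
  define M0 where "M0 = mat N N (\<lambda>(i, j). if i = 0 then 1 else - L i j)"
  have M0: "M0 \<in> carrier_mat N N" by (simp add: M0_def)
  have "poly (det M) 0 = det M0"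
    by (rule poly_det_cong[OF M0 car(3)]) (auto simp: M_def M0_def Cij)
  moreover have "det M0 \<noteq> 0"
  proof
    assume "det M0 = 0"
    then obtain w where w: "w \<in> carrier_vec N" "w \<noteq> 0\<^sub>v N" "M0 *\<^sub>v w = 0\<^sub>v N"
      using det_0_iff_vec_prod_zero[OF M0] by auto
    have row: "(\<Sum>j<N. M0 $$ (i, j) * w $ j) = 0" if i: "i < N" for i
    proof -
      have "(M0 *\<^sub>v w) $ i = (\<Sum>j<N. M0 $$ (i, j) * w $ j)"
        using i w(1) M0 by (auto simp: scalar_prod_def atLeast0LessThan intro!: sum.cong)
      then show ?thesis using w(3) i by simp
    qed
    have s0: "(\<Sum>j<N. w $ j) = 0" using row[of 0] N by (simp add: M0_def)
    have r: "(\<Sum>j<N. L i j * w $ j) = 0" if "i < N" "i \<noteq> 0" for i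
      using row[OF that(1)] that by (simp add: M0_def sum_negf)
    \<comment> \<open>Since the columns of L sum to 0, the equation for row 0 follows from those for
      the other rows.\<close>
    have "(\<Sum>i<N. \<Sum>j<N. L i j * w $ j) = (\<Sum>j<N. (\<Sum>i<N. L i j) * w $ j)"
      unfolding sum_distrib_right by (rule sum.swap)
    also have "\<dots> = 0" using cols by simp
    finally have "(\<Sum>i<N. \<Sum>j<N. L i j * w $ j) = 0" .
    moreover have "(\<Sum>i<N. \<Sum>j<N. L i j * w $ j) = (\<Sum>j<N. L 0 j * w $ j)
        + (\<Sum>i\<in>{..<N} - {0}. \<Sum>j<N. L i j * w $ j)"
      using N by (intro sum.remove) auto
    moreover have "(\<Sum>i\<in>{..<N} - {0}. \<Sum>j<N. L i j * w $ j) = 0"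
      using r by (intro sum.neutral) auto
    ultimately have "(\<Sum>j<N. L 0 j * w $ j) = 0" by simp
    then have "\<forall>i<N. w $ i = 0" using r by (intro ker s0) metis
    then have "w = 0\<^sub>v N" using w(1) by (intro eq_vecI) auto
    then show False using w by simp
  qed
  ultimately show ?thesis using cp by metis
qed

text \<open>Once the factor X is split off the characteristic polynomial, the remaining roots are
  positive, and the minimal Rayleigh quotient \<mu> is one of them. Entry 1 of the sorted list is
  then the least of these roots, and l2 <= \<mu> gives the inequality without any
  diagonalization.\<close>

theorem second_eigenvalue_spectral_gap:
  fixes L :: "nat \<Rightarrow> nat \<Rightarrow> real"
  assumes N: "N \<ge> 2"
    and sym: "\<And>i j. i < N \<Longrightarrow> j < N \<Longrightarrow> L i j = L j i"
    and rows: "\<And>i. i < N \<Longrightarrow> (\<Sum>j<N. L i j) = 0"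
    and psd: "\<And>v. 0 \<le> (\<Sum>i<N. v i * (\<Sum>j<N. L i j * v j))"
    and ker: "\<And>v. (\<And>i. i < N \<Longrightarrow> (\<Sum>j<N. L i j * v j) = 0) \<Longrightarrow> (\<Sum>i<N. v i) = 0 \<Longrightarrow> (\<forall>i<N. v i = 0)"
  defines "A \<equiv> mat N N (\<lambda>(i, j). L i j)"
  defines "l2 \<equiv> sorted_list_of_multiset (proots (char_poly A)) ! 1"
  shows "l2 > 0" "\<And>w. (\<Sum>i<N. w i) = 0 \<Longrightarrow> l2 * (\<Sum>i<N. (w i)\<^sup>2) \<le> (\<Sum>i<N. w i * (\<Sum>j<N. L i j * w j))"
proof -
  have A: "A \<in> carrier_mat N N" by (simp add: A_def)
  have Av: "(A *\<^sub>v w) $ i = (\<Sum>j<N. L i j * w $ j)" if "i < N" "w \<in> carrier_vec N" for i w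
    using that by (auto simp: A_def scalar_prod_def atLeast0LessThan intro!: sum.cong)
  have cols: "(\<Sum>i<N. L i j) = 0" if j: "j < N" for j
  proof -
    have "(\<Sum>i<N. L i j) = (\<Sum>i<N. L j i)" using j by (intro sum.cong refl sym) auto
    then show ?thesis using rows[OF j] by simp
  qed
  obtain q where q: "char_poly A = [:0, 1:] * q" "poly q 0 \<noteq> 0"
    using char_poly_simple_zero[of N L] N cols ker unfolding A_def by auto
  have q0: "q \<noteq> 0" using q by auto
  obtain v \<mu> where v: "(\<Sum>i<N. (v i)\<^sup>2) = 1" "(\<Sum>i<N. v i) = 0"
    "\<And>i. i < N \<Longrightarrow> (\<Sum>j<N. L i j * v j) = \<mu> * v i"
    and min: "\<And>w. (\<Sum>i<N. w i) = 0 \<Longrightarrow> \<mu> * (\<Sum>i<N. (w i)\<^sup>2) \<le> (\<Sum>i<N. w i * (\<Sum>j<N. L i j * w j))"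
    using Rayleigh_minimizer[OF N sym rows] by blast
  have "\<mu> \<noteq> 0"
  proof
    assume "\<mu> = 0"
    then have "\<forall>i<N. v i = 0" using v by (intro ker) auto
    then show False using v(1) by simp
  qed
  have "eigenvector A (vec N v) \<mu>"
  proof -
    have "A *\<^sub>v vec N v = \<mu> \<cdot>\<^sub>v vec N v"
      using v(3) Av[of _ "vec N v"] by (intro eq_vecI) (auto simp: A_def)
    moreover have "vec N v \<noteq> 0\<^sub>v N"
    proof
      assume "vec N v = 0\<^sub>v N"
      then have "\<forall>i<N. v i = 0" by (metis index_vec index_zero_vec(1))
      then show False using v(1) by simp
    qed
    ultimately show ?thesis using A by (auto simp: eigenvector_def)
  qed
  then have root\<mu>: "poly (char_poly A) \<mu> = 0"
    using eigenvalue_root_char_poly[OF A] by (auto simp: eigenvalue_def)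
  then have q\<mu>: "poly q \<mu> = 0" using q \<open>\<mu> \<noteq> 0\<close> by simp
  have nonneg: "k \<ge> 0" if k: "poly (char_poly A) k = 0" for k
  proof -
    obtain w where w: "w \<in> carrier_vec N" "w \<noteq> 0\<^sub>v N" "A *\<^sub>v w = k \<cdot>\<^sub>v w"
      using k eigenvalue_root_char_poly[OF A] A by (auto simp: eigenvalue_def eigenvector_def)
    have e: "(\<Sum>j<N. L i j * w $ j) = k * w $ i" if "i < N" for i
      using Av[OF that w(1)] w that by simp
    have "0 \<le> (\<Sum>i<N. w $ i * (\<Sum>j<N. L i j * w $ j))" by (rule psd)
    also have "\<dots> = k * (\<Sum>i<N. (w $ i)\<^sup>2)"
      unfolding sum_distrib_left[of k] by (intro sum.cong refl) (simp add: e power2_eq_square)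
    finally have 1: "0 \<le> k * (\<Sum>i<N. (w $ i)\<^sup>2)" .
    have "(\<Sum>i<N. (w $ i)\<^sup>2) \<noteq> 0"
    proof
      assume "(\<Sum>i<N. (w $ i)\<^sup>2) = 0"
      then have "\<forall>i<N. w $ i = 0" by (subst (asm) sum_nonneg_eq_0_iff) auto
      then have "w = 0\<^sub>v N" using w(1) by (intro eq_vecI) auto
      then show False using w by simp
    qed
    moreover have "(\<Sum>i<N. (w $ i)\<^sup>2) \<ge> 0" by (simp add: sum_nonneg)
    ultimately show ?thesis using 1 by (simp add: zero_le_mult_iff)
  qed
  have qpos: "k > 0" if "poly q k = 0" for k
    using nonneg[of k] that q by (cases "k = 0") auto
  define l where "l = sorted_list_of_multiset (proots q)"
  have setl: "set l = {k. poly q k = 0}" using q0 by (simp add: l_def)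
  have sl: "sorted l" by (simp add: l_def)
  have "proots (char_poly A) = {#0#} + proots q"
    unfolding q(1) using q0 by (subst proots_mult) auto
  then have "sorted_list_of_multiset (proots (char_poly A)) = insort 0 l"
    by (simp add: l_def)
  \<comment> \<open>All roots of q are positive, so the root 0 that was split off heads the list and
    index 1 points to the least root of q.\<close>
  also have "\<dots> = 0 # l"
  proof -
    have "\<forall>k\<in>set l. 0 \<le> k" using setl qpos less_imp_le by auto
    then show ?thesis by (cases l) auto
  qed
  finally have l2: "l2 = l ! 0" by (simp add: l2_def)
  have \<mu>l: "\<mu> \<in> set l" using q\<mu> setl by simp
  then obtain l0 ls where l: "l = l0 # ls" by (cases l) auto
  then have l20: "l2 = l0" by (simp add: l2)
  show "l2 > 0" using qpos setl l l20 by auto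
  have le: "l2 \<le> \<mu>" using \<mu>l sl l l20 by auto
  show "l2 * (\<Sum>i<N. (w i)\<^sup>2) \<le> (\<Sum>i<N. w i * (\<Sum>j<N. L i j * w j))" if "(\<Sum>i<N. w i) = 0" for w
  proof -
    have "l2 * (\<Sum>i<N. (w i)\<^sup>2) \<le> \<mu> * (\<Sum>i<N. (w i)\<^sup>2)"
      using le by (intro mult_right_mono sum_nonneg) auto
    then show ?thesis using min[OF that] by linarith
  qed
qed

section \<open>Irreducible Markov chains and the Poisson equation\<close>

lemma tmat_carrier [simp]: "tmat h P \<in> carrier_mat h h"
  by (simp add: tmat_def)

lemma tmat_power_closed:
  assumes cl: "\<And>u v. u \<in> S \<Longrightarrow> v < h \<Longrightarrow> P (u + 1) (v + 1) \<noteq> 0 \<Longrightarrow> v \<in> S"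
    and S: "S \<subseteq> {..<h}" "u \<in> S"
  shows "v < h \<Longrightarrow> (tmat h P ^\<^sub>m k) $$ (u, v) \<noteq> 0 \<Longrightarrow> v \<in> S"
proof (induction k arbitrary: v)
  case 0
  then show ?case using S by (auto simp: tmat_def split: if_splits)
next
  case (Suc k)
  have pc: "tmat h P ^\<^sub>m k \<in> carrier_mat h h" by (rule pow_carrier_mat) simp
  have u: "u < h" using S by auto
  have "(tmat h P ^\<^sub>m Suc k) $$ (u, v) = (\<Sum>w\<in>{0..<h}. (tmat h P ^\<^sub>m k) $$ (u, w) * tmat h P $$ (w, v))"
    using pc u Suc.prems(1) by (auto simp: scalar_prod_def tmat_def intro!: sum.cong)
  with Suc.prems(2) obtain w where w: "w < h" "(tmat h P ^\<^sub>m k) $$ (u, w) \<noteq> 0" "tmat h P $$ (w, v) \<noteq> 0"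
    by (metis (no_types, lifting) atLeastLessThan_iff mult_eq_0_iff sum.neutral)
  have "w \<in> S" using Suc.IH w by auto
  moreover have "P (w + 1) (v + 1) \<noteq> 0" using w Suc.prems by (simp add: tmat_def)
  ultimately show ?case using cl Suc.prems by auto
qed

text \<open>A nonzero entry of a matrix power needs a path of nonzero transitions, and such a path
  cannot leave a closed set. The shift by 1 translates states counted from 1 into matrix indices
  counted from 0.\<close>

lemma irreducible_closed_set:
  assumes irr: "irreducible_tm h P"
    and S: "S \<subseteq> {1..h}" "S \<noteq> {}"
    and cl: "\<And>u v. u \<in> S \<Longrightarrow> v \<in> {1..h} \<Longrightarrow> P u v \<noteq> 0 \<Longrightarrow> v \<in> S"
  shows "S = {1..h}"
proof (rule antisym[OF S(1)], rule subsetI)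
  fix v assume v: "v \<in> {1..h}"
  obtain u where u: "u \<in> S" using S by auto
  then obtain k where k: "(tmat h P ^\<^sub>m k) $$ (u - 1, v - 1) > 0"
    using irr v S unfolding irreducible_tm_def by blast
  have "v - 1 \<in> (\<lambda>u. u - 1) ` S"
  proof (rule tmat_power_closed[where h = h and P = P and k = k])
    show "w \<in> (\<lambda>u. u - 1) ` S" if u': "u' \<in> (\<lambda>u. u - 1) ` S" and w: "w < h" and nz: "P (u' + 1) (w + 1) \<noteq> 0" for u' w
    proof -
      obtain x where x: "x \<in> S" "u' = x - 1" using u' by (rule imageE)
      then have "x \<ge> 1" using S by auto
      then have "w + 1 \<in> S" using cl[of x "w + 1"] x w nz by auto
      then show ?thesis by force
    qed
    show "(\<lambda>u. u - 1) ` S \<subseteq> {..<h}"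
      by (intro subsetI, elim imageE) (auto dest!: subsetD[OF S(1)])
    show "u - 1 \<in> (\<lambda>u. u - 1) ` S" using u by (rule imageI)
    show "v - 1 < h" using v by auto
    show "(tmat h P ^\<^sub>m k) $$ (u - 1, v - 1) \<noteq> 0" using k by simp
  qed
  then obtain x where x: "x \<in> S" "v - 1 = x - 1" by blast
  moreover have "x \<ge> 1" using S x by auto
  moreover have "v \<ge> 1" using v by simp
  ultimately have "v = x" by linarith
  then show "v \<in> S" using x by simp
qed

text \<open>The support of \<pi> is nonempty and closed under transitions, since mass at u is passed
  on to every v with \<open>P u v \<noteq> 0\<close>.\<close>

lemma stationary_pos:
  assumes "stochastic h P" "irreducible_tm h P" "stationary h P \<pi>" "v \<in> {1..h}"
  shows "\<pi> v > 0"
proof -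
  have nn: "\<And>u. u \<in> {1..h} \<Longrightarrow> \<pi> u \<ge> 0" and s1: "(\<Sum>u\<in>{1..h}. \<pi> u) = 1"
    and st: "\<And>v. v \<in> {1..h} \<Longrightarrow> (\<Sum>u\<in>{1..h}. \<pi> u * P u v) = \<pi> v"
    using assms(3) by (auto simp: stationary_def)
  have P: "\<And>u v. u \<in> {1..h} \<Longrightarrow> v \<in> {1..h} \<Longrightarrow> P u v \<ge> 0"
    using assms(1) by (auto simp: stochastic_def)
  have "{u \<in> {1..h}. \<pi> u > 0} = {1..h}"
  proof (rule irreducible_closed_set[OF assms(2)])
    show "{u \<in> {1..h}. \<pi> u > 0} \<noteq> {}"
    proof
      assume "{u \<in> {1..h}. \<pi> u > 0} = {}"
      then have "(\<Sum>u\<in>{1..h}. \<pi> u) = 0" using nn by (intro sum.neutral) (auto simp: less_le)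
      then show False using s1 by simp
    qed
    fix u v assume u: "u \<in> {u \<in> {1..h}. \<pi> u > 0}" and v: "v \<in> {1..h}" and p: "P u v \<noteq> 0"
    have "0 < \<pi> u * P u v" using u v p P[of u v] by (auto simp: less_le)
    also have "\<dots> \<le> (\<Sum>u\<in>{1..h}. \<pi> u * P u v)"
      using u v P nn by (intro member_le_sum) auto
    also have "\<dots> = \<pi> v" using st v by simp
    finally show "v \<in> {u \<in> {1..h}. \<pi> u > 0}" using v by simp
  qed auto
  then show ?thesis using assms(4) by blast
qed

text \<open>Maximum principle: where f attains its maximum, being an average of its successors
  forces all of them to attain it too, so the set of maximizers is closed under transitions.\<close>

lemma harmonic_constant:
  fixes f :: "nat \<Rightarrow> real"
  assumes h: "h \<ge> 1" and st: "stochastic h P" and irr: "irreducible_tm h P"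
    and harm: "\<And>u. u \<in> {1..h} \<Longrightarrow> (\<Sum>v\<in>{1..h}. P u v * f v) = f u"
    and u: "u \<in> {1..h}" "v \<in> {1..h}"
  shows "f u = f v"
proof -
  have P: "\<And>u v. u \<in> {1..h} \<Longrightarrow> v \<in> {1..h} \<Longrightarrow> P u v \<ge> 0"
    and P1: "\<And>u. u \<in> {1..h} \<Longrightarrow> (\<Sum>v\<in>{1..h}. P u v) = 1"
    using st by (auto simp: stochastic_def)
  define mx where "mx = Max (f ` {1..h})"
  have le: "f u \<le> mx" if "u \<in> {1..h}" for u using that by (simp add: mx_def)
  have "mx \<in> f ` {1..h}" unfolding mx_def using h by (intro Max_in) auto
  have "{u \<in> {1..h}. f u = mx} = {1..h}"
  proof (rule irreducible_closed_set[OF irr])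
    show "{u \<in> {1..h}. f u = mx} \<noteq> {}" using \<open>mx \<in> f ` {1..h}\<close> by auto
    fix x w assume x: "x \<in> {u \<in> {1..h}. f u = mx}" and w: "w \<in> {1..h}" and p: "P x w \<noteq> 0"
    have x': "x \<in> {1..h}" "f x = mx" using x by auto
    have "(\<Sum>v\<in>{1..h}. P x v * (mx - f v)) = mx * (\<Sum>v\<in>{1..h}. P x v) - (\<Sum>v\<in>{1..h}. P x v * f v)"
      by (simp add: right_diff_distrib sum_subtractf sum_distrib_left ac_simps)
    also have "\<dots> = 0" using P1[OF x'(1)] harm[OF x'(1)] x' by simp
    finally have "\<forall>v\<in>{1..h}. P x v * (mx - f v) = 0"
      using P[OF x'(1)] le by (subst (asm) sum_nonneg_eq_0_iff) auto
    then show "w \<in> {u \<in> {1..h}. f u = mx}" using w p by auto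
  qed auto
  then have "f x = mx" if "x \<in> {1..h}" for x using that by blast
  then show ?thesis using u by simp
qed

text \<open>I - P is singular, its kernel being the constants; adding the rank-one matrix all of
  whose rows are \<pi> makes it invertible. Averaging the perturbed equation against \<pi> shows
  that the added term equals the mean of g, which is 0, so the solution also solves the unperturbed
  equation.\<close>

theorem Poisson_equation:
  fixes g :: "nat \<Rightarrow> real"
  assumes h: "h \<ge> 1" and st: "stochastic h P" and irr: "irreducible_tm h P" and sta: "stationary h P \<pi>"
    and g: "(\<Sum>u\<in>{1..h}. \<pi> u * g u) = 0"
  obtains \<nu> where "\<And>u. u \<in> {1..h} \<Longrightarrow> \<nu> u - (\<Sum>v\<in>{1..h}. P u v * \<nu> v) = g u"
proof -
  have s1: "(\<Sum>u\<in>{1..h}. \<pi> u) = 1"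
    and st': "\<And>v. v \<in> {1..h} \<Longrightarrow> (\<Sum>u\<in>{1..h}. \<pi> u * P u v) = \<pi> v"
    using sta by (auto simp: stationary_def)
  define A where "A = mat h h (\<lambda>(u, v). (if u = v then 1 else 0) - P (u + 1) (v + 1) + \<pi> (v + 1))"
  have A: "A \<in> carrier_mat h h" by (simp add: A_def)
  have shift: "(\<Sum>v\<in>{0..<h}. F (v + 1)) = (\<Sum>v\<in>{1..h}. F v)" for F :: "nat \<Rightarrow> real"
    by (rule sum.reindex_bij_witness[of _ "\<lambda>v. v - 1" "\<lambda>v. v + 1"]) auto
  have Ax: "(A *\<^sub>v w) $ u = f (u + 1) - (\<Sum>v\<in>{1..h}. P (u + 1) v * f v) + (\<Sum>v\<in>{1..h}. \<pi> v * f v)"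
    if w: "w \<in> carrier_vec h" and u: "u < h" and f: "\<And>v. v < h \<Longrightarrow> w $ v = f (v + 1)" for w f u
  proof -
    have "(A *\<^sub>v w) $ u = (\<Sum>v\<in>{0..<h}. ((if u = v then 1 else 0) - P (u + 1) (v + 1) + \<pi> (v + 1)) * w $ v)"
      using w u by (auto simp: A_def scalar_prod_def intro!: sum.cong)
    also have "\<dots> = (\<Sum>v\<in>{0..<h}. (if u = v then f (u + 1) else 0) - P (u + 1) (v + 1) * f (v + 1) + \<pi> (v + 1) * f (v + 1))"
      using f by (intro sum.cong refl) (auto simp: algebra_simps)
    also have "\<dots> = f (u + 1) - (\<Sum>v\<in>{0..<h}. P (u + 1) (v + 1) * f (v + 1)) + (\<Sum>v\<in>{0..<h}. \<pi> (v + 1) * f (v + 1))"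
      using u by (simp add: sum.distrib sum_subtractf)
    finally show ?thesis
      using shift[of "\<lambda>v. P (u + 1) v * f v"] shift[of "\<lambda>v. \<pi> v * f v"] by simp
  qed
  \<comment> \<open>Stationarity cancels f - Pf under \<pi>, so that only the constant m
    survives.\<close>
  have mean: "(\<Sum>u\<in>{1..h}. \<pi> u * (f u - (\<Sum>v\<in>{1..h}. P u v * f v) + m)) = m" for f m
  proof -
    have "(\<Sum>u\<in>{1..h}. \<pi> u * (f u - (\<Sum>v\<in>{1..h}. P u v * f v) + m))
        = (\<Sum>u\<in>{1..h}. \<pi> u * f u) - (\<Sum>u\<in>{1..h}. \<Sum>v\<in>{1..h}. \<pi> u * P u v * f v) + (\<Sum>u\<in>{1..h}. \<pi> u) * m"
      by (simp add: algebra_simps sum.distrib sum_subtractf sum_distrib_left sum_distrib_right)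
    also have "(\<Sum>u\<in>{1..h}. \<Sum>v\<in>{1..h}. \<pi> u * P u v * f v) = (\<Sum>v\<in>{1..h}. (\<Sum>u\<in>{1..h}. \<pi> u * P u v) * f v)"
      unfolding sum_distrib_right by (rule sum.swap)
    also have "\<dots> = (\<Sum>v\<in>{1..h}. \<pi> v * f v)" using st' by simp
    finally show ?thesis unfolding s1 by simp
  qed
  have "det A \<noteq> 0"
  proof
    assume "det A = 0"
    then obtain w where w: "w \<in> carrier_vec h" "w \<noteq> 0\<^sub>v h" "A *\<^sub>v w = 0\<^sub>v h"
      using det_0_iff_vec_prod_zero[OF A] by auto
    define f where "f v = w $ (v - 1)" for v
    define m where "m = (\<Sum>v\<in>{1..h}. \<pi> v * f v)"
    have e: "f u - (\<Sum>v\<in>{1..h}. P u v * f v) + m = 0" if u: "u \<in> {1..h}" for u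
      using Ax[OF w(1), of "u - 1" f] w(3) u unfolding m_def by (auto simp: f_def)
    have "m = 0" using mean[of f m] e by simp
    then have "\<And>u. u \<in> {1..h} \<Longrightarrow> (\<Sum>v\<in>{1..h}. P u v * f v) = f u" using e by simp
    then have const: "f u = f 1" if "u \<in> {1..h}" for u
      using harmonic_constant[OF h st irr, of f u 1] that h by auto
    have "m = (\<Sum>v\<in>{1..h}. \<pi> v * f 1)" unfolding m_def by (intro sum.cong refl arg_cong2[where f = "(*)"] const)
    then have "f 1 = 0" using \<open>m = 0\<close> unfolding sum_distrib_right[symmetric] s1 by simp
    then have "w $ v = 0" if "v < h" for v using const[of "v + 1"] that by (simp add: f_def)
    then have "w = 0\<^sub>v h" using w(1) by (intro eq_vecI) auto
    then show False using w by simp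
  qed
  then obtain B where B: "B \<in> carrier_mat h h" "A * B = 1\<^sub>m h"
    using det_non_zero_imp_unit[OF A] by (auto simp: Units_def ring_mat_def)
  define w where "w = B *\<^sub>v vec h (\<lambda>v. g (v + 1))"
  have w: "w \<in> carrier_vec h" using B by (simp add: w_def)
  have Aw: "A *\<^sub>v w = vec h (\<lambda>v. g (v + 1))"
    unfolding w_def using A B by (subst assoc_mult_mat_vec[symmetric, of _ h h _ h]) auto
  define f where "f v = w $ (v - 1)" for v
  define m where "m = (\<Sum>v\<in>{1..h}. \<pi> v * f v)"
  have e: "f u - (\<Sum>v\<in>{1..h}. P u v * f v) + m = g u" if u: "u \<in> {1..h}" for u
    using Ax[OF w(1), of "u - 1" f] Aw u unfolding m_def by (auto simp: f_def)
  have "m = 0" using mean[of f m] e g by simp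
  then show ?thesis using that[of f] e by simp
qed

section \<open>Conditioning on the past of the chain and the noise\<close>

lemma vimage_algebraI:
  "A \<in> sets N \<Longrightarrow> S = f -` A \<inter> X \<Longrightarrow> S \<in> sets (vimage_algebra X f N)"
  by (simp add: in_vimage_algebra)

text \<open>Dynkin's argument: the sets on which the two integrals agree are closed under
  complements and countable disjoint unions, so a generator stable under intersection
  suffices.\<close>

lemma set_integral_eq_sigma_sets:
  fixes f g :: "'a \<Rightarrow> real"
  assumes int: "integrable M f" "integrable M g"
    and G: "G \<subseteq> sets M" "Int_stable G" "space M \<in> G"
    and eq: "\<And>A. A \<in> G \<Longrightarrow> (\<integral>x\<in>A. f x \<partial>M) = (\<integral>x\<in>A. g x \<partial>M)"
    and A: "A \<in> sigma_sets (space M) G"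
  shows "(\<integral>x\<in>A. f x \<partial>M) = (\<integral>x\<in>A. g x \<partial>M)"
proof -
  have Gp: "G \<subseteq> Pow (space M)" using G(1) sets.space_closed by blast
  have sub: "sigma_sets (space M) G \<subseteq> sets M" using G(1) by (rule sets.sigma_sets_subset)
  have sint: "set_integrable M B k" if "B \<in> sets M" "integrable M k" for B and k :: "'a \<Rightarrow> real"
    unfolding set_integrable_def using that by (intro integrable_mult_indicator)
  have full: "(\<integral>x. f x \<partial>M) = (\<integral>x. g x \<partial>M)"
    using eq[OF G(3)] int by (simp add: set_integral_space)
  have cmpl: "(\<integral>x\<in>space M - B. k x \<partial>M) = (\<integral>x. k x \<partial>M) - (\<integral>x\<in>B. k x \<partial>M)"
    if B: "B \<in> sets M" and k: "integrable M k" for B and k :: "'a \<Rightarrow> real"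
  proof -
    have "(\<integral>x\<in>space M - B. k x \<partial>M) + (\<integral>x\<in>B. k x \<partial>M) = (\<integral>x\<in>(space M - B) \<union> B. k x \<partial>M)"
      using B k by (intro set_integral_Un[symmetric] sint) auto
    also have "(space M - B) \<union> B = space M" using sets.sets_into_space[OF B] by auto
    finally show ?thesis using k by (simp add: set_integral_space)
  qed
  show ?thesis
    using G(2) Gp A
  proof (induction rule: sigma_sets_induct_disjoint)
    case (basic A)
    then show ?case by (rule eq)
  next
    case empty
    then show ?case by (simp add: set_lebesgue_integral_def)
  next
    case (compl A)
    then show ?case using cmpl[of A] sub int full by auto
  next
    case (union A)
    have Ai: "\<And>i. A i \<in> sets M" using union sub by auto
    have "(\<integral>x\<in>(\<Union>i. A i). k x \<partial>M) = (\<Sum>i. \<integral>x\<in>A i. k x \<partial>M)" if "integrable M k" for k :: "'a \<Rightarrow> real"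
      using Ai union(1) that by (intro lebesgue_integral_countable_add sint) (auto simp: disjoint_family_on_def)
    then show ?case using int union by simp
  qed
qed

text \<open>Freezing argument: by independence, the joint law of the sample point (seen through F)
  and D is a product, so Fubini integrates D out with \<phi> and y held fixed, and the indicator
  becomes a distribution function.\<close>

lemma (in prob_space) integral_indep_threshold:
  fixes D \<phi> y :: "'a \<Rightarrow> real"
  assumes sub: "subalgebra M F"
    and D: "D \<in> borel_measurable M"
    and ind: "indep_set (sets F) (sigma_sets (space M) {D -` A \<inter> space M | A. A \<in> sets borel})"
    and \<phi>: "\<phi> \<in> borel_measurable F" and y: "y \<in> borel_measurable F"
    and bd: "\<And>\<omega>. \<omega> \<in> space M \<Longrightarrow> \<bar>\<phi> \<omega>\<bar> \<le> B"
  shows "(\<integral>\<omega>. \<phi> \<omega> * (if y \<omega> + D \<omega> \<le> c then 1 else 0) \<partial>M)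
       = (\<integral>\<omega>. \<phi> \<omega> * measure (distr M borel D) {..c - y \<omega>} \<partial>M)"
proof -
  note [measurable] = D \<phi> y
  have sp: "space F = space M" and st: "sets F \<subseteq> sets M" using sub by (auto simp: subalgebra_def)
  have idm [measurable]: "(\<lambda>x. x) \<in> measurable M F"
    using sp st sets.sets_into_space by (intro measurableI) (auto simp: Int_absorb2 subset_iff)
  \<comment> \<open>The identity map into F restricts the measure to the sub-sigma-algebra; this
    image is what makes independence of a sigma-algebra expressible as a product measure.\<close>
  define MF where "MF = distr M F (\<lambda>x. x)"
  define MD where "MD = distr M borel D"
  interpret MF: prob_space MF unfolding MF_def by (rule prob_space_distr) simp
  interpret MD: prob_space MD unfolding MD_def by (rule prob_space_distr) simp
  interpret PP: pair_prob_space MF MD ..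
  have sMF [measurable_cong]: "sets MF = sets F" and sMD [measurable_cong]: "sets MD = sets borel"
    by (auto simp: MF_def MD_def)
  have prod: "MF \<Otimes>\<^sub>M MD = distr M (F \<Otimes>\<^sub>M borel) (\<lambda>x. (x, D x))"
  proof (rule pair_measure_eqI)
    fix A B assume A: "A \<in> sets MF" and B: "B \<in> sets MD"
    have AM: "A \<in> sets M" using A st sMF by auto
    have "prob (A \<inter> (D -` B \<inter> space M)) = prob A * prob (D -` B \<inter> space M)"
      using A B sMF sMD by (intro indep_setD[OF ind] sigma_sets.Basic) auto
    moreover have "(\<lambda>x. (x, D x)) -` (A \<times> B) \<inter> space M = A \<inter> (D -` B \<inter> space M)"
      using sets.sets_into_space[OF AM] by auto
    moreover have "(\<lambda>x. x) -` A \<inter> space M = A" using sets.sets_into_space[OF AM] by auto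
    ultimately show "emeasure MF A * emeasure MD B = emeasure (distr M (F \<Otimes>\<^sub>M borel) (\<lambda>x. (x, D x))) (A \<times> B)"
      using A B sMF sMD by (simp add: MF_def MD_def emeasure_distr emeasure_eq_measure ennreal_mult)
  qed (use sMF sMD in \<open>auto simp: MF.sigma_finite_measure_axioms MD.sigma_finite_measure_axioms cong: sets_pair_measure_cong\<close>)
  define g where "g = (\<lambda>(\<omega>, r). \<phi> \<omega> * (if y \<omega> + r \<le> c then 1 else 0 :: real))"
  have gm: "g \<in> borel_measurable (F \<Otimes>\<^sub>M borel)" unfolding g_def by measurable
  have gm': "g \<in> borel_measurable (MF \<Otimes>\<^sub>M MD)" unfolding g_def by measurable
  have B0: "B \<ge> 0" using bd not_empty by (metis abs_ge_zero ex_in_conv order_trans)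
  have gi: "integrable (MF \<Otimes>\<^sub>M MD) g"
  proof (rule PP.integrable_const_bound[of _ B])
    show "AE x in MF \<Otimes>\<^sub>M MD. norm (g x) \<le> B"
      using bd B0 by (intro AE_I2) (auto simp: g_def space_pair_measure MF_def sp)
  qed (rule gm')
  have "(\<integral>\<omega>. \<phi> \<omega> * (if y \<omega> + D \<omega> \<le> c then 1 else 0) \<partial>M) = (\<integral>\<omega>. g (\<omega>, D \<omega>) \<partial>M)"
    by (simp add: g_def)
  also have "\<dots> = (\<integral>z. g z \<partial>distr M (F \<Otimes>\<^sub>M borel) (\<lambda>x. (x, D x)))"
    by (subst integral_distr[OF _ gm]) auto
  also have "\<dots> = (\<integral>z. g z \<partial>(MF \<Otimes>\<^sub>M MD))" unfolding prod ..
  also have "\<dots> = (\<integral>\<omega>. (\<integral>r. g (\<omega>, r) \<partial>MD) \<partial>MF)"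
    using gi by (rule PP.integral_fst'[symmetric])
  also have "\<dots> = (\<integral>\<omega>. \<phi> \<omega> * measure MD {..c - y \<omega>} \<partial>MF)"
  proof (rule Bochner_Integration.integral_cong[OF refl])
    fix \<omega>
    have "(\<lambda>r. g (\<omega>, r)) = (\<lambda>r. \<phi> \<omega> * indicator {..c - y \<omega>} r)"
      by (auto simp: g_def indicator_def fun_eq_iff)
    then show "(\<integral>r. g (\<omega>, r) \<partial>MD) = \<phi> \<omega> * measure MD {..c - y \<omega>}" by (simp add: MD_def)
  qed
  also have "\<dots> = (\<integral>\<omega>. \<phi> \<omega> * measure MD {..c - y \<omega>} \<partial>M)"
  proof -
    have "(\<lambda>\<omega>. \<integral>r. g (\<omega>, r) \<partial>MD) \<in> borel_measurable MF"
      using gm' by measurable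
    moreover have "(\<lambda>\<omega>. \<integral>r. g (\<omega>, r) \<partial>MD) = (\<lambda>\<omega>. \<phi> \<omega> * measure MD {..c - y \<omega>})"
    proof
      fix \<omega>
      have "(\<lambda>r. g (\<omega>, r)) = (\<lambda>r. \<phi> \<omega> * indicator {..c - y \<omega>} r)"
        by (auto simp: g_def indicator_def fun_eq_iff)
      then show "(\<integral>r. g (\<omega>, r) \<partial>MD) = \<phi> \<omega> * measure MD {..c - y \<omega>}" by (simp add: MD_def)
    qed
    ultimately have "(\<lambda>\<omega>. \<phi> \<omega> * measure MD {..c - y \<omega>}) \<in> borel_measurable F"
      by (simp add: MF_def)
    then show ?thesis unfolding MF_def by (intro integral_distr idm)
  qed
  finally show ?thesis by (simp add: MD_def)
qed

locale markov_noise = prob_space M for M :: "'w measure" +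
  fixes h :: nat and P :: "nat \<Rightarrow> nat \<Rightarrow> real" and m :: "nat \<Rightarrow> 'w \<Rightarrow> nat"
    and I :: "'p set" and D :: "'p \<Rightarrow> nat \<Rightarrow> 'w \<Rightarrow> real"
  assumes chain: "hom_markov_chain M h P m"
    and noise_indep: "indep_vars (\<lambda>_. borel) (\<lambda>(p, t). D p t) (I \<times> UNIV)"
    and chain_noise_indep:
      "indep_set
         (sets (vimage_algebra (space M) (\<lambda>\<omega> t. m t \<omega>) (Pi\<^sub>M UNIV (\<lambda>_. count_space UNIV))))
         (sets (vimage_algebra (space M)
            (\<lambda>\<omega>. restrict (\<lambda>(p, t). D p t \<omega>) (I \<times> UNIV)) (Pi\<^sub>M (I \<times> UNIV) (\<lambda>_. borel))))"
begin

definition chain_algebra :: "'w set set" where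
  "chain_algebra = sets (vimage_algebra (space M) (\<lambda>\<omega> t. m t \<omega>) (Pi\<^sub>M UNIV (\<lambda>_. count_space UNIV)))"

definition noise_algebra :: "'w set set" where
  "noise_algebra = sets (vimage_algebra (space M)
     (\<lambda>\<omega>. restrict (\<lambda>(p, t). D p t \<omega>) (I \<times> UNIV)) (Pi\<^sub>M (I \<times> UNIV) (\<lambda>_. borel)))"

text \<open>An arbitrary predicate Q is harmless: only finitely many paths up to t exist, so each
  such set is a finite union of cylinders.\<close>

definition chain_events :: "nat \<Rightarrow> 'w set set" where
  "chain_events t = {{\<omega> \<in> space M. Q (restrict (\<lambda>k. m k \<omega>) {..t})} | Q. True}"

definition noise_events :: "nat \<Rightarrow> 'w set set" where
  "noise_events t = {(\<lambda>\<omega>. restrict (\<lambda>(p, k). D p k \<omega>) (I \<times> {..<t})) -` B \<inter> space M | B.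
     B \<in> sets (Pi\<^sub>M (I \<times> {..<t}) (\<lambda>_. borel))}"

definition past_generator :: "nat \<Rightarrow> 'w set set" where
  "past_generator t = {A \<inter> B | A B. A \<in> chain_events t \<and> B \<in> noise_events t}"

text \<open>The asymmetry is deliberate: the chain is included up to time t, the noise only before
  t. The topology at t is thus known when the drift at t is evaluated, while the noise at t remains
  independent.\<close>

definition past :: "nat \<Rightarrow> 'w measure" where
  "past t = sigma (space M) (past_generator t)"

lemma chain_eventsI: "S = {\<omega> \<in> space M. Q (restrict (\<lambda>k. m k \<omega>) {..t})} \<Longrightarrow> S \<in> chain_events t"
  unfolding chain_events_def by (intro CollectI exI[of _ Q]) simp

lemma noise_eventsI:
  "B \<in> sets (Pi\<^sub>M (I \<times> {..<t}) (\<lambda>_. borel)) \<Longrightarrow>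
   S = (\<lambda>\<omega>. restrict (\<lambda>(p, k). D p k \<omega>) (I \<times> {..<t})) -` B \<inter> space M \<Longrightarrow> S \<in> noise_events t"
  unfolding noise_events_def by (intro CollectI exI[of _ B]) simp

lemma past_generatorI:
  "A \<in> chain_events t \<Longrightarrow> B \<in> noise_events t \<Longrightarrow> X = A \<inter> B \<Longrightarrow> X \<in> past_generator t"
  unfolding past_generator_def by (intro CollectI exI[of _ A] exI[of _ B]) simp

lemma m_measurable [measurable]: "m t \<in> measurable M (count_space UNIV)"
  using chain by (auto simp: hom_markov_chain_def)

lemma m_range: "\<omega> \<in> space M \<Longrightarrow> m t \<omega> \<in> {1..h}"
  using chain by (auto simp: hom_markov_chain_def)

lemma D_measurable: "p \<in> I \<Longrightarrow> D p t \<in> borel_measurable M"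
  using noise_indep unfolding indep_vars_def by (auto dest: bspec[of _ _ "(p, t)"])

section \<open>Cylinders of the chain and measurability with respect to the past\<close>

definition cyl :: "nat \<Rightarrow> (nat \<Rightarrow> nat) \<Rightarrow> 'w set" where
  "cyl t s = {\<omega> \<in> space M. \<forall>k\<le>t. m k \<omega> = s k}"

definition paths :: "nat \<Rightarrow> ((nat \<Rightarrow> nat) \<Rightarrow> bool) \<Rightarrow> (nat \<Rightarrow> nat) set" where
  "paths t Q = {s \<in> PiE {..t} (\<lambda>_. {1..h}). Q s}"

lemma finite_paths [simp]: "finite (paths t Q)"
  by (auto simp: paths_def intro!: finite_PiE)

lemma cyl_sets [measurable]: "cyl t s \<in> sets M"
  unfolding cyl_def by measurable

lemma cyl_disjoint: "disjoint_family_on (cyl t) (paths t Q)"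
proof (unfold disjoint_family_on_def, intro ballI impI)
  fix s s' assume s: "s \<in> paths t Q" "s' \<in> paths t Q" "s \<noteq> s'"
  have "\<exists>k\<in>{..t}. s k \<noteq> s' k"
    using s unfolding paths_def by (metis (no_types, lifting) PiE_ext mem_Collect_eq)
  then show "cyl t s \<inter> cyl t s' = {}" by (auto simp: cyl_def)
qed

text \<open>The Markov property is given for cylinders only; this finite union, disjoint by
  \<open>cyl_disjoint\<close>, extends it to every event of the chain up to t.\<close>

lemma chain_event_eq_Union_cyl:
  "{\<omega> \<in> space M. Q (restrict (\<lambda>k. m k \<omega>) {..t})} = (\<Union>s\<in>paths t Q. cyl t s)"
proof safe
  fix \<omega> assume \<omega>: "\<omega> \<in> space M" and Q: "Q (restrict (\<lambda>k. m k \<omega>) {..t})"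
  have "restrict (\<lambda>k. m k \<omega>) {..t} \<in> paths t Q"
    using \<omega> Q m_range[OF \<omega>] by (auto simp: paths_def)
  moreover have "\<omega> \<in> cyl t (restrict (\<lambda>k. m k \<omega>) {..t})" using \<omega> by (simp add: cyl_def)
  ultimately show "\<omega> \<in> (\<Union>s\<in>paths t Q. cyl t s)" by blast
next
  fix \<omega> s assume s: "s \<in> paths t Q" and \<omega>: "\<omega> \<in> cyl t s"
  then have "restrict (\<lambda>k. m k \<omega>) {..t} = s"
    by (auto simp: paths_def cyl_def fun_eq_iff PiE_def extensional_def)
  then show "Q (restrict (\<lambda>k. m k \<omega>) {..t})" using s by (simp add: paths_def)
  show "\<omega> \<in> space M" using \<omega> by (simp add: cyl_def)
qed

lemma cyl_chain_algebra: "cyl t s \<in> chain_algebra"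
proof -
  have "{f \<in> space (Pi\<^sub>M UNIV (\<lambda>_. count_space UNIV)). \<forall>k\<le>t. f k = s k} \<in> sets (Pi\<^sub>M UNIV (\<lambda>_::nat. count_space (UNIV::nat set)))"
    by measurable
  moreover have "cyl t s = (\<lambda>\<omega> t. m t \<omega>) -` {f \<in> space (Pi\<^sub>M UNIV (\<lambda>_. count_space UNIV)). \<forall>k\<le>t. f k = s k} \<inter> space M"
    by (auto simp: cyl_def space_PiM)
  ultimately show ?thesis unfolding chain_algebra_def by (rule vimage_algebraI)
qed

lemma chain_events_chain_algebra: "chain_events t \<subseteq> chain_algebra"
proof
  fix A assume "A \<in> chain_events t"
  then obtain Q where "A = (\<Union>s\<in>paths t Q. cyl t s)"
    using chain_event_eq_Union_cyl by (auto simp: chain_events_def)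
  moreover have "(\<Union>s\<in>paths t Q. cyl t s) \<in> chain_algebra"
    using cyl_chain_algebra unfolding chain_algebra_def by (intro sets.finite_UN) auto
  ultimately show "A \<in> chain_algebra" by simp
qed

lemma noise_events_noise_algebra: "noise_events t \<subseteq> noise_algebra"
proof
  fix A assume "A \<in> noise_events t"
  then obtain B where B: "B \<in> sets (Pi\<^sub>M (I \<times> {..<t}) (\<lambda>_. borel))"
    and A: "A = (\<lambda>\<omega>. restrict (\<lambda>(p, k). D p k \<omega>) (I \<times> {..<t})) -` B \<inter> space M"
    by (auto simp: noise_events_def)
  have r: "(\<lambda>f. restrict f (I \<times> {..<t})) \<in> measurable (Pi\<^sub>M (I \<times> UNIV) (\<lambda>_. borel)) (Pi\<^sub>M (I \<times> {..<t}) (\<lambda>_. borel))"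
    by (rule measurable_restrict_subset) auto
  define B' where "B' = (\<lambda>f. restrict f (I \<times> {..<t})) -` B \<inter> space (Pi\<^sub>M (I \<times> UNIV) (\<lambda>_. borel :: real measure))"
  have "B' \<in> sets (Pi\<^sub>M (I \<times> UNIV) (\<lambda>_. borel))"
    unfolding B'_def by (rule measurable_sets[OF r B])
  moreover have "A = (\<lambda>\<omega>. restrict (\<lambda>(p, t). D p t \<omega>) (I \<times> UNIV)) -` B' \<inter> space M"
  proof -
    have "restrict (restrict f (I \<times> UNIV)) (I \<times> {..<t}) = restrict f (I \<times> {..<t})" for f :: "'p \<times> nat \<Rightarrow> real"
      by (auto simp: restrict_def fun_eq_iff)
    then show ?thesis unfolding A B'_def by (auto simp: space_PiM)
  qed
  ultimately show "A \<in> noise_algebra" unfolding noise_algebra_def by (rule vimage_algebraI)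
qed

lemma chain_noise_indepD:
  "A \<in> chain_algebra \<Longrightarrow> B \<in> noise_algebra \<Longrightarrow> prob (A \<inter> B) = prob A * prob B"
  using indep_setD[OF chain_noise_indep] by (simp add: chain_algebra_def noise_algebra_def)

lemma algebra_sets: "chain_algebra \<subseteq> sets M" "noise_algebra \<subseteq> sets M"
  using indep_setD_ev1[OF chain_noise_indep] indep_setD_ev2[OF chain_noise_indep]
  by (auto simp: chain_algebra_def noise_algebra_def)

lemma space_chain_events: "space M \<in> chain_events t"
  by (auto simp: chain_events_def intro!: exI[of _ "\<lambda>_. True"])

lemma space_noise_events: "space M \<in> noise_events t"
proof -
  have "space (Pi\<^sub>M (I \<times> {..<t}) (\<lambda>_. borel :: real measure)) \<in> sets (Pi\<^sub>M (I \<times> {..<t}) (\<lambda>_. borel))"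
    by simp
  moreover have "space M = (\<lambda>\<omega>. restrict (\<lambda>(p, k). D p k \<omega>) (I \<times> {..<t})) -`
      space (Pi\<^sub>M (I \<times> {..<t}) (\<lambda>_. borel :: real measure)) \<inter> space M"
    by (auto simp: space_PiM)
  ultimately show ?thesis by (rule noise_eventsI)
qed

lemma past_generator_sets: "past_generator t \<subseteq> sets M"
  using chain_events_chain_algebra[of t] noise_events_noise_algebra[of t] algebra_sets
  by (auto simp: past_generator_def intro!: sets.Int)

lemma past_generator_space: "space M \<in> past_generator t"
  using space_chain_events[of t] space_noise_events[of t] by (auto simp: past_generator_def)

lemma Int_stable_past_generator: "Int_stable (past_generator t)"
proof (rule Int_stableI)
  fix X Y assume "X \<in> past_generator t" "Y \<in> past_generator t"
  then obtain A B A' B' where X: "X = A \<inter> B" "Y = A' \<inter> B'"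
    and A: "A \<in> chain_events t" "A' \<in> chain_events t" and B: "B \<in> noise_events t" "B' \<in> noise_events t"
    by (auto simp: past_generator_def)
  obtain Q Q' where "A = {\<omega> \<in> space M. Q (restrict (\<lambda>k. m k \<omega>) {..t})}" "A' = {\<omega> \<in> space M. Q' (restrict (\<lambda>k. m k \<omega>) {..t})}"
    using A by (auto simp: chain_events_def)
  then have 1: "A \<inter> A' \<in> chain_events t"
    by (intro chain_eventsI[where Q = "\<lambda>s. Q s \<and> Q' s"]) auto
  obtain C C' where C: "C \<in> sets (Pi\<^sub>M (I \<times> {..<t}) (\<lambda>_. borel))" "C' \<in> sets (Pi\<^sub>M (I \<times> {..<t}) (\<lambda>_. borel))"
    "B = (\<lambda>\<omega>. restrict (\<lambda>(p, k). D p k \<omega>) (I \<times> {..<t})) -` C \<inter> space M"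
    "B' = (\<lambda>\<omega>. restrict (\<lambda>(p, k). D p k \<omega>) (I \<times> {..<t})) -` C' \<inter> space M"
    using B by (auto simp: noise_events_def)
  then have "B \<inter> B' = (\<lambda>\<omega>. restrict (\<lambda>(p, k). D p k \<omega>) (I \<times> {..<t})) -` (C \<inter> C') \<inter> space M" by auto
  then have 2: "B \<inter> B' \<in> noise_events t" using C by (intro noise_eventsI[of "C \<inter> C'"]) auto
  have "X \<inter> Y = (A \<inter> A') \<inter> (B \<inter> B')" using X by auto
  with 1 2 show "X \<inter> Y \<in> past_generator t" by (rule past_generatorI)
qed

lemma space_past [simp]: "space (past t) = space M"
  by (simp add: past_def space_measure_of_conv)

lemma sets_past: "sets (past t) = sigma_sets (space M) (past_generator t)"
proof -
  have "past_generator t \<subseteq> Pow (space M)" using past_generator_sets[of t] sets.space_closed by blast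
  then show ?thesis by (simp add: past_def)
qed

lemma past_generator_past: "A \<in> past_generator t \<Longrightarrow> A \<in> sets (past t)"
  by (simp add: sets_past)

lemma subalgebra_past: "subalgebra M (past t)"
  unfolding subalgebra_def using sets.sigma_sets_subset[OF past_generator_sets] by (simp add: sets_past)

lemma m_measurable_past:
  assumes "k \<le> t" shows "m k \<in> measurable (past t) (count_space UNIV)"
proof (rule measurableI)
  fix V :: "nat set"
  have "m k -` V \<inter> space M \<in> chain_events t"
    using assms by (intro chain_eventsI[where Q = "\<lambda>s. s k \<in> V"]) auto
  then have "m k -` V \<inter> space M \<in> past_generator t"
    by (rule past_generatorI[OF _ space_noise_events]) auto
  then show "m k -` V \<inter> space (past t) \<in> sets (past t)" by (simp add: past_generator_past)
qed simp

lemma D_measurable_past: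
  assumes "p \<in> I" "k < t" shows "D p k \<in> borel_measurable (past t)"
proof (rule measurableI)
  fix V :: "real set" assume V: "V \<in> sets borel"
  have pk: "(p, k) \<in> I \<times> {..<t}" using assms by auto
  have *: "(\<lambda>f. f (p, k)) -` V \<inter> space (Pi\<^sub>M (I \<times> {..<t}) (\<lambda>_. borel)) \<in> sets (Pi\<^sub>M (I \<times> {..<t}) (\<lambda>_. borel))"
    using V pk by (intro measurable_sets[OF measurable_component_singleton]) auto
  have "D p k -` V \<inter> space M = (\<lambda>\<omega>. restrict (\<lambda>(p, k). D p k \<omega>) (I \<times> {..<t})) -`
      ((\<lambda>f. f (p, k)) -` V \<inter> space (Pi\<^sub>M (I \<times> {..<t}) (\<lambda>_. borel))) \<inter> space M"
    using pk by (auto simp: space_PiM)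
  with * have "D p k -` V \<inter> space M \<in> noise_events t" by (rule noise_eventsI)
  then have "D p k -` V \<inter> space M \<in> past_generator t"
    by (rule past_generatorI[OF space_chain_events]) auto
  then show "D p k -` V \<inter> space (past t) \<in> sets (past t)" by (simp add: past_generator_past)
qed simp

lemma past_generator_mono: "past_generator t \<subseteq> past_generator (Suc t)"
proof
  fix X assume "X \<in> past_generator t"
  then obtain A B where XAB: "X = A \<inter> B" and A: "A \<in> chain_events t" and B: "B \<in> noise_events t"
    unfolding past_generator_def by blast
  obtain Q where Q: "A = {\<omega> \<in> space M. Q (restrict (\<lambda>k. m k \<omega>) {..t})}"
    using A unfolding chain_events_def by blast
  obtain C where C': "B = (\<lambda>\<omega>. restrict (\<lambda>(p, k). D p k \<omega>) (I \<times> {..<t})) -` C \<inter> space M"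
    and C: "C \<in> sets (Pi\<^sub>M (I \<times> {..<t}) (\<lambda>_. borel))"
    using B unfolding noise_events_def by blast
  note X = XAB[unfolded Q C']
  have "restrict (restrict f {..Suc t}) {..t} = restrict f {..t}" for f :: "nat \<Rightarrow> nat"
    by (auto simp: restrict_def fun_eq_iff)
  then have 1: "{\<omega> \<in> space M. Q (restrict (\<lambda>k. m k \<omega>) {..t})} \<in> chain_events (Suc t)"
    by (intro chain_eventsI[where Q = "\<lambda>s. Q (restrict s {..t})"]) simp
  have r: "(\<lambda>f. restrict f (I \<times> {..<t})) \<in> measurable (Pi\<^sub>M (I \<times> {..<Suc t}) (\<lambda>_. borel)) (Pi\<^sub>M (I \<times> {..<t}) (\<lambda>_. borel))"
    by (rule measurable_restrict_subset) auto
  define B' where "B' = (\<lambda>f. restrict f (I \<times> {..<t})) -` C \<inter> space (Pi\<^sub>M (I \<times> {..<Suc t}) (\<lambda>_. borel :: real measure))"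
  have "B' \<in> sets (Pi\<^sub>M (I \<times> {..<Suc t}) (\<lambda>_. borel))"
    unfolding B'_def by (rule measurable_sets[OF r C])
  moreover have "(\<lambda>\<omega>. restrict (\<lambda>(p, k). D p k \<omega>) (I \<times> {..<t})) -` C \<inter> space M
      = (\<lambda>\<omega>. restrict (\<lambda>(p, k). D p k \<omega>) (I \<times> {..<Suc t})) -` B' \<inter> space M"
  proof -
    have "restrict (restrict f (I \<times> {..<Suc t})) (I \<times> {..<t}) = restrict f (I \<times> {..<t})" for f :: "'p \<times> nat \<Rightarrow> real"
      by (auto simp: restrict_def fun_eq_iff)
    then show ?thesis unfolding B'_def by (auto simp: space_PiM)
  qed
  ultimately have "(\<lambda>\<omega>. restrict (\<lambda>(p, k). D p k \<omega>) (I \<times> {..<t})) -` C \<inter> space M \<in> noise_events (Suc t)"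
    by (rule noise_eventsI)
  from past_generatorI[OF 1 this X] show "X \<in> past_generator (Suc t)" .
qed

lemma measurable_past_Suc: "f \<in> borel_measurable (past t) \<Longrightarrow> f \<in> borel_measurable (past (Suc t))"
proof -
  have "sets (past t) \<subseteq> sets (past (Suc t))"
    unfolding sets_past by (rule sigma_sets_mono') (rule past_generator_mono)
  then have "subalgebra (past (Suc t)) (past t)" by (simp add: subalgebra_def)
  then show "f \<in> borel_measurable (past t) \<Longrightarrow> f \<in> borel_measurable (past (Suc t))"
    by (rule measurable_from_subalg)
qed

lemma measurable_past_M: "f \<in> borel_measurable (past t) \<Longrightarrow> f \<in> borel_measurable M"
  using measurable_from_subalg[OF subalgebra_past] .

section \<open>Laws of the next state and of the fresh noise given the past\<close>

lemma prob_cyl_step: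
  "prob (cyl t s \<inter> {\<omega> \<in> space M. m (Suc t) \<omega> = v}) = prob (cyl t s) * P (s t) v"
proof -
  define s' where "s' = s(Suc t := v)"
  have c: "\<And>t s. prob {\<omega> \<in> space M. \<forall>k\<le>Suc t. m k \<omega> = s k}
        = prob {\<omega> \<in> space M. \<forall>k\<le>t. m k \<omega> = s k} * P (s t) (s (Suc t))"
    using chain unfolding hom_markov_chain_def by blast
  have "{\<omega> \<in> space M. \<forall>k\<le>Suc t. m k \<omega> = s' k} = cyl t s \<inter> {\<omega> \<in> space M. m (Suc t) \<omega> = v}"
    by (auto simp: s'_def cyl_def le_Suc_eq)
  moreover have "{\<omega> \<in> space M. \<forall>k\<le>t. m k \<omega> = s' k} = cyl t s"
    by (auto simp: s'_def cyl_def)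
  ultimately show ?thesis using c[of t s'] by (simp add: s'_def)
qed

lemma prob_chain_event_step:
  assumes A: "A \<in> chain_events t"
  shows "prob (A \<inter> {\<omega> \<in> space M. m (Suc t) \<omega> = v})
     = (\<Sum>w\<in>{1..h}. P w v * prob (A \<inter> {\<omega> \<in> space M. m t \<omega> = w}))"
proof -
  obtain Q where Q: "A = (\<Union>s\<in>paths t Q. cyl t s)"
    using A chain_event_eq_Union_cyl by (auto simp: chain_events_def)
  have split: "prob (A \<inter> S) = (\<Sum>s\<in>paths t Q. prob (cyl t s \<inter> S))" if S: "S \<in> sets M" for S
  proof -
    have "A \<inter> S = (\<Union>s\<in>paths t Q. cyl t s \<inter> S)" using Q by auto
    also have "prob \<dots> = (\<Sum>s\<in>paths t Q. prob (cyl t s \<inter> S))"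
      using cyl_disjoint[of t Q] S by (intro finite_measure_finite_Union) (auto simp: disjoint_family_on_def)
    finally show ?thesis .
  qed
  have e: "prob (cyl t s \<inter> {\<omega> \<in> space M. m t \<omega> = w}) = (if s t = w then prob (cyl t s) else 0)" for s w
  proof (cases "s t = w")
    case True
    then have "cyl t s \<inter> {\<omega> \<in> space M. m t \<omega> = w} = cyl t s" by (auto simp: cyl_def)
    then show ?thesis using True by simp
  next
    case False
    then have "cyl t s \<inter> {\<omega> \<in> space M. m t \<omega> = w} = {}" by (auto simp: cyl_def)
    then show ?thesis using False by simp
  qed
  have "prob (A \<inter> {\<omega> \<in> space M. m (Suc t) \<omega> = v}) = (\<Sum>s\<in>paths t Q. prob (cyl t s) * P (s t) v)"
    by (subst split) (auto simp: prob_cyl_step)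
  also have "\<dots> = (\<Sum>s\<in>paths t Q. \<Sum>w\<in>{1..h}. if s t = w then prob (cyl t s) * P w v else 0)"
    by (intro sum.cong refl) (auto simp: paths_def PiE_iff)
  also have "\<dots> = (\<Sum>w\<in>{1..h}. \<Sum>s\<in>paths t Q. if s t = w then prob (cyl t s) * P w v else 0)"
    by (rule sum.swap)
  also have "\<dots> = (\<Sum>w\<in>{1..h}. P w v * prob (A \<inter> {\<omega> \<in> space M. m t \<omega> = w}))"
  proof (intro sum.cong refl)
    fix w
    have "prob (A \<inter> {\<omega> \<in> space M. m t \<omega> = w}) = (\<Sum>s\<in>paths t Q. if s t = w then prob (cyl t s) else 0)"
      by (subst split) (auto simp: e)
    then show "(\<Sum>s\<in>paths t Q. if s t = w then prob (cyl t s) * P w v else 0) = P w v * prob (A \<inter> {\<omega> \<in> space M. m t \<omega> = w})"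
      by (simp add: sum_distrib_left if_distrib mult.commute cong: if_cong)
  qed
  finally show ?thesis .
qed

text \<open>Independence of chain and noise factors the probability of the noise part out of both
  sides, which leaves the one-step identity of the chain alone.\<close>

lemma prob_past_generator_step:
  assumes X: "X \<in> past_generator t"
  shows "prob (X \<inter> {\<omega> \<in> space M. m (Suc t) \<omega> = v})
     = (\<Sum>w\<in>{1..h}. P w v * prob (X \<inter> {\<omega> \<in> space M. m t \<omega> = w}))"
proof -
  obtain A B where X: "X = A \<inter> B" and A: "A \<in> chain_events t" and B: "B \<in> noise_events t"
    using X by (auto simp: past_generator_def)
  have Bn: "B \<in> noise_algebra" using B noise_events_noise_algebra by auto
  have mset: "{\<omega> \<in> space M. m k \<omega> = w} \<in> chain_events k" for k w
    by (intro chain_eventsI[where Q = "\<lambda>s. s k = w"]) auto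
  have indep: "prob (X \<inter> {\<omega> \<in> space M. m k \<omega> = w}) = prob B * prob (A \<inter> {\<omega> \<in> space M. m k \<omega> = w})" for k w
  proof -
    have "A \<inter> {\<omega> \<in> space M. m k \<omega> = w} \<in> chain_algebra"
      using A mset[of k w] chain_events_chain_algebra unfolding chain_algebra_def by blast
    from chain_noise_indepD[OF this Bn] show ?thesis by (simp add: X Int_ac mult.commute)
  qed
  show ?thesis unfolding indep prob_chain_event_step[OF A] by (simp add: sum_distrib_left ac_simps)
qed

text \<open>The identity on the intersection-stable generator extends to all of
  \<open>past t\<close> and identifies \<open>P (m t \<omega>) v\<close> as the conditional
  expectation of the indicator; a bounded past-measurable weight can then be carried along.
  Enlarging the past by the noise does not disturb the Markov property.\<close>

lemma integral_past_step:
  assumes \<phi>: "\<phi> \<in> borel_measurable (past t)" and bd: "\<And>\<omega>. \<omega> \<in> space M \<Longrightarrow> \<bar>\<phi> \<omega>\<bar> \<le> B"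
  shows "(\<integral>\<omega>. \<phi> \<omega> * (if m (Suc t) \<omega> = v then 1 else 0) \<partial>M) = (\<integral>\<omega>. \<phi> \<omega> * P (m t \<omega>) v \<partial>M)"
proof -
  have \<phi>M: "\<phi> \<in> borel_measurable M" using \<phi> by (rule measurable_past_M)
  define f where "f \<omega> = (if m (Suc t) \<omega> = v then 1 else 0 :: real)" for \<omega>
  define g where "g \<omega> = P (m t \<omega>) v" for \<omega>
  define K where "K = (\<Sum>w\<in>{1..h}. \<bar>P w v\<bar>)"
  have gK: "\<bar>g \<omega>\<bar> \<le> K" if "\<omega> \<in> space M" for \<omega>
    unfolding g_def K_def using m_range[OF that, of t] by (intro member_le_sum) auto
  have fm: "f \<in> borel_measurable M" unfolding f_def by measurable
  have gp: "g \<in> borel_measurable (past t)" unfolding g_def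
    using measurable_compose[OF m_measurable_past[of t t], of "\<lambda>w. P w v" borel] by simp
  have gm: "g \<in> borel_measurable M" using gp by (rule measurable_past_M)
  have fi: "integrable M f" by (rule integrable_const_bound[of _ 1]) (auto simp: f_def fm)
  have gi: "integrable M g" by (rule integrable_const_bound[of _ K]) (use gK gm in auto)
  have gen: "(\<integral>x\<in>X. f x \<partial>M) = (\<integral>x\<in>X. g x \<partial>M)" if X: "X \<in> past_generator t" for X
  proof -
    have XM: "X \<in> sets M" using X past_generator_sets by auto
    have "(\<integral>x\<in>X. f x \<partial>M) = (\<integral>x. indicator (X \<inter> {\<omega> \<in> space M. m (Suc t) \<omega> = v}) x \<partial>M)"
      unfolding set_lebesgue_integral_def
      by (intro Bochner_Integration.integral_cong refl) (auto simp: f_def indicator_def)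
    also have "\<dots> = prob (X \<inter> {\<omega> \<in> space M. m (Suc t) \<omega> = v})"
      using XM by (subst Bochner_Integration.integral_indicator) (auto simp: Int_ac)
    also have "\<dots> = (\<Sum>w\<in>{1..h}. P w v * prob (X \<inter> {\<omega> \<in> space M. m t \<omega> = w}))"
      by (rule prob_past_generator_step[OF X])
    also have "\<dots> = (\<Sum>w\<in>{1..h}. \<integral>x. P w v * indicator (X \<inter> {\<omega> \<in> space M. m t \<omega> = w}) x \<partial>M)"
      using XM by (intro sum.cong refl) (auto simp: Int_ac)
    also have "\<dots> = (\<integral>x. (\<Sum>w\<in>{1..h}. P w v * indicator (X \<inter> {\<omega> \<in> space M. m t \<omega> = w}) x) \<partial>M)"
      using XM by (intro Bochner_Integration.integral_sum[symmetric] integrable_mult_right integrable_real_indicator) (auto simp: less_top[symmetric])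
    also have "\<dots> = (\<integral>x\<in>X. g x \<partial>M)"
      unfolding set_lebesgue_integral_def
    proof (intro Bochner_Integration.integral_cong refl)
      fix \<omega> assume \<omega>: "\<omega> \<in> space M"
      have "(\<Sum>w\<in>{1..h}. P w v * indicator (X \<inter> {\<omega> \<in> space M. m t \<omega> = w}) \<omega>)
          = (\<Sum>w\<in>{1..h}. if w = m t \<omega> then P (m t \<omega>) v * indicator X \<omega> else 0)"
        using \<omega> by (intro sum.cong refl) (auto simp: indicator_def)
      also have "\<dots> = P (m t \<omega>) v * indicator X \<omega>" using m_range[OF \<omega>, of t] by simp
      finally show "(\<Sum>w\<in>{1..h}. P w v * indicator (X \<inter> {\<omega> \<in> space M. m t \<omega> = w}) \<omega>) = indicator X \<omega> *\<^sub>R g \<omega>"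
        by (simp add: g_def mult.commute)
    qed
    finally show ?thesis .
  qed
  interpret sub: finite_measure_subalgebra M "past t"
    by unfold_locales (rule subalgebra_past)
  have AE: "AE x in M. real_cond_exp M (past t) f x = g x"
  proof (rule sub.real_cond_exp_charact[OF _ fi gi gp])
    fix A assume "A \<in> sets (past t)"
    then show "(\<integral>x\<in>A. f x \<partial>M) = (\<integral>x\<in>A. g x \<partial>M)"
      using set_integral_eq_sigma_sets[OF fi gi past_generator_sets Int_stable_past_generator past_generator_space gen]
      by (simp add: sets_past)
  qed
  have B0: "B \<ge> 0" using bd not_empty by (metis abs_ge_zero ex_in_conv order_trans)
  have int: "integrable M (\<lambda>x. \<phi> x * f x)"
    using bd \<phi>M fm B0 by (intro integrable_const_bound[of _ B]) (auto simp: f_def)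
  have "(\<integral>x. \<phi> x * f x \<partial>M) = (\<integral>x. \<phi> x * real_cond_exp M (past t) f x \<partial>M)"
    using sub.real_cond_exp_intg(2)[OF int \<phi> fm] by simp
  also have "\<dots> = (\<integral>x. \<phi> x * g x \<partial>M)"
    using AE \<phi>M gm by (intro integral_cong_AE) auto
  finally show ?thesis by (simp add: f_def g_def)
qed

text \<open>Two independences are combined on the generators: the noise at t is independent of the
  earlier noise, and the chain is independent of both together. This is why B \<inter> S is treated
  as a single event of the noise algebra before the chain part is split off.\<close>

lemma noise_indep_past:
  assumes p: "p \<in> I"
  shows "indep_set (sets (past t)) (sigma_sets (space M) {D p t -` A \<inter> space M | A. A \<in> sets borel})"
proof -
  let ?S = "{D p t -` A \<inter> space M | A. A \<in> sets borel}"
  have Sstab: "Int_stable ?S"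
  proof (rule Int_stableI)
    fix a b assume "a \<in> ?S" "b \<in> ?S"
    then obtain A A' where "A \<in> sets borel" "A' \<in> sets borel" "a = D p t -` A \<inter> space M" "b = D p t -` A' \<inter> space M" by auto
    then show "a \<inter> b \<in> ?S" by (intro CollectI exI[of _ "A \<inter> A'"]) auto
  qed
  have Ssets: "?S \<subseteq> sets M" using measurable_sets[OF D_measurable[OF p]] by auto
  have "indep_set (past_generator t) ?S"
    unfolding indep_sets2_eq
  proof (intro conjI ballI past_generator_sets Ssets)
    fix X S assume X: "X \<in> past_generator t" and "S \<in> ?S"
    then obtain V where V: "V \<in> sets borel" "S = D p t -` V \<inter> space M" by auto
    obtain A B where X: "X = A \<inter> B" and A: "A \<in> chain_events t" and B: "B \<in> noise_events t"
      using X by (auto simp: past_generator_def)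
    obtain C where C: "C \<in> sets (Pi\<^sub>M (I \<times> {..<t}) (\<lambda>_. borel))"
      "B = (\<lambda>\<omega>. restrict (\<lambda>(p, k). D p k \<omega>) (I \<times> {..<t})) -` C \<inter> space M"
      using B by (auto simp: noise_events_def)
    define V' where "V' = (\<lambda>f. f (p, t)) -` V \<inter> space (Pi\<^sub>M {(p, t)} (\<lambda>_. borel :: real measure))"
    have V': "V' \<in> sets (Pi\<^sub>M {(p, t)} (\<lambda>_. borel))"
      unfolding V'_def using V by (intro measurable_sets[OF measurable_component_singleton]) auto
    have S': "S = (\<lambda>\<omega>. restrict (\<lambda>i. (\<lambda>(p, t). D p t) i \<omega>) {(p, t)}) -` V' \<inter> space M"
      unfolding V V'_def by (auto simp: space_PiM)
    have B': "B = (\<lambda>\<omega>. restrict (\<lambda>i. (\<lambda>(p, t). D p t) i \<omega>) (I \<times> {..<t})) -` C \<inter> space M"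
      unfolding C(2) by (simp add: case_prod_unfold)
    have "indep_var (Pi\<^sub>M (I \<times> {..<t}) (\<lambda>_. borel)) (\<lambda>\<omega>. restrict (\<lambda>i. (\<lambda>(p, t). D p t) i \<omega>) (I \<times> {..<t}))
        (Pi\<^sub>M {(p, t)} (\<lambda>_. borel)) (\<lambda>\<omega>. restrict (\<lambda>i. (\<lambda>(p, t). D p t) i \<omega>) {(p, t)})"
      using p by (intro indep_var_restrict[OF noise_indep]) auto
    note ind = conjunct2[OF this[unfolded indep_var_eq]]
    have BS: "prob (B \<inter> S) = prob B * prob S"
    proof (rule indep_setD[OF ind])
      show "B \<in> sigma_sets (space M) {(\<lambda>\<omega>. restrict (\<lambda>i. (\<lambda>(p, t). D p t) i \<omega>) (I \<times> {..<t})) -` A \<inter> space M | A.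
          A \<in> sets (Pi\<^sub>M (I \<times> {..<t}) (\<lambda>_. borel))}"
        by (rule sigma_sets.Basic, rule CollectI, rule exI[of _ C], rule conjI, rule B', rule C(1))
      show "S \<in> sigma_sets (space M) {(\<lambda>\<omega>. restrict (\<lambda>i. (\<lambda>(p, t). D p t) i \<omega>) {(p, t)}) -` A \<inter> space M | A.
          A \<in> sets (Pi\<^sub>M {(p, t)} (\<lambda>_. borel))}"
        by (rule sigma_sets.Basic, rule CollectI, rule exI[of _ V'], rule conjI, rule S', rule V')
    qed
    have An: "A \<in> chain_algebra" using A chain_events_chain_algebra by auto
    have Bn: "B \<in> noise_algebra" using B noise_events_noise_algebra by auto
    have Sn: "S \<in> noise_algebra"
    proof -
      have "(\<lambda>f. f (p, t)) -` V \<inter> space (Pi\<^sub>M (I \<times> UNIV) (\<lambda>_. borel :: real measure)) \<in> sets (Pi\<^sub>M (I \<times> UNIV) (\<lambda>_. borel))"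
        using V p by (intro measurable_sets[OF measurable_component_singleton]) auto
      moreover have "S = (\<lambda>\<omega>. restrict (\<lambda>(p, t). D p t \<omega>) (I \<times> UNIV)) -`
         ((\<lambda>f. f (p, t)) -` V \<inter> space (Pi\<^sub>M (I \<times> UNIV) (\<lambda>_. borel :: real measure))) \<inter> space M"
        using p unfolding V by (auto simp: space_PiM)
      ultimately show ?thesis unfolding noise_algebra_def by (rule vimage_algebraI)
    qed
    have BSn: "B \<inter> S \<in> noise_algebra" using Bn Sn unfolding noise_algebra_def by auto
    have "prob (X \<inter> S) = prob A * (prob B * prob S)"
      using chain_noise_indepD[OF An BSn] BS by (simp add: X Int_assoc)
    also have "\<dots> = prob X * prob S" using chain_noise_indepD[OF An Bn] by (simp add: X)
    finally show "prob (X \<inter> S) = prob X * prob S" .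
  qed
  from indep_set_sigma_sets[OF this Int_stable_past_generator Sstab]
  show ?thesis by (simp add: sets_past)
qed

end

section \<open>Switching graphs\<close>

definition adj :: "(nat \<Rightarrow> nat set set) \<Rightarrow> nat \<Rightarrow> nat \<Rightarrow> nat \<Rightarrow> real" where
  "adj E u i j = (if {i, j} \<in> E u then 1 else 0)"

lemma adj_sym: "adj E u i j = adj E u j i"
  by (simp add: adj_def insert_commute)

lemma adj_bounds: "0 \<le> adj E u i j" "adj E u i j \<le> 1"
  by (auto simp: adj_def)

lemma nbr_subset:
  assumes "undirected_graphs N h E" "u \<in> {1..h}"
  shows "nbr E u i \<subseteq> {1..N}"
  using assms by (fastforce simp: nbr_def undirected_graphs_def)

lemma sum_nbr:
  fixes f :: "nat \<Rightarrow> real"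
  assumes "undirected_graphs N h E" "u \<in> {1..h}"
  shows "(\<Sum>j\<in>nbr E u i. f j) = (\<Sum>j\<in>{1..N}. adj E u i j * f j)"
proof -
  have "(\<Sum>j\<in>nbr E u i. f j) = (\<Sum>j\<in>nbr E u i. adj E u i j * f j)"
    by (intro sum.cong refl) (auto simp: nbr_def adj_def)
  also have "\<dots> = (\<Sum>j\<in>{1..N}. adj E u i j * f j)"
    using nbr_subset[OF assms] by (intro sum.mono_neutral_left) (auto simp: nbr_def adj_def)
  finally show ?thesis .
qed

lemma laplacian_eq:
  assumes "undirected_graphs N h E" "u \<in> {1..h}"
  shows "laplacian E u i k = (if i = k then (\<Sum>j\<in>{1..N}. adj E u i j) else 0) - adj E u i k"
proof -
  have "adj E u i i = 0"
    using assms by (auto simp: adj_def undirected_graphs_def dest!: bspec)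
  moreover have "real (card (nbr E u i)) = (\<Sum>j\<in>{1..N}. adj E u i j)"
    using sum_nbr[OF assms, of "\<lambda>_. 1" i] by simp
  ultimately show ?thesis by (auto simp: laplacian_def adj_def)
qed

lemma weighted_laplacian_apply:
  fixes a :: "nat \<Rightarrow> nat \<Rightarrow> real"
  assumes L: "\<And>k. k \<in> V \<Longrightarrow> L i k = (if i = k then (\<Sum>j\<in>V. a i j) else 0) - a i k"
    and i: "i \<in> V" and fin: "finite V"
  shows "(\<Sum>k\<in>V. L i k * x k) = (\<Sum>j\<in>V. a i j * (x i - x j))"
proof -
  have "(\<Sum>k\<in>V. L i k * x k) = (\<Sum>k\<in>V. (if k = i then (\<Sum>j\<in>V. a i j) * x i else 0) - a i k * x k)"
    by (intro sum.cong refl) (auto simp: L left_diff_distrib)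
  also have "\<dots> = (\<Sum>j\<in>V. a i j) * x i - (\<Sum>k\<in>V. a i k * x k)"
    using i fin by (simp add: sum_subtractf)
  finally show ?thesis by (simp add: right_diff_distrib sum_subtractf sum_distrib_right)
qed

text \<open>Exchanging the two summation indices gives a second expression for the form; adding both
  turns it into a sum of squared differences over ordered pairs, hence the division by 2.\<close>

lemma weighted_laplacian_form:
  fixes a :: "nat \<Rightarrow> nat \<Rightarrow> real"
  assumes L: "\<And>i k. i \<in> V \<Longrightarrow> k \<in> V \<Longrightarrow> L i k = (if i = k then (\<Sum>j\<in>V. a i j) else 0) - a i k"
    and sym: "\<And>i j. a i j = a j i" and fin: "finite V"
  shows "(\<Sum>i\<in>V. x i * (\<Sum>k\<in>V. L i k * x k)) = (\<Sum>i\<in>V. \<Sum>j\<in>V. a i j * (x i - x j)\<^sup>2) / 2"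
proof -
  define S where "S = (\<Sum>i\<in>V. x i * (\<Sum>k\<in>V. L i k * x k))"
  have S1: "S = (\<Sum>i\<in>V. \<Sum>j\<in>V. a i j * (x i - x j) * x i)"
    unfolding S_def using weighted_laplacian_apply[of V L _ a x] L fin
    by (intro sum.cong refl) (simp add: sum_distrib_left ac_simps)
  have "S = (\<Sum>j\<in>V. \<Sum>i\<in>V. a i j * (x i - x j) * x i)" unfolding S1 by (rule sum.swap)
  also have "\<dots> = (\<Sum>i\<in>V. \<Sum>j\<in>V. a i j * (x j - x i) * x j)"
    by (intro sum.cong refl) (simp add: sym)
  finally have S2: "S = (\<Sum>i\<in>V. \<Sum>j\<in>V. a i j * (x j - x i) * x j)" .
  have "S + S = (\<Sum>i\<in>V. \<Sum>j\<in>V. a i j * (x i - x j)\<^sup>2)"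
    by (subst S1, subst S2) (simp add: sum.distrib[symmetric] power2_eq_square algebra_simps)
  then show ?thesis unfolding S_def by simp
qed

lemma nbr_union_eq: "nbr_union h E i = {j. \<exists>u\<in>{1..h}. j \<in> nbr E u i}"
  by (auto simp: nbr_union_def nbr_def)

lemma pairs_subset:
  assumes "undirected_graphs N h E"
  shows "pairs N h E \<subseteq> {1..N} \<times> {1..N}"
proof
  fix p assume "p \<in> pairs N h E"
  then obtain i j where p: "p = (i, j)" "i \<in> {1..N}" "j \<in> nbr_union h E i"
    unfolding pairs_def by blast
  then obtain u where "u \<in> {1..h}" "j \<in> nbr E u i" unfolding nbr_union_eq by blast
  then show "p \<in> {1..N} \<times> {1..N}" using nbr_subset[OF assms] p by blast
qed

lemma finite_pairs: "undirected_graphs N h E \<Longrightarrow> finite (pairs N h E)"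
  using pairs_subset by (rule finite_subset) auto

lemma pairs_iff:
  "(i, j) \<in> pairs N h E \<longleftrightarrow> i \<in> {1..N} \<and> (\<exists>u\<in>{1..h}. {i, j} \<in> E u)"
  by (auto simp: pairs_def nbr_union_def)

text \<open>Brings the neighbour sums of the algorithm into the rows of W, in terms of which the
  gain constants are defined. Pairs of the union graph that are inactive in topology u drop out
  because W vanishes on them.\<close>

lemma sum_nbr_pairs:
  fixes f :: "nat \<times> nat \<Rightarrow> real"
  assumes g: "undirected_graphs N h E" and u: "u \<in> {1..h}" and i: "i \<in> {1..N}"
  shows "(\<Sum>j\<in>nbr E u i. f (i, j)) = (\<Sum>p\<in>pairs N h E. Wmat E u i p * f p)"
proof -
  have "Pair i ` nbr E u i \<subseteq> pairs N h E"
    using u i by (auto simp: pairs_iff nbr_def simp del: atLeastAtMost_iff One_nat_def)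
  then have "(\<Sum>p\<in>pairs N h E. Wmat E u i p * f p) = (\<Sum>p\<in>Pair i ` nbr E u i. Wmat E u i p * f p)"
    using finite_pairs[OF g]
    by (intro sum.mono_neutral_right) (auto simp: Wmat_def nbr_def)
  also have "\<dots> = (\<Sum>j\<in>nbr E u i. Wmat E u i (i, j) * f (i, j))"
    by (subst sum.reindex) (auto simp: inj_on_def)
  also have "\<dots> = (\<Sum>j\<in>nbr E u i. f (i, j))"
    by (intro sum.cong refl) (auto simp: Wmat_def nbr_def)
  finally show ?thesis by simp
qed

text \<open>Since \<pi> is positive, the averaged weights are positive on every edge of the union
  graph. Vanishing energy therefore forces equal values along all its paths, so a sum-zero vector in
  the kernel is 0. This is how connectivity of the union alone can suffice.\<close>

lemma spectral_gap_Lcheck: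
  assumes N: "N \<ge> 2" and g: "undirected_graphs N h E" and con: "union_connected N h E"
    and \<pi>: "\<And>u. u \<in> {1..h} \<Longrightarrow> \<pi> u > 0"
  shows "lam2 N h E \<pi> > 0"
    and "(\<Sum>i\<in>{1..N}. x i) = 0 \<Longrightarrow> lam2 N h E \<pi> * (\<Sum>i\<in>{1..N}. (x i)\<^sup>2)
       \<le> (\<Sum>u\<in>{1..h}. \<pi> u * (\<Sum>i\<in>{1..N}. x i * (\<Sum>k\<in>{1..N}. laplacian E u i k * x k)))"
proof -
  let ?V = "{1..N}"
  define a where "a i j = (\<Sum>u\<in>{1..h}. \<pi> u * adj E u i j)" for i j
  define Lc where "Lc i k = (\<Sum>u\<in>{1..h}. \<pi> u * laplacian E u i k)" for i k
  have asym: "a i j = a j i" for i j unfolding a_def by (simp add: adj_sym)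
  have ann: "a i j \<ge> 0" for i j
    unfolding a_def using \<pi> by (intro sum_nonneg mult_nonneg_nonneg adj_bounds) (auto simp: less_imp_le)
  have apos: "a i j > 0" if j: "j \<in> nbr_union h E i" for i j
  proof -
    obtain u where u: "u \<in> {1..h}" "{i, j} \<in> E u" using j by (auto simp: nbr_union_def)
    have "0 < \<pi> u * adj E u i j" using \<pi> u by (simp add: adj_def)
    also have "\<dots> \<le> a i j" unfolding a_def using u \<pi>
      by (intro member_le_sum mult_nonneg_nonneg adj_bounds) (auto simp: less_imp_le)
    finally show ?thesis .
  qed
  have Lc: "Lc i k = (if i = k then (\<Sum>j\<in>?V. a i j) else 0) - a i k" for i k
  proof -
    have "Lc i k = (\<Sum>u\<in>{1..h}. \<pi> u * ((if i = k then (\<Sum>j\<in>?V. adj E u i j) else 0) - adj E u i k))"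
      unfolding Lc_def using laplacian_eq[OF g] by (intro sum.cong refl) simp
    also have "\<dots> = (if i = k then (\<Sum>u\<in>{1..h}. \<Sum>j\<in>?V. \<pi> u * adj E u i j) else 0) - a i k"
      by (simp add: right_diff_distrib sum_subtractf a_def sum_distrib_left)
    also have "(\<Sum>u\<in>{1..h}. \<Sum>j\<in>?V. \<pi> u * adj E u i j) = (\<Sum>j\<in>?V. a i j)"
      unfolding a_def by (rule sum.swap)
    finally show ?thesis .
  qed
  have form: "(\<Sum>i\<in>?V. x i * (\<Sum>k\<in>?V. Lc i k * x k)) = (\<Sum>i\<in>?V. \<Sum>j\<in>?V. a i j * (x i - x j)\<^sup>2) / 2" for x
    by (rule weighted_laplacian_form[OF Lc asym]) auto
  \<comment> \<open>Vertices are numbered from 1, matrix indices from 0.\<close>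
  define L where "L i k = Lc (i + 1) (k + 1)" for i k
  have shift: "(\<Sum>k<N. F (k + 1)) = (\<Sum>k\<in>?V. F k)" for F :: "nat \<Rightarrow> real"
    by (rule sum.reindex_bij_witness[of _ "\<lambda>v. v - 1" "\<lambda>v. v + 1"]) auto
  have shift': "(\<Sum>k<N. F k) = (\<Sum>k\<in>?V. F (k - 1))" for F :: "nat \<Rightarrow> real"
    using shift[of "\<lambda>k. F (k - 1)"] by simp
  have Lform: "(\<Sum>i<N. v i * (\<Sum>j<N. L i j * v j)) = (\<Sum>i\<in>?V. v (i - 1) * (\<Sum>k\<in>?V. Lc i k * v (k - 1)))" for v
    unfolding shift' by (intro sum.cong refl arg_cong2[where f = "(*)"]) (auto simp: L_def)
  have mat: "Lcheck N h E \<pi> = mat N N (\<lambda>(i, j). L i j)"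
    by (simp add: Lcheck_def L_def Lc_def)
  have p: "N \<ge> 2"
    "\<And>i j. i < N \<Longrightarrow> j < N \<Longrightarrow> L i j = L j i"
    "\<And>i. i < N \<Longrightarrow> (\<Sum>j<N. L i j) = 0"
    "\<And>v. 0 \<le> (\<Sum>i<N. v i * (\<Sum>j<N. L i j * v j))"
    "\<And>v. (\<And>i. i < N \<Longrightarrow> (\<Sum>j<N. L i j * v j) = 0) \<Longrightarrow> (\<Sum>i<N. v i) = 0 \<Longrightarrow> (\<forall>i<N. v i = 0)"
  proof -
    show "N \<ge> 2" by (rule N)
    show "L i j = L j i" for i j unfolding L_def Lc by (auto simp: asym)
    show "(\<Sum>j<N. L i j) = 0" if "i < N" for i
    proof -
      have "(\<Sum>k\<in>?V. Lc (i + 1) k * 1) = (\<Sum>j\<in>?V. a (i + 1) j * (1 - 1))"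
        by (rule weighted_laplacian_apply[OF Lc]) (use that in auto)
      then show ?thesis unfolding L_def shift[of "\<lambda>k. Lc (i + 1) k"] by simp
    qed
    show "0 \<le> (\<Sum>i<N. v i * (\<Sum>j<N. L i j * v j))" for v
      unfolding Lform form using ann by (intro divide_nonneg_pos sum_nonneg mult_nonneg_nonneg) auto
    fix v :: "nat \<Rightarrow> real"
    assume 0: "\<And>i. i < N \<Longrightarrow> (\<Sum>j<N. L i j * v j) = 0" and s: "(\<Sum>i<N. v i) = 0"
    have "(\<Sum>i\<in>?V. \<Sum>j\<in>?V. a i j * (v (i - 1) - v (j - 1))\<^sup>2) = 0"
      using form[of "\<lambda>i. v (i - 1)"] Lform[of v] 0 by simp
    then have z1: "(\<Sum>j\<in>?V. a i j * (v (i - 1) - v (j - 1))\<^sup>2) = 0" if "i \<in> ?V" for i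
      using that ann by (subst (asm) sum_nonneg_eq_0_iff) (auto intro!: sum_nonneg)
    have z: "a i j * (v (i - 1) - v (j - 1))\<^sup>2 = 0" if "i \<in> ?V" "j \<in> ?V" for i j
    proof -
      have "\<forall>j\<in>?V. a i j * (v (i - 1) - v (j - 1))\<^sup>2 = 0"
        using z1[OF that(1)] ann by (subst (asm) sum_nonneg_eq_0_iff) auto
      then show ?thesis using that by blast
    qed
    have edge: "v (i - 1) = v (j - 1) \<and> j \<in> ?V" if "i \<in> ?V" "j \<in> nbr_union h E i" for i j
    proof -
      have "j \<in> ?V" using that nbr_subset[OF g] unfolding nbr_union_eq by blast
      then show ?thesis using z[of i j] apos[of j i] that by auto
    qed
    have conn: "v (1 - 1) = v (j - 1) \<and> j \<in> ?V" if "(1, j) \<in> {(k, l). l \<in> nbr_union h E k}\<^sup>*" for j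
      using that
    proof (induction rule: rtrancl_induct)
      case base
      show ?case using N by simp
    next
      case (step j k)
      have "k \<in> nbr_union h E j" using step(2) by simp
      with edge[of j k] step.IH show ?case by metis
    qed
    have c: "v i = v 0" if "i < N" for i
    proof -
      have "(1, i + 1) \<in> {(k, l). l \<in> nbr_union h E k}\<^sup>*"
        using con that N unfolding union_connected_def by auto
      from conn[OF this] show ?thesis by simp
    qed
    have "(\<Sum>i<N. v i) = (\<Sum>i<N. v 0)" by (rule sum.cong[OF refl]) (rule c, simp)
    then have v0: "v 0 = 0" using s N by simp
    show "\<forall>i<N. v i = 0"
    proof (intro allI impI)
      fix i assume "i < N"
      from c[OF this] v0 show "v i = 0" by simp
    qed
  qed
  note gap = second_eigenvalue_spectral_gap[OF p, folded mat, folded lam2_def]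
  show "lam2 N h E \<pi> > 0" by (rule gap)
  assume x: "(\<Sum>i\<in>?V. x i) = 0"
  have "lam2 N h E \<pi> * (\<Sum>i<N. (x (i + 1))\<^sup>2) \<le> (\<Sum>i<N. x (i + 1) * (\<Sum>j<N. L i j * x (j + 1)))"
  proof (rule gap(2))
    show "(\<Sum>i<N. x (i + 1)) = 0" using x unfolding shift[of x] .
  qed
  also have "\<dots> = (\<Sum>i\<in>?V. x i * (\<Sum>k\<in>?V. Lc i k * x k))"
    unfolding L_def shift[of "\<lambda>k. Lc _ k * x k"] shift[of "\<lambda>i. x i * (\<Sum>k\<in>?V. Lc i k * x k)"] ..
  also have "\<dots> = (\<Sum>i\<in>?V. \<Sum>k\<in>?V. \<Sum>u\<in>{1..h}. \<pi> u * (x i * (laplacian E u i k * x k)))"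
    by (simp add: Lc_def sum_distrib_left sum_distrib_right ac_simps)
  also have "\<dots> = (\<Sum>i\<in>?V. \<Sum>u\<in>{1..h}. \<Sum>k\<in>?V. \<pi> u * (x i * (laplacian E u i k * x k)))"
    by (intro sum.cong refl sum.swap)
  also have "\<dots> = (\<Sum>u\<in>{1..h}. \<Sum>i\<in>?V. \<Sum>k\<in>?V. \<pi> u * (x i * (laplacian E u i k * x k)))"
    by (rule sum.swap)
  also have "\<dots> = (\<Sum>u\<in>{1..h}. \<pi> u * (\<Sum>i\<in>?V. x i * (\<Sum>k\<in>?V. laplacian E u i k * x k)))"
    by (simp add: sum_distrib_left)
  finally show "lam2 N h E \<pi> * (\<Sum>i\<in>?V. (x i)\<^sup>2)
       \<le> (\<Sum>u\<in>{1..h}. \<pi> u * (\<Sum>i\<in>?V. x i * (\<Sum>k\<in>?V. laplacian E u i k * x k)))"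
    unfolding shift[of "\<lambda>i. (x i)\<^sup>2"] .
qed

lemma exists_edge:
  assumes N: "N \<ge> 2" and g: "undirected_graphs N h E" and con: "union_connected N h E"
  obtains i j u where "u \<in> {1..h}" "{i, j} \<in> E u" "i \<in> {1..N}" "(i, j) \<in> pairs N h E"
proof -
  have "(1, 2) \<in> {(k, l). l \<in> nbr_union h E k}\<^sup>*"
    using con N unfolding union_connected_def by auto
  then obtain j where "j \<in> nbr_union h E 1"
    by (cases rule: converse_rtranclE) auto
  then show ?thesis using that[of _ 1 j] N by (auto simp: nbr_union_def pairs_def)
qed

text \<open>The unit vector of one pair (i, j) active in some topology is mapped to column i of J,
  whose diagonal entry 1 - 1/N is nonzero for N >= 2. Positivity matters because \<open>lamG\<close>
  is a divisor in \<open>alpha_const\<close> and appears in a Young weight.\<close>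

lemma lamG_pos:
  assumes N: "N \<ge> 2" and g: "undirected_graphs N h E" and con: "union_connected N h E"
  shows "lamG N h E > 0"
proof -
  obtain i j u where u: "u \<in> {1..h}" "{i, j} \<in> E u" "i \<in> {1..N}" and p: "(i, j) \<in> pairs N h E"
    using exists_edge[OF assms] .
  let ?A = "mprod {1..N} (Jmat N) (Wmat E u)"
  let ?x = "\<lambda>q. if q = (i, j) then 1 else 0 :: real"
  note fin = finite_pairs[OF g]
  have x1: "(\<Sum>q\<in>pairs N h E. (?x q)\<^sup>2) = 1"
  proof -
    have "(\<Sum>q\<in>pairs N h E. (?x q)\<^sup>2) = (\<Sum>q\<in>pairs N h E. if q = (i, j) then 1 else 0)"
      by (intro sum.cong) auto
    then show ?thesis using p fin by simp
  qed
  have Ax: "(\<Sum>q\<in>pairs N h E. ?A r q * ?x q) = Jmat N r i" for r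
  proof -
    have "(\<Sum>q\<in>pairs N h E. ?A r q * ?x q) = (\<Sum>q\<in>pairs N h E. if q = (i, j) then ?A r (i, j) else 0)"
      by (intro sum.cong) auto
    also have "\<dots> = ?A r (i, j)" using p fin by simp
    also have "\<dots> = (\<Sum>s\<in>{1..N}. if s = i then Jmat N r i else 0)"
      unfolding mprod_def using u by (intro sum.cong refl) (auto simp: Wmat_def)
    also have "\<dots> = Jmat N r i" using u by simp
    finally show ?thesis .
  qed
  have "0 < (Jmat N i i)\<^sup>2" using N by (simp add: Jmat_def)
  also have "\<dots> \<le> (\<Sum>r\<in>{1..N}. (Jmat N r i)\<^sup>2)" using u by (intro member_le_sum) auto
  finally have "0 < sqrt (\<Sum>r\<in>{1..N}. (\<Sum>q\<in>pairs N h E. ?A r q * ?x q)\<^sup>2)" unfolding Ax by simp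
  also have "\<dots> \<le> opnorm {1..N} (pairs N h E) ?A"
    using fin x1 by (intro opnorm_upper) auto
  finally have "0 < (opnorm {1..N} (pairs N h E) ?A)\<^sup>2" by simp
  also have "\<dots> \<le> lamG N h E" unfolding lamG_def using u by (intro Max_ge) auto
  finally show ?thesis .
qed

text \<open>J can be inserted at no cost next to a sum-zero vector, and multiplication by Q merely
  selects the row belonging to the second component of a pair. In this way the sums occurring in the
  drifts become bilinear forms of the matrices whose norms define the constants.\<close>

lemma gain_forms:
  fixes \<delta> :: "nat \<Rightarrow> real" and e :: "nat \<times> nat \<Rightarrow> real"
  assumes g: "undirected_graphs N h E" and u: "u \<in> {1..h}" and N: "N \<ge> 1"
  shows JW_form: "(\<Sum>i\<in>{1..N}. \<delta> i) = 0 \<Longrightarrow>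
      \<bar>\<Sum>i\<in>{1..N}. \<delta> i * (\<Sum>p\<in>pairs N h E. Wmat E u i p * e p)\<bar>
      \<le> sqrt (lamG N h E) * sqrt (\<Sum>i\<in>{1..N}. (\<delta> i)\<^sup>2) * sqrt (\<Sum>p\<in>pairs N h E. (e p)\<^sup>2)"
    and QW_form: "\<bar>\<Sum>p\<in>pairs N h E. e p * (\<Sum>q\<in>pairs N h E. Wmat E u (snd p) q * e q)\<bar>
      \<le> sqrt (lamQW N h E) * (\<Sum>p\<in>pairs N h E. (e p)\<^sup>2)"
    and QL_form: "\<bar>\<Sum>p\<in>pairs N h E. e p * (\<Sum>k\<in>{1..N}. laplacian E u (snd p) k * \<delta> k)\<bar>
      \<le> sqrt (lamQL N h E) * sqrt (\<Sum>p\<in>pairs N h E. (e p)\<^sup>2) * sqrt (\<Sum>i\<in>{1..N}. (\<delta> i)\<^sup>2)"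
proof -
  note fin = finite_pairs[OF g]
  have Q: "mprod {1..N} Qmat A p = A (snd p)" if "p \<in> pairs N h E" for p and A :: "nat \<Rightarrow> 'x \<Rightarrow> real"
  proof
    fix q
    have "mprod {1..N} Qmat A p q = (\<Sum>s\<in>{1..N}. if s = snd p then A (snd p) q else 0)"
      unfolding mprod_def by (intro sum.cong refl) (auto simp: Qmat_def)
    also have "\<dots> = A (snd p) q" using that pairs_subset[OF g] by auto
    finally show "mprod {1..N} Qmat A p q = A (snd p) q" .
  qed
  show "\<bar>\<Sum>i\<in>{1..N}. \<delta> i * (\<Sum>p\<in>pairs N h E. Wmat E u i p * e p)\<bar>
      \<le> sqrt (lamG N h E) * sqrt (\<Sum>i\<in>{1..N}. (\<delta> i)\<^sup>2) * sqrt (\<Sum>p\<in>pairs N h E. (e p)\<^sup>2)"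
    if s: "(\<Sum>i\<in>{1..N}. \<delta> i) = 0"
  proof -
    have J: "(\<Sum>i\<in>{1..N}. \<delta> i * mprod {1..N} (Jmat N) (Wmat E u) i p) = (\<Sum>i\<in>{1..N}. \<delta> i * Wmat E u i p)" for p
    proof -
      have "mprod {1..N} (Jmat N) (Wmat E u) i p = Wmat E u i p - (\<Sum>s\<in>{1..N}. Wmat E u s p) / real N"
        if i: "i \<in> {1..N}" for i
      proof -
        have "mprod {1..N} (Jmat N) (Wmat E u) i p
            = (\<Sum>s\<in>{1..N}. (if s = i then Wmat E u i p else 0) - Wmat E u s p / real N)"
          unfolding mprod_def by (intro sum.cong refl) (auto simp: Jmat_def left_diff_distrib)
        then show ?thesis using i by (simp add: sum_subtractf sum_divide_distrib)
      qed
      then have "(\<Sum>i\<in>{1..N}. \<delta> i * mprod {1..N} (Jmat N) (Wmat E u) i p)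
          = (\<Sum>i\<in>{1..N}. \<delta> i * Wmat E u i p - \<delta> i * ((\<Sum>s\<in>{1..N}. Wmat E u s p) / real N))"
        by (intro sum.cong refl) (simp only: right_diff_distrib)
      also have "\<dots> = (\<Sum>i\<in>{1..N}. \<delta> i * Wmat E u i p) - (\<Sum>i\<in>{1..N}. \<delta> i) * ((\<Sum>s\<in>{1..N}. Wmat E u s p) / real N)"
        by (simp only: sum_subtractf sum_distrib_right)
      finally show ?thesis using s by simp
    qed
    have sw: "(\<Sum>i\<in>{1..N}. \<delta> i * (\<Sum>p\<in>pairs N h E. A i p * e p)) = (\<Sum>p\<in>pairs N h E. (\<Sum>i\<in>{1..N}. \<delta> i * A i p) * e p)"
      for A :: "nat \<Rightarrow> nat \<times> nat \<Rightarrow> real"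
      unfolding sum_distrib_left sum_distrib_right by (subst sum.swap) (simp add: ac_simps)
    have "(\<Sum>i\<in>{1..N}. \<delta> i * (\<Sum>p\<in>pairs N h E. Wmat E u i p * e p))
      = (\<Sum>i\<in>{1..N}. \<delta> i * (\<Sum>p\<in>pairs N h E. mprod {1..N} (Jmat N) (Wmat E u) i p * e p))"
      unfolding sw J ..
    then show ?thesis unfolding lamG_def
      using bilinear_form_le_Max_opnorm[of "{1..N}" "pairs N h E" "{1..h}" u \<delta> "\<lambda>u. mprod {1..N} (Jmat N) (Wmat E u)" e] fin u
      by simp
  qed
  have "(\<Sum>p\<in>pairs N h E. e p * (\<Sum>q\<in>pairs N h E. Wmat E u (snd p) q * e q))
     = (\<Sum>p\<in>pairs N h E. e p * (\<Sum>q\<in>pairs N h E. mprod {1..N} Qmat (Wmat E u) p q * e q))"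
    by (intro sum.cong refl) (simp only: Q)
  moreover have "sqrt (\<Sum>p\<in>pairs N h E. (e p)\<^sup>2) * sqrt (\<Sum>p\<in>pairs N h E. (e p)\<^sup>2) = (\<Sum>p\<in>pairs N h E. (e p)\<^sup>2)"
    by (simp add: sum_nonneg)
  ultimately show "\<bar>\<Sum>p\<in>pairs N h E. e p * (\<Sum>q\<in>pairs N h E. Wmat E u (snd p) q * e q)\<bar>
      \<le> sqrt (lamQW N h E) * (\<Sum>p\<in>pairs N h E. (e p)\<^sup>2)"
    unfolding lamQW_def
    using bilinear_form_le_Max_opnorm[of "pairs N h E" "pairs N h E" "{1..h}" u e "\<lambda>u. mprod {1..N} Qmat (Wmat E u)" e] fin u
    by (simp add: mult.assoc)
  have "(\<Sum>p\<in>pairs N h E. e p * (\<Sum>k\<in>{1..N}. laplacian E u (snd p) k * \<delta> k))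
     = (\<Sum>p\<in>pairs N h E. e p * (\<Sum>k\<in>{1..N}. mprod {1..N} Qmat (laplacian E u) p k * \<delta> k))"
    by (intro sum.cong refl) (simp only: Q)
  then show "\<bar>\<Sum>p\<in>pairs N h E. e p * (\<Sum>k\<in>{1..N}. laplacian E u (snd p) k * \<delta> k)\<bar>
      \<le> sqrt (lamQL N h E) * sqrt (\<Sum>p\<in>pairs N h E. (e p)\<^sup>2) * sqrt (\<Sum>i\<in>{1..N}. (\<delta> i)\<^sup>2)"
    unfolding lamQL_def
    using bilinear_form_le_Max_opnorm[of "pairs N h E" "{1..N}" "{1..h}" u e "\<lambda>u. mprod {1..N} Qmat (laplacian E u)" \<delta>] fin u
    by simp
qed

section \<open>Young's inequality, the Gaussian distribution function and the projection\<close>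

lemma Young_sqrt:
  fixes a b l k :: real
  assumes "a \<ge> 0" "b \<ge> 0" "l \<ge> 0" "k > 0"
  shows "2 * (sqrt l * sqrt a * sqrt b) \<le> k * a + l / k * b"
proof -
  have "0 \<le> (sqrt k * sqrt a - sqrt l / sqrt k * sqrt b)\<^sup>2" by simp
  also have "\<dots> = k * a + l / k * b - 2 * (sqrt l * sqrt a * sqrt b)"
    using assms by (simp add: power2_diff power_mult_distrib power_divide)
  finally show ?thesis by simp
qed

text \<open>The centred density decreases in |y|, so on an interval inside [-K, K] it is at least
  its value at K.\<close>

lemma gauss_F_lower:
  assumes \<sigma>: "\<sigma> > 0" and ab: "a \<le> b" "\<bar>a\<bar> \<le> K" "\<bar>b\<bar> \<le> K"
  shows "normal_density 0 \<sigma> K * (b - a) \<le> gauss_F \<sigma> b - gauss_F \<sigma> a"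
proof -
  let ?G = "density lborel (\<lambda>y. ennreal (normal_density 0 \<sigma> y))"
  interpret G: prob_space ?G using \<sigma> by (rule prob_space_normal_density)
  have "measure ?G ({..b} - {..a}) = measure ?G {..b} - measure ?G {..a}"
    using ab by (intro G.finite_measure_Diff) auto
  moreover have "{..b} - {..a} = {a<..b}" by auto
  ultimately have eq: "gauss_F \<sigma> b - gauss_F \<sigma> a = measure ?G {a<..b}" by (simp add: gauss_F_def)
  have "ennreal (normal_density 0 \<sigma> K * (b - a)) = (\<integral>\<^sup>+y. ennreal (normal_density 0 \<sigma> K) * indicator {a<..b} y \<partial>lborel)"
    using ab by (simp add: nn_integral_cmult ennreal_mult normal_density_nonneg)
  also have "\<dots> \<le> (\<integral>\<^sup>+y. ennreal (normal_density 0 \<sigma> y) * indicator {a<..b} y \<partial>lborel)"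
  proof (intro nn_integral_mono)
    fix y :: real
    show "ennreal (normal_density 0 \<sigma> K) * indicator {a<..b} y \<le> ennreal (normal_density 0 \<sigma> y) * indicator {a<..b} y"
    proof (cases "y \<in> {a<..b}")
      case True
      then have "\<bar>y\<bar> \<le> \<bar>K\<bar>" using ab by auto
      then have "y\<^sup>2 \<le> K\<^sup>2" by (simp add: abs_le_square_iff)
      then have "normal_density 0 \<sigma> K \<le> normal_density 0 \<sigma> y"
        using \<sigma> by (auto simp: normal_density_def intro!: divide_right_mono)
      then show ?thesis using True by (simp add: ennreal_leI)
    qed simp
  qed
  also have "\<dots> = emeasure ?G {a<..b}" by (subst emeasure_density) auto
  also have "\<dots> = ennreal (measure ?G {a<..b})" by (rule G.emeasure_eq_measure)
  finally show ?thesis unfolding eq by (simp add: ennreal_le_iff)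
qed

lemma gauss_F_bounds: "\<sigma> > 0 \<Longrightarrow> 0 \<le> gauss_F \<sigma> z \<and> gauss_F \<sigma> z \<le> 1"
  unfolding gauss_F_def using prob_space.prob_le_1[OF prob_space_normal_density] by auto

text \<open>Both c - z and c - y lie in [-(|c| + B), |c| + B], where F has slope at least the
  density at the endpoint. As z enters F with a minus sign, this slope acts as a restoring force
  towards y. The slack constant k is meant for the minimum of such densities over all pairs.\<close>

lemma gauss_F_contraction:
  assumes \<sigma>: "\<sigma> > 0" and b: "\<bar>z\<bar> \<le> B" "\<bar>y\<bar> \<le> B"
    and k: "k \<le> normal_density 0 \<sigma> (\<bar>c\<bar> + B)"
  shows "(z - y) * (gauss_F \<sigma> (c - z) - gauss_F \<sigma> (c - y)) \<le> - k * (z - y)\<^sup>2"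
proof -
  let ?d = "normal_density 0 \<sigma> (\<bar>c\<bar> + B)"
  have "(z - y) * (gauss_F \<sigma> (c - z) - gauss_F \<sigma> (c - y)) \<le> - ?d * (z - y)\<^sup>2"
  proof (cases "z \<le> y")
    case True
    have "?d * ((c - z) - (c - y)) \<le> gauss_F \<sigma> (c - z) - gauss_F \<sigma> (c - y)"
      using True b by (intro gauss_F_lower \<sigma>) auto
    then have "(y - z) * (?d * (y - z)) \<le> (y - z) * (gauss_F \<sigma> (c - z) - gauss_F \<sigma> (c - y))"
      using True by (intro mult_left_mono) auto
    then show ?thesis by (simp add: algebra_simps power2_eq_square)
  next
    case False
    have "?d * ((c - y) - (c - z)) \<le> gauss_F \<sigma> (c - y) - gauss_F \<sigma> (c - z)"
      using False b by (intro gauss_F_lower \<sigma>) auto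
    then have "(z - y) * (?d * (z - y)) \<le> (z - y) * (gauss_F \<sigma> (c - y) - gauss_F \<sigma> (c - z))"
      using False by (intro mult_left_mono) auto
    then show ?thesis by (simp add: algebra_simps power2_eq_square)
  qed
  also have "\<dots> \<le> - k * (z - y)\<^sup>2" using k by (simp add: mult_right_mono)
  finally show ?thesis .
qed

lemma proj_bounds: "M \<ge> 0 \<Longrightarrow> \<bar>proj M x\<bar> \<le> M"
  by (auto simp: proj_def)

lemma proj_nonexpansive: "\<bar>y\<bar> \<le> M \<Longrightarrow> \<bar>proj M x - y\<bar> \<le> \<bar>x - y\<bar>"
  by (auto simp: proj_def max_def min_def)

section \<open>Stable linear recurrences\<close>

text \<open>This is p(S) X at time t, with S the shift operator; complex scalars allow p to be split
  into linear factors.\<close>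

definition shift_app :: "complex poly \<Rightarrow> (nat \<Rightarrow> complex) \<Rightarrow> nat \<Rightarrow> complex" where
  "shift_app p X t = (\<Sum>i\<le>degree p. coeff p i * X (t + i))"

lemma shift_app_eq:
  assumes "degree p \<le> n"
  shows "shift_app p X t = (\<Sum>i\<le>n. coeff p i * X (t + i))"
  unfolding shift_app_def using assms
  by (intro sum.mono_neutral_left) (auto simp: coeff_eq_0)

lemma shift_app_linear_factor:
  "shift_app ([:-a, 1:] * q) X t = shift_app q X (Suc t) - a * shift_app q X t"
proof -
  let ?n = "degree q"
  have deg: "degree ([:-a, 1:] * q) \<le> Suc ?n"
    using degree_mult_le[of "[:-a, 1:]" q] by simp
  have "shift_app ([:-a, 1:] * q) X t = (\<Sum>i\<le>Suc ?n. coeff ([:-a, 1:] * q) i * X (t + i))"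
    by (rule shift_app_eq[OF deg])
  also have "\<dots> = (\<Sum>i\<le>Suc ?n. - a * (coeff q i * X (t + i)) + coeff (pCons 0 q) i * X (t + i))"
    by (intro sum.cong refl) (simp add: algebra_simps)
  also have "\<dots> = - a * (\<Sum>i\<le>Suc ?n. coeff q i * X (t + i)) + (\<Sum>i\<le>Suc ?n. coeff (pCons 0 q) i * X (t + i))"
    by (simp only: sum.distrib sum_distrib_left)
  also have "(\<Sum>i\<le>Suc ?n. coeff q i * X (t + i)) = shift_app q X t"
    by (rule shift_app_eq[symmetric]) simp
  also have "(\<Sum>i\<le>Suc ?n. coeff (pCons 0 q) i * X (t + i)) = (\<Sum>i\<le>?n. coeff q i * X (Suc t + i))"
    by (subst sum.atMost_Suc_shift) simp
  also have "\<dots> = shift_app q X (Suc t)" by (simp add: shift_app_def)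
  finally show ?thesis by simp
qed

text \<open>A class of decay rates that is stable under passing a sequence through a contraction;
  it lets convergence to \<open>0\<close> and the rate \<open>O(1/t)\<close> be treated simultaneously.\<close>

locale rate_class =
  fixes Good :: "(nat \<Rightarrow> real) \<Rightarrow> bool"
  assumes zero: "Good (\<lambda>_. 0)"
    and add: "\<And>V W. Good V \<Longrightarrow> Good W \<Longrightarrow> Good (\<lambda>t. V t + W t)"
    and shift: "\<And>V. Good V \<Longrightarrow> Good (\<lambda>t. V (Suc t))"
    and dom: "\<And>V W C. Good V \<Longrightarrow> C \<ge> 0 \<Longrightarrow> (\<And>t. 0 \<le> W t) \<Longrightarrow> (\<And>t. W t \<le> C * V t) \<Longrightarrow> Good W"
    and step: "\<And>V W r C. Good V \<Longrightarrow> 0 \<le> r \<Longrightarrow> r < 1 \<Longrightarrow> C \<ge> 0 \<Longrightarrow> (\<And>t. 0 \<le> W t) \<Longrightarrow>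
        (\<And>t. W (Suc t) \<le> r * W t + C * V t) \<Longrightarrow> Good W"

text \<open>Jensen's inequality for the square at the convex combination of x and v/(1 - r) with
  weights r and 1 - r.\<close>

lemma convex_square:
  fixes r x v :: real
  assumes "0 \<le> r" "r < 1"
  shows "(r * x + v)\<^sup>2 \<le> r * x\<^sup>2 + v\<^sup>2 / (1 - r)"
proof -
  have "0 \<le> r * ((1 - r) * x - v)\<^sup>2 / (1 - r)" using assms by simp
  also have "\<dots> = r * x\<^sup>2 + v\<^sup>2 / (1 - r) - (r * x + v)\<^sup>2"
  proof -
    have "1 - r \<noteq> 0" using assms by simp
    then show ?thesis by (simp add: field_simps power2_eq_square)
  qed
  finally show ?thesis by simp
qed

text \<open>Roots are removed one at a time: if p = (s - a) q, then Y = q(S) X satisfies Y(t+1) = a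
  Y(t) + (p(S) X)(t) with |a| < 1. By \<open>convex_square\<close> this contracts in mean square, so
  the rate passes from p(S) X to q(S) X, until only a nonzero constant is left. The bounds on X may
  depend on t, as they serve integrability only.\<close>

lemma (in rate_class) stable_shift_poly:
  fixes p :: "complex poly" and X :: "nat \<Rightarrow> 'w \<Rightarrow> complex"
  assumes M: "finite_measure M"
    and X: "\<And>t. X t \<in> borel_measurable M" "\<And>t. \<exists>B. \<forall>\<omega>\<in>space M. cmod (X t \<omega>) \<le> B"
    and "p \<noteq> 0" "\<And>a. poly p a = 0 \<Longrightarrow> cmod a < 1"
    and "Good (\<lambda>t. \<integral>\<omega>. (cmod (shift_app p (\<lambda>t. X t \<omega>) t))\<^sup>2 \<partial>M)"
  shows "Good (\<lambda>t. \<integral>\<omega>. (cmod (X t \<omega>))\<^sup>2 \<partial>M)"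
  using assms(4-)
proof (induction "degree p" arbitrary: p)
  case 0
  then obtain k where k: "p = [:k:]" by (metis degree_eq_zeroE)
  have k0: "k \<noteq> 0" using 0 k by auto
  have eq: "(\<integral>\<omega>. (cmod (shift_app p (\<lambda>t. X t \<omega>) t))\<^sup>2 \<partial>M) = (cmod k)\<^sup>2 * (\<integral>\<omega>. (cmod (X t \<omega>))\<^sup>2 \<partial>M)" for t
    by (simp add: k shift_app_def norm_mult power_mult_distrib)
  show ?case
  proof (rule dom[OF 0(4), of "1 / (cmod k)\<^sup>2"])
    show "(\<integral>\<omega>. (cmod (X t \<omega>))\<^sup>2 \<partial>M) \<le> 1 / (cmod k)\<^sup>2 * (\<integral>\<omega>. (cmod (shift_app p (\<lambda>t. X t \<omega>) t))\<^sup>2 \<partial>M)" for t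
      unfolding eq using k0 by simp
  qed (auto intro!: Bochner_Integration.integral_nonneg)
next
  case (Suc d)
  have "\<not> constant (poly p)" using Suc.hyps(2) by (simp add: constant_degree)
  then obtain a where a: "poly p a = 0" using fundamental_theorem_of_algebra by blast
  then obtain q where q: "p = [:-a, 1:] * q" by (auto simp: poly_eq_0_iff_dvd)
  have q0: "q \<noteq> 0" using q Suc.prems(1) by auto
  have "degree p = degree [:-a, 1:] + degree q"
    unfolding q using q0 by (intro degree_mult_eq) auto
  then have dq: "d = degree q" using Suc.hyps(2) by simp
  have a1: "cmod a < 1" using Suc.prems(2)[OF a] .
  have bd: "(\<lambda>\<omega>. shift_app r (\<lambda>t. X t \<omega>) t) \<in> borel_measurable M"
    "\<exists>B. \<forall>\<omega>\<in>space M. cmod (shift_app r (\<lambda>t. X t \<omega>) t) \<le> B" for r t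
  proof -
    show "(\<lambda>\<omega>. shift_app r (\<lambda>t. X t \<omega>) t) \<in> borel_measurable M"
      unfolding shift_app_def using X(1) by (intro borel_measurable_sum borel_measurable_times borel_measurable_const)
    have "\<exists>B. \<forall>t. \<forall>\<omega>\<in>space M. cmod (X t \<omega>) \<le> B t" by (rule choice, rule allI, rule X(2))
    then obtain B where "\<forall>t. \<forall>\<omega>\<in>space M. cmod (X t \<omega>) \<le> B t" by (rule exE)
    then have B: "\<And>t \<omega>. \<omega> \<in> space M \<Longrightarrow> cmod (X t \<omega>) \<le> B t" by blast
    have "cmod (shift_app r (\<lambda>t. X t \<omega>) t) \<le> (\<Sum>i\<le>degree r. cmod (coeff r i) * B (t + i))" if "\<omega> \<in> space M" for \<omega>
      unfolding shift_app_def
      by (rule sum_norm_le) (auto simp: norm_mult intro!: mult_left_mono B[OF that])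
    then show "\<exists>B. \<forall>\<omega>\<in>space M. cmod (shift_app r (\<lambda>t. X t \<omega>) t) \<le> B" by blast
  qed
  have int: "integrable M (\<lambda>\<omega>. (cmod (shift_app r (\<lambda>t. X t \<omega>) t))\<^sup>2)" for r t
  proof -
    obtain B where B: "\<And>\<omega>. \<omega> \<in> space M \<Longrightarrow> cmod (shift_app r (\<lambda>t. X t \<omega>) t) \<le> B" using bd(2)[of r t] by blast
    have "(cmod (shift_app r (\<lambda>t. X t \<omega>) t))\<^sup>2 \<le> B\<^sup>2" if "\<omega> \<in> space M" for \<omega>
      using B[OF that] by (intro power_mono) auto
    moreover have "(\<lambda>\<omega>. (cmod (shift_app r (\<lambda>t. X t \<omega>) t))\<^sup>2) \<in> borel_measurable M"
      using bd(1)[of r t] by measurable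
    ultimately show ?thesis
      by (intro finite_measure.integrable_const_bound[OF M, of _ "B\<^sup>2"]) auto
  qed
  have "Good (\<lambda>t. \<integral>\<omega>. (cmod (shift_app q (\<lambda>t. X t \<omega>) t))\<^sup>2 \<partial>M)"
  proof (rule step[OF Suc.prems(3), of "cmod a" "1 / (1 - cmod a)"])
    fix t
    let ?Y = "\<lambda>t \<omega>. shift_app q (\<lambda>t. X t \<omega>) t" and ?V = "\<lambda>t \<omega>. shift_app p (\<lambda>t. X t \<omega>) t"
    have "(\<integral>\<omega>. (cmod (?Y (Suc t) \<omega>))\<^sup>2 \<partial>M) \<le> (\<integral>\<omega>. cmod a * (cmod (?Y t \<omega>))\<^sup>2 + 1 / (1 - cmod a) * (cmod (?V t \<omega>))\<^sup>2 \<partial>M)"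
    proof (rule integral_mono)
      show "integrable M (\<lambda>\<omega>. cmod a * (cmod (?Y t \<omega>))\<^sup>2 + 1 / (1 - cmod a) * (cmod (?V t \<omega>))\<^sup>2)"
        using int[of q t] int[of p t] by (intro Bochner_Integration.integrable_add) auto
      fix \<omega>
      have "?Y (Suc t) \<omega> = a * ?Y t \<omega> + ?V t \<omega>" unfolding q shift_app_linear_factor by simp
      then have "cmod (?Y (Suc t) \<omega>) \<le> cmod a * cmod (?Y t \<omega>) + cmod (?V t \<omega>)"
        by (metis norm_mult norm_triangle_ineq)
      then have "(cmod (?Y (Suc t) \<omega>))\<^sup>2 \<le> (cmod a * cmod (?Y t \<omega>) + cmod (?V t \<omega>))\<^sup>2"
        by (intro power_mono) auto
      also have "\<dots> \<le> cmod a * (cmod (?Y t \<omega>))\<^sup>2 + (cmod (?V t \<omega>))\<^sup>2 / (1 - cmod a)"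
        using a1 by (intro convex_square) auto
      finally show "(cmod (?Y (Suc t) \<omega>))\<^sup>2 \<le> cmod a * (cmod (?Y t \<omega>))\<^sup>2 + 1 / (1 - cmod a) * (cmod (?V t \<omega>))\<^sup>2"
        by simp
    qed (rule int)
    also have "\<dots> = cmod a * (\<integral>\<omega>. (cmod (?Y t \<omega>))\<^sup>2 \<partial>M) + 1 / (1 - cmod a) * (\<integral>\<omega>. (cmod (?V t \<omega>))\<^sup>2 \<partial>M)"
      using int[of q t] int[of p t] by simp
    finally show "(\<integral>\<omega>. (cmod (?Y (Suc t) \<omega>))\<^sup>2 \<partial>M) \<le>
      cmod a * (\<integral>\<omega>. (cmod (?Y t \<omega>))\<^sup>2 \<partial>M) + 1 / (1 - cmod a) * (\<integral>\<omega>. (cmod (?V t \<omega>))\<^sup>2 \<partial>M)" .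
  qed (use a1 in \<open>auto intro!: Bochner_Integration.integral_nonneg\<close>)
  moreover have "\<And>a. poly q a = 0 \<Longrightarrow> cmod a < 1" using Suc.prems(2) q by simp
  ultimately show ?case using Suc.hyps(1)[OF dq q0] by blast
qed

lemma contraction_tendsto_0:
  fixes V W :: "nat \<Rightarrow> real"
  assumes V: "V \<longlonglongrightarrow> 0" and r: "0 \<le> r" "r < 1" and nn: "\<And>t. 0 \<le> W t"
    and rec: "\<And>t. W (Suc t) \<le> r * W t + C * V t"
  shows "W \<longlonglongrightarrow> 0"
proof (rule LIMSEQ_I)
  fix \<epsilon> :: real assume e: "\<epsilon> > 0"
  define d where "d = \<epsilon> / 2"
  have d: "d > 0" using e by (simp add: d_def)
  have "(\<lambda>t. C * V t) \<longlonglongrightarrow> C * 0" by (intro tendsto_intros V)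
  then have "\<forall>\<^sub>F t in sequentially. C * V t < d * (1 - r)"
    using d r by (intro order_tendstoD(2)[of _ "C * 0"]) auto
  then obtain T where T: "\<And>t. t \<ge> T \<Longrightarrow> C * V t < d * (1 - r)"
    by (auto simp: eventually_sequentially)
  \<comment> \<open>d is the fixed point of the map w -> r w + d(1 - r), which dominates the
    recursion from T on; so the excess over d decays geometrically.\<close>
  have b: "W (T + k) - d \<le> r ^ k * W T" for k
  proof (induction k)
    case 0
    then show ?case using d by simp
  next
    case (Suc k)
    have "W (T + Suc k) \<le> r * W (T + k) + d * (1 - r)" using rec[of "T + k"] T[of "T + k"] by simp
    then have "W (T + Suc k) - d \<le> r * (W (T + k) - d)" by (simp add: algebra_simps)
    also have "\<dots> \<le> r * (r ^ k * W T)" using Suc r by (intro mult_left_mono)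
    finally show ?case by simp
  qed
  have "(\<lambda>k. r ^ k * W T) \<longlonglongrightarrow> 0 * W T" using r by (intro tendsto_intros LIMSEQ_power_zero) auto
  then have "\<forall>\<^sub>F k in sequentially. r ^ k * W T < d" using d by (intro order_tendstoD(2)[of _ "0 * W T"]) auto
  then obtain K where K: "\<And>k. k \<ge> K \<Longrightarrow> r ^ k * W T < d" by (auto simp: eventually_sequentially)
  show "\<exists>no. \<forall>n\<ge>no. norm (W n - 0) < \<epsilon>"
  proof (intro exI[of _ "T + K"] allI impI)
    fix n assume "n \<ge> T + K"
    then obtain k where n: "n = T + k" "k \<ge> K" by (metis add.assoc le_add1 le_iff_add)
    then show "norm (W n - 0) < \<epsilon>" using b[of k] K[of k] nn[of n] by (simp add: d_def)
  qed
qed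

text \<open>A number s strictly between r and 1 leaves room for the growth (t+2)/(t+1) of the
  weight, so that (t+1) W(t) stays bounded once r(t+2) <= s(t+1).\<close>

lemma contraction_bigo:
  fixes V W :: "nat \<Rightarrow> real"
  assumes V: "\<And>t. V t \<le> K / real (Suc t)" and r: "0 \<le> r" "r < 1" and C: "C \<ge> 0" and nn: "\<And>t. 0 \<le> W t"
    and rec: "\<And>t. W (Suc t) \<le> r * W t + C * V t"
  shows "\<exists>K'. \<forall>t. W t \<le> K' / real (Suc t)"
proof -
  define s where "s = (1 + r) / 2"
  have s: "r < s" "s < 1" "s > 0" using r by (auto simp: s_def)
  define K0 where "K0 = C * \<bar>K\<bar>"
  have K0: "K0 \<ge> 0" using C by (simp add: K0_def)
  obtain T :: nat where T: "real T \<ge> r / (s - r)" using real_arch_simple by blast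
  have rt: "r * real (Suc (Suc t)) \<le> s * real (Suc t)" if "t \<ge> T" for t
  proof -
    have "r / (s - r) \<le> real (Suc t)" using T that by linarith
    then have "r \<le> real (Suc t) * (s - r)" using s by (simp add: field_simps)
    then show ?thesis by (simp add: algebra_simps)
  qed
  \<comment> \<open>The sum bounds the times up to T; the second summand makes B invariant, since s
    B + 2 K0 <= B.\<close>
  define B where "B = (\<Sum>t\<le>T. real (Suc t) * W t) + 2 * K0 / (1 - s)"
  have B1: "2 * K0 / (1 - s) \<le> B" unfolding B_def using nn by (simp add: sum_nonneg)
  then have B2: "2 * K0 \<le> B * (1 - s)" using s by (simp add: field_simps)
  have small: "real (Suc t) * W t \<le> B" if "t \<le> T" for t
  proof -
    have "real (Suc t) * W t \<le> (\<Sum>t\<le>T. real (Suc t) * W t)" using that nn by (intro member_le_sum) auto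
    moreover have "0 \<le> 2 * K0 / (1 - s)" using K0 s by simp
    ultimately show ?thesis by (simp add: B_def)
  qed
  have "real (Suc t) * W t \<le> B" for t
  proof (cases "t \<le> T")
    case False
    then have "T \<le> t" by simp
    then show ?thesis
    proof (induction t rule: dec_induct)
      case base
      then show ?case using small by simp
    next
      case (step t)
      have "C * V t \<le> C * (\<bar>K\<bar> / real (Suc t))"
        using V[of t] C by (intro mult_left_mono order_trans[OF V] divide_right_mono) auto
      then have "W (Suc t) \<le> r * W t + K0 / real (Suc t)" using rec[of t] by (simp add: K0_def)
      then have "real (Suc (Suc t)) * W (Suc t) \<le> real (Suc (Suc t)) * (r * W t + K0 / real (Suc t))"
        by (intro mult_left_mono) auto
      also have "\<dots> = (r * real (Suc (Suc t))) * W t + real (Suc (Suc t)) / real (Suc t) * K0"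
        by (simp add: algebra_simps)
      also have "\<dots> \<le> (s * real (Suc t)) * W t + 2 * K0"
      proof (intro add_mono mult_right_mono rt nn K0)
        show "T \<le> t" using step by simp
        show "real (Suc (Suc t)) / real (Suc t) \<le> 2" by (simp add: field_simps)
      qed
      also have "\<dots> \<le> s * B + B * (1 - s)"
        using step.IH s B2 by (intro add_mono) (auto simp: mult.assoc intro!: mult_left_mono)
      finally show ?case by (simp add: algebra_simps)
    qed
  qed (rule small)
  then have "W t \<le> B / real (Suc t)" for t by (simp add: field_simps)
  then show ?thesis by blast
qed

lemma rate_class_tendsto_0: "rate_class (\<lambda>V. V \<longlonglongrightarrow> 0)"
proof
  show "(\<lambda>t. V t + W t) \<longlonglongrightarrow> 0" if "V \<longlonglongrightarrow> 0" "W \<longlonglongrightarrow> 0" for V W :: "nat \<Rightarrow> real"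
    using tendsto_add[OF that] by simp
  show "(\<lambda>t. V (Suc t)) \<longlonglongrightarrow> 0" if "V \<longlonglongrightarrow> 0" for V :: "nat \<Rightarrow> real"
    using that by (rule LIMSEQ_Suc)
  show "W \<longlonglongrightarrow> 0" if V: "V \<longlonglongrightarrow> 0" and W: "\<And>t. 0 \<le> W t" "\<And>t. W t \<le> C * V t"
    for V W :: "nat \<Rightarrow> real" and C
    by (rule tendsto_sandwich[OF _ _ tendsto_const tendsto_mult_right_zero[OF V, of C]]) (use W in auto)
  show "W \<longlonglongrightarrow> 0" if "V \<longlonglongrightarrow> 0" "0 \<le> r" "r < 1" "\<And>t. 0 \<le> W t" "\<And>t. W (Suc t) \<le> r * W t + C * V t"
    for V W :: "nat \<Rightarrow> real" and r C
    using that by (rule contraction_tendsto_0)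
qed simp

text \<open>The denominator \<open>Suc t\<close> makes the class meaningful from time 0 on, where
  division by t would yield 0.\<close>

lemma rate_class_inverse: "rate_class (\<lambda>V. \<exists>K. \<forall>t. V t \<le> K / real (Suc t))"
proof
  let ?G = "\<lambda>V. \<exists>K. \<forall>t. V t \<le> K / real (Suc t)"
  show "?G (\<lambda>_. 0)" by (intro exI[of _ 0]) simp
  show "?G (\<lambda>t. V t + W t)" if V: "?G V" and W: "?G W" for V W
  proof -
    obtain K1 where K1: "\<And>t. V t \<le> K1 / real (Suc t)" using V by blast
    obtain K2 where K2: "\<And>t. W t \<le> K2 / real (Suc t)" using W by blast
    have "V t + W t \<le> (K1 + K2) / real (Suc t)" for t
      using K1[of t] K2[of t] unfolding add_divide_distrib by linarith
    then show ?thesis by blast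
  qed
  show "?G (\<lambda>t. V (Suc t))" if V: "?G V" for V
  proof -
    obtain K1 where K1: "\<And>t. V t \<le> K1 / real (Suc t)" using V by blast
    have "V (Suc t) \<le> \<bar>K1\<bar> / real (Suc t)" for t
    proof -
      have "V (Suc t) \<le> K1 / real (Suc (Suc t))" by (rule K1)
      also have "\<dots> \<le> \<bar>K1\<bar> / real (Suc t)" by (intro frac_le) auto
      finally show ?thesis .
    qed
    then show ?thesis by blast
  qed
  show "?G W" if V: "?G V" and C: "C \<ge> 0" and W: "\<And>t. W t \<le> C * V t" for V W :: "nat \<Rightarrow> real" and C
  proof -
    obtain K1 where K1: "\<And>t. V t \<le> K1 / real (Suc t)" using V by blast
    have "W t \<le> C * K1 / real (Suc t)" for t
      using W[of t] mult_left_mono[OF K1[of t] C] by simp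
    then show ?thesis by blast
  qed
  show "?G W" if V: "?G V" and r: "0 \<le> r" "r < 1" and C: "C \<ge> 0" and W: "\<And>t. 0 \<le> W t" "\<And>t. W (Suc t) \<le> r * W t + C * V t"
    for V W :: "nat \<Rightarrow> real" and r C
  proof -
    obtain K1 where K1: "\<And>t. V t \<le> K1 / real (Suc t)" using V by blast
    show ?thesis by (rule contraction_bigo[OF K1 r C W])
  qed
qed

section \<open>One step of the consensus scheme\<close>

\<comment> \<open>keeps the index sets \<open>{1..N}\<close> and \<open>{1..h}\<close> in this form\<close>
declare One_nat_def [simp del]

text \<open>Only scalar outputs and estimates occur here; the state dimension and the gains are
  eliminated by \<open>gainK2_step\<close>. Thresholds, noises and estimates are all indexed by
  ordered pairs.\<close>

locale consensus_scheme = markov_noise M h P m "pairs N h E" D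
  for M :: "'w measure" and h P m N E and D :: "nat \<times> nat \<Rightarrow> nat \<Rightarrow> 'w \<Rightarrow> real" +
  fixes t0 :: nat and \<pi> :: "nat \<Rightarrow> real" and c :: "nat \<times> nat \<Rightarrow> real" and \<sigma> \<beta> \<gamma> Mb :: real
    and y0 :: "nat \<Rightarrow> real" and z0 :: "nat \<times> nat \<Rightarrow> real"
    and y :: "nat \<Rightarrow> nat \<Rightarrow> 'w \<Rightarrow> real" and z :: "nat \<times> nat \<Rightarrow> nat \<Rightarrow> 'w \<Rightarrow> real"
  assumes N2: "N \<ge> 2" and h1: "h \<ge> 1"
    and graphs: "undirected_graphs N h E" and connected: "union_connected N h E"
    and stoch: "stochastic h P" and irred: "irreducible_tm h P" and station: "stationary h P \<pi>"
    and \<sigma>: "\<sigma> > 0"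
    and noise_law: "\<And>p t. p \<in> pairs N h E \<Longrightarrow>
      distributed M lborel (D p t) (\<lambda>x. ennreal (normal_density 0 \<sigma> x))"
    and params: "\<beta> > 0" "\<gamma> > 0" "real t0 > \<gamma> * real (dmax N h E) - 1" "Mb > 0"
    and y_init: "\<And>i \<omega>. i \<in> {1..N} \<Longrightarrow> y i (Suc t0) \<omega> = y0 i" "\<And>i. i \<in> {1..N} \<Longrightarrow> \<bar>y0 i\<bar> \<le> Mb"
    and z_init: "\<And>p \<omega>. p \<in> pairs N h E \<Longrightarrow> z p t0 \<omega> = z0 p" "\<And>p. p \<in> pairs N h E \<Longrightarrow> \<bar>z0 p\<bar> \<le> Mb"
    and z_rec: "\<And>p t \<omega>. p \<in> pairs N h E \<Longrightarrow> t \<ge> Suc t0 \<Longrightarrow> \<omega> \<in> space M \<Longrightarrow>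
      z p t \<omega> = proj Mb (z p (t - 1) \<omega> + \<beta> / real t * adj E (m t \<omega>) (fst p) (snd p) *
         (gauss_F \<sigma> (c p - z p (t - 1) \<omega>) - (if y (snd p) t \<omega> + D p t \<omega> \<le> c p then 1 else 0)))"
    and y_rec: "\<And>i t \<omega>. i \<in> {1..N} \<Longrightarrow> t \<ge> Suc t0 \<Longrightarrow> \<omega> \<in> space M \<Longrightarrow>
      y i (Suc t) \<omega> = y i t \<omega> + \<gamma> / real (Suc t) * (\<Sum>j\<in>nbr E (m t \<omega>) i. z (i, j) t \<omega> - y i t \<omega>)"
begin

abbreviation V where "V \<equiv> {1..N}"
abbreviation Pr where "Pr \<equiv> pairs N h E"

lemma finite_Pr [simp]: "finite Pr"
  by (rule finite_pairs[OF graphs])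

lemma snd_Pr: "p \<in> Pr \<Longrightarrow> snd p \<in> V" and fst_Pr: "p \<in> Pr \<Longrightarrow> fst p \<in> V"
  using pairs_subset[OF graphs] by auto

lemma pi_pos: "u \<in> {1..h} \<Longrightarrow> \<pi> u > 0"
  using stationary_pos[OF stoch irred station] .

lemma gauss_F_measurable [measurable]: "gauss_F \<sigma> \<in> borel_measurable borel"
proof (rule borel_measurable_mono)
  show "mono (gauss_F \<sigma>)"
  proof (rule monoI)
    fix a b :: real assume ab: "a \<le> b"
    have "0 \<le> normal_density 0 \<sigma> (max \<bar>a\<bar> \<bar>b\<bar>) * (b - a)"
      using ab by (intro mult_nonneg_nonneg normal_density_nonneg) auto
    also have "\<dots> \<le> gauss_F \<sigma> b - gauss_F \<sigma> a"
      by (rule gauss_F_lower[OF \<sigma> ab]) auto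
    finally show "gauss_F \<sigma> a \<le> gauss_F \<sigma> b" by simp
  qed
qed

definition g :: "nat \<times> nat \<Rightarrow> nat \<Rightarrow> 'w \<Rightarrow> real" where
  "g p t \<omega> = adj E (m t \<omega>) (fst p) (snd p) *
     (gauss_F \<sigma> (c p - z p (t - 1) \<omega>) - (if y (snd p) t \<omega> + D p t \<omega> \<le> c p then 1 else 0))"

lemma z_rec_g: "p \<in> Pr \<Longrightarrow> t \<ge> Suc t0 \<Longrightarrow> \<omega> \<in> space M \<Longrightarrow>
    z p t \<omega> = proj Mb (z p (t - 1) \<omega> + \<beta> / real t * g p t \<omega>)"
  unfolding g_def by (subst z_rec) (auto simp: mult.assoc)

lemma g_bound: "\<bar>g p t \<omega>\<bar> \<le> 1"
proof -
  have "\<bar>adj E (m t \<omega>) (fst p) (snd p)\<bar> \<le> 1" using adj_bounds by (simp add: abs_le_iff adj_def)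
  moreover have "\<bar>gauss_F \<sigma> (c p - z p (t - 1) \<omega>) - (if y (snd p) t \<omega> + D p t \<omega> \<le> c p then 1 else 0)\<bar> \<le> 1"
    using gauss_F_bounds[OF \<sigma>, of "c p - z p (t - 1) \<omega>"] by auto
  ultimately have "\<bar>adj E (m t \<omega>) (fst p) (snd p)\<bar> *
     \<bar>gauss_F \<sigma> (c p - z p (t - 1) \<omega>) - (if y (snd p) t \<omega> + D p t \<omega> \<le> c p then 1 else 0)\<bar> \<le> 1 * 1"
    by (intro mult_mono) auto
  then show ?thesis unfolding g_def abs_mult by simp
qed

lemma z_bound: "p \<in> Pr \<Longrightarrow> t \<ge> t0 \<Longrightarrow> \<omega> \<in> space M \<Longrightarrow> \<bar>z p t \<omega>\<bar> \<le> Mb"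
proof (cases "t = t0")
  case True
  then show "p \<in> Pr \<Longrightarrow> \<bar>z p t \<omega>\<bar> \<le> Mb" using z_init[of p] by simp
next
  case False
  assume "p \<in> Pr" "t \<ge> t0" "\<omega> \<in> space M"
  then show ?thesis using z_rec_g[of p t \<omega>] proj_bounds[of Mb] params False by auto
qed

lemma card_nbr_le:
  assumes "i \<in> V" "u \<in> {1..h}"
  shows "card (nbr E u i) \<le> dmax N h E"
proof -
  have "finite (nbr_union h E i)"
  proof (rule finite_subset)
    show "nbr_union h E i \<subseteq> V" unfolding nbr_union_eq using nbr_subset[OF graphs] by blast
  qed simp
  moreover have "nbr E u i \<subseteq> nbr_union h E i" using assms by (auto simp: nbr_def nbr_union_def)
  ultimately have "card (nbr E u i) \<le> card (nbr_union h E i)" by (rule card_mono)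
  also have "\<dots> \<le> dmax N h E" unfolding dmax_def using assms by (intro Max_ge) auto
  finally show ?thesis .
qed

text \<open>The lower bound on t0 gives \<gamma> times the maximal degree below t + 1, so the
  neighbours have total weight at most 1. Each new output is then a convex combination of the old
  one and of estimates that the projection confines to [-Mb, Mb].\<close>

lemma y_bound:
  assumes "i \<in> V" "t \<ge> Suc t0" "\<omega> \<in> space M"
  shows "\<bar>y i t \<omega>\<bar> \<le> Mb"
  using assms(2,1)
proof (induction t arbitrary: i rule: dec_induct)
  case base
  then show ?case using y_init by simp
next
  case (step t)
  define a where "a = \<gamma> / real (Suc t)"
  define S where "S = nbr E (m t \<omega>) i"
  have a: "a > 0" using params by (simp add: a_def)
  have "real (card S) \<le> real (dmax N h E)"
    unfolding S_def using card_nbr_le m_range assms step by simp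
  then have "\<gamma> * real (card S) \<le> \<gamma> * real (dmax N h E)" using params by simp
  also have "\<dots> < real (Suc t)" using params step by simp
  finally have 1: "a * real (card S) \<le> 1" unfolding a_def by (simp add: field_simps)
  have zb: "\<bar>z (i, j) t \<omega>\<bar> \<le> Mb" if j: "j \<in> S" for j
  proof -
    have "(i, j) \<in> Pr" unfolding pairs_iff using j step.prems m_range[OF assms(3), of t]
      unfolding S_def nbr_def by blast
    then show ?thesis using z_bound step assms by auto
  qed
  have "y i (Suc t) \<omega> = (1 - a * real (card S)) * y i t \<omega> + a * (\<Sum>j\<in>S. z (i, j) t \<omega>)"
    using step assms unfolding a_def S_def by (subst y_rec) (auto simp: sum_subtractf algebra_simps)
  also have "\<bar>\<dots>\<bar> \<le> \<bar>(1 - a * real (card S)) * y i t \<omega>\<bar> + \<bar>a * (\<Sum>j\<in>S. z (i, j) t \<omega>)\<bar>"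
    by (rule abs_triangle_ineq)
  also have "\<dots> \<le> (1 - a * real (card S)) * Mb + a * (real (card S) * Mb)"
  proof (rule add_mono)
    show "\<bar>(1 - a * real (card S)) * y i t \<omega>\<bar> \<le> (1 - a * real (card S)) * Mb"
      unfolding abs_mult using 1 step.IH step.prems by (intro mult_mono) auto
    have "\<bar>\<Sum>j\<in>S. z (i, j) t \<omega>\<bar> \<le> (\<Sum>j\<in>S. \<bar>z (i, j) t \<omega>\<bar>)" by (rule sum_abs)
    also have "\<dots> \<le> real (card S) * Mb" using zb by (intro sum_bounded_above) auto
    finally show "\<bar>a * (\<Sum>j\<in>S. z (i, j) t \<omega>)\<bar> \<le> a * (real (card S) * Mb)"
      unfolding abs_mult using a by simp
  qed
  also have "\<dots> = Mb" by (simp add: algebra_simps)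
  finally show ?case .
qed

text \<open>Uniform order t^(-k): the bound holds at every sample point, not only in expectation, so
  remainders may be multiplied by bounded random factors before any average is taken.\<close>

definition Ob :: "nat \<Rightarrow> (nat \<Rightarrow> 'w \<Rightarrow> real) \<Rightarrow> bool" where
  "Ob k f \<longleftrightarrow> (\<exists>C. \<forall>t\<ge>Suc t0. \<forall>\<omega>\<in>space M. \<bar>f t \<omega>\<bar> \<le> C / real t ^ k)"

lemma ObI: "(\<And>t \<omega>. t \<ge> Suc t0 \<Longrightarrow> \<omega> \<in> space M \<Longrightarrow> \<bar>f t \<omega>\<bar> \<le> C / real t ^ k) \<Longrightarrow> Ob k f"
  unfolding Ob_def by blast

lemma ObE:
  assumes "Ob k f"
  obtains C where "C \<ge> 0" "\<And>t \<omega>. t \<ge> Suc t0 \<Longrightarrow> \<omega> \<in> space M \<Longrightarrow> \<bar>f t \<omega>\<bar> \<le> C / real t ^ k"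
proof -
  obtain C where C: "\<And>t \<omega>. t \<ge> Suc t0 \<Longrightarrow> \<omega> \<in> space M \<Longrightarrow> \<bar>f t \<omega>\<bar> \<le> C / real t ^ k"
    using assms unfolding Ob_def by blast
  have "\<bar>f t \<omega>\<bar> \<le> \<bar>C\<bar> / real t ^ k" if "t \<ge> Suc t0" "\<omega> \<in> space M" for t \<omega>
  proof -
    have "C / real t ^ k \<le> \<bar>C\<bar> / real t ^ k" by (intro divide_right_mono) auto
    with C[OF that] show ?thesis by linarith
  qed
  then show ?thesis using that[of "\<bar>C\<bar>"] by simp
qed

lemma Ob_cong:
  "Ob k g' \<Longrightarrow> (\<And>t \<omega>. t \<ge> Suc t0 \<Longrightarrow> \<omega> \<in> space M \<Longrightarrow> f' t \<omega> = g' t \<omega>) \<Longrightarrow> Ob k f'"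
  unfolding Ob_def by simp

lemma Ob_bound: "(\<And>t \<omega>. t \<ge> Suc t0 \<Longrightarrow> \<omega> \<in> space M \<Longrightarrow> \<bar>f t \<omega>\<bar> \<le> C) \<Longrightarrow> Ob 0 f"
  by (rule ObI[where C = C]) simp

lemma Ob_add:
  assumes "Ob k f" "Ob k f'" shows "Ob k (\<lambda>t \<omega>. f t \<omega> + f' t \<omega>)"
proof -
  obtain C C' where C: "\<And>t \<omega>. t \<ge> Suc t0 \<Longrightarrow> \<omega> \<in> space M \<Longrightarrow> \<bar>f t \<omega>\<bar> \<le> C / real t ^ k"
    and C': "\<And>t \<omega>. t \<ge> Suc t0 \<Longrightarrow> \<omega> \<in> space M \<Longrightarrow> \<bar>f' t \<omega>\<bar> \<le> C' / real t ^ k"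
    using assms by (metis ObE)
  show ?thesis
  proof (rule ObI)
    fix t \<omega> assume "t \<ge> Suc t0" "\<omega> \<in> space M"
    from C[OF this] C'[OF this] show "\<bar>f t \<omega> + f' t \<omega>\<bar> \<le> (C + C') / real t ^ k"
      unfolding add_divide_distrib by linarith
  qed
qed

lemma Ob_mult:
  assumes "Ob k f" "Ob l f'" shows "Ob (k + l) (\<lambda>t \<omega>. f t \<omega> * f' t \<omega>)"
proof -
  obtain C C' where C: "C \<ge> 0" "\<And>t \<omega>. t \<ge> Suc t0 \<Longrightarrow> \<omega> \<in> space M \<Longrightarrow> \<bar>f t \<omega>\<bar> \<le> C / real t ^ k"
    and C': "C' \<ge> 0" "\<And>t \<omega>. t \<ge> Suc t0 \<Longrightarrow> \<omega> \<in> space M \<Longrightarrow> \<bar>f' t \<omega>\<bar> \<le> C' / real t ^ l"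
    using assms by (metis ObE)
  show ?thesis
  proof (rule ObI)
    fix t \<omega> assume t: "t \<ge> Suc t0" "\<omega> \<in> space M"
    have "\<bar>f t \<omega>\<bar> * \<bar>f' t \<omega>\<bar> \<le> (C / real t ^ k) * (C' / real t ^ l)"
      using C(1) C'(1) C(2)[OF t] C'(2)[OF t] by (intro mult_mono) auto
    then show "\<bar>f t \<omega> * f' t \<omega>\<bar> \<le> (C * C') / real t ^ (k + l)" by (simp add: abs_mult power_add)
  qed
qed

lemma Ob_const: "Ob 0 (\<lambda>_ _. r)"
  by (rule Ob_bound[where C = "\<bar>r\<bar>"]) simp

lemma Ob_cmult: "Ob k f \<Longrightarrow> Ob k (\<lambda>t \<omega>. r * f t \<omega>)"
  using Ob_mult[OF Ob_const] by fastforce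

lemma Ob_diff: "Ob k f \<Longrightarrow> Ob k f' \<Longrightarrow> Ob k (\<lambda>t \<omega>. f t \<omega> - f' t \<omega>)"
  using Ob_add[OF _ Ob_cmult[of k f' "-1"]] by simp

lemma Ob_sum: "finite A \<Longrightarrow> (\<And>a. a \<in> A \<Longrightarrow> Ob k (f a)) \<Longrightarrow> Ob k (\<lambda>t \<omega>. \<Sum>a\<in>A. f a t \<omega>)"
proof (induction A rule: finite_induct)
  case empty
  then show ?case by (auto intro: ObI[where C = 0])
next
  case (insert x F)
  then show ?case using Ob_add[of k "f x" "\<lambda>t \<omega>. \<Sum>a\<in>F. f a t \<omega>"] by simp
qed

lemma Ob_inverse: "Ob 1 (\<lambda>t \<omega>. r / real t)" "Ob 1 (\<lambda>t \<omega>. r / real (Suc t))"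
   "Ob 2 (\<lambda>t \<omega>. r / real (Suc t) - r / real t)"
proof -
  show "Ob 1 (\<lambda>t \<omega>. r / real t)" by (rule ObI[where C = "\<bar>r\<bar>"]) simp
  show "Ob 1 (\<lambda>t \<omega>. r / real (Suc t))"
    by (rule ObI[where C = "\<bar>r\<bar>"]) (auto intro!: divide_left_mono)
  show "Ob 2 (\<lambda>t \<omega>. r / real (Suc t) - r / real t)"
  proof (rule ObI[where C = "\<bar>r\<bar>"])
    fix t assume "t \<ge> Suc t0"
    then have t: "t \<ge> 1" by simp
    have "\<bar>r / real (Suc t) - r / real t\<bar> = \<bar>r\<bar> * (1 / real t - 1 / real (Suc t))"
    proof -
      have "r / real (Suc t) - r / real t = - (r * (1 / real t - 1 / real (Suc t)))"
        by (simp add: right_diff_distrib)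
      then show ?thesis using inverse_step_bound(2)[OF t] by (simp add: abs_mult)
    qed
    also have "\<dots> \<le> \<bar>r\<bar> * (1 / (real t)\<^sup>2)"
      using inverse_step_bound(1)[OF t] by (intro mult_left_mono) auto
    finally show "\<bar>r / real (Suc t) - r / real t\<bar> \<le> \<bar>r\<bar> / (real t)\<^sup>2" by simp
  qed
qed

section \<open>Disagreement and estimation errors, and the expansion of their squares over one
  step\<close>

definition \<delta> :: "nat \<Rightarrow> nat \<Rightarrow> 'w \<Rightarrow> real" where
  "\<delta> i t \<omega> = y i t \<omega> - (\<Sum>j\<in>V. y j t \<omega>) / real N"

text \<open>Old estimate against current output. Unlike \<open>\<epsilon>\<close>, which uses the
  new estimate, this is measurable with respect to \<open>past t\<close>, so the noise at time t can
  be averaged out against it.\<close>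

definition e :: "nat \<times> nat \<Rightarrow> nat \<Rightarrow> 'w \<Rightarrow> real" where
  "e p t \<omega> = z p (t - 1) \<omega> - y (snd p) t \<omega>"

definition \<epsilon> :: "nat \<times> nat \<Rightarrow> nat \<Rightarrow> 'w \<Rightarrow> real" where
  "\<epsilon> p t \<omega> = z p t \<omega> - y (snd p) t \<omega>"

text \<open>With \<open>q\<close> equal to \<open>\<epsilon>\<close> this is the drift acting on the
  outputs, with \<open>q\<close> equal to \<open>e\<close> its past-measurable version. The mean
  over the agents is not subtracted, because it cancels when paired with
  \<open>\<delta>\<close>.\<close>

definition drift :: "(nat \<times> nat \<Rightarrow> nat \<Rightarrow> 'w \<Rightarrow> real) \<Rightarrow> nat \<Rightarrow> nat \<Rightarrow> 'w \<Rightarrow> real" where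
  "drift q i t \<omega> = (\<Sum>p\<in>Pr. Wmat E (m t \<omega>) i p * q p t \<omega>) - (\<Sum>k\<in>V. laplacian E (m t \<omega>) i k * \<delta> k t \<omega>)"

lemma sum_\<delta>: "(\<Sum>i\<in>V. \<delta> i t \<omega>) = 0"
  using N2 by (simp add: \<delta>_def sum_subtractf)

lemma y_step:
  assumes i: "i \<in> V" and t: "t \<ge> Suc t0" and \<omega>: "\<omega> \<in> space M"
  shows "y i (Suc t) \<omega> = y i t \<omega> + \<gamma> / real (Suc t) * drift \<epsilon> i t \<omega>"
proof -
  let ?u = "m t \<omega>"
  have u: "?u \<in> {1..h}" using m_range \<omega> by blast
  have "(\<Sum>j\<in>nbr E ?u i. z (i, j) t \<omega> - y i t \<omega>)
      = (\<Sum>j\<in>nbr E ?u i. \<epsilon> (i, j) t \<omega>) + (\<Sum>j\<in>nbr E ?u i. y j t \<omega> - y i t \<omega>)"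
    by (simp add: \<epsilon>_def sum.distrib[symmetric])
  also have "(\<Sum>j\<in>nbr E ?u i. \<epsilon> (i, j) t \<omega>) = (\<Sum>p\<in>Pr. Wmat E ?u i p * \<epsilon> p t \<omega>)"
    by (rule sum_nbr_pairs[OF graphs u i])
  also have "(\<Sum>j\<in>nbr E ?u i. y j t \<omega> - y i t \<omega>) = (\<Sum>j\<in>V. adj E ?u i j * (y j t \<omega> - y i t \<omega>))"
    by (rule sum_nbr[OF graphs u])
  \<comment> \<open>Differences of outputs are differences of deviations from the mean, so the
    Laplacian may act on \<open>\<delta>\<close>.\<close>
  also have "\<dots> = - (\<Sum>j\<in>V. adj E ?u i j * (\<delta> i t \<omega> - \<delta> j t \<omega>))"
    by (simp add: \<delta>_def sum_negf[symmetric] algebra_simps)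
  also have "(\<Sum>j\<in>V. adj E ?u i j * (\<delta> i t \<omega> - \<delta> j t \<omega>)) = (\<Sum>k\<in>V. laplacian E ?u i k * \<delta> k t \<omega>)"
    by (rule weighted_laplacian_apply[symmetric]) (use laplacian_eq[OF graphs u] i in auto)
  finally show ?thesis using y_rec[OF i t \<omega>] by (simp add: drift_def)
qed

lemma \<delta>_step:
  assumes i: "i \<in> V" and t: "t \<ge> Suc t0" and \<omega>: "\<omega> \<in> space M"
  shows "\<delta> i (Suc t) \<omega> = \<delta> i t \<omega> + \<gamma> / real (Suc t) * (drift \<epsilon> i t \<omega> - (\<Sum>j\<in>V. drift \<epsilon> j t \<omega>) / real N)"
proof -
  have "(\<Sum>j\<in>V. y j (Suc t) \<omega>) = (\<Sum>j\<in>V. y j t \<omega>) + \<gamma> / real (Suc t) * (\<Sum>j\<in>V. drift \<epsilon> j t \<omega>)"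
    unfolding sum_distrib_left sum.distrib[symmetric] using t \<omega> by (intro sum.cong refl y_step) auto
  then show ?thesis unfolding \<delta>_def using y_step[OF assms] by (simp add: algebra_simps add_divide_distrib)
qed

lemma e_step:
  assumes p: "p \<in> Pr" and t: "t \<ge> Suc t0" and \<omega>: "\<omega> \<in> space M"
  shows "e p (Suc t) \<omega> = \<epsilon> p t \<omega> - \<gamma> / real (Suc t) * drift \<epsilon> (snd p) t \<omega>"
  using y_step[OF snd_Pr[OF p] t \<omega>] by (simp add: e_def[of p "Suc t" \<omega>] \<epsilon>_def[of p t \<omega>])

lemma Ob_y: "i \<in> V \<Longrightarrow> Ob 0 (y i)"
  by (rule Ob_bound) (rule y_bound)

lemma Ob_\<delta>: "i \<in> V \<Longrightarrow> Ob 0 (\<delta> i)"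
  unfolding \<delta>_def divide_inverse mult.commute[of _ "inverse _"]
  by (intro Ob_diff Ob_cmult Ob_sum Ob_y) auto

lemma Ob_z: "p \<in> Pr \<Longrightarrow> Ob 0 (z p)" "p \<in> Pr \<Longrightarrow> Ob 0 (\<lambda>t. z p (t - 1))"
  by (rule Ob_bound, rule z_bound, auto)+

lemma Ob_e: "p \<in> Pr \<Longrightarrow> Ob 0 (e p)" and Ob_\<epsilon>: "p \<in> Pr \<Longrightarrow> Ob 0 (\<epsilon> p)"
  unfolding e_def \<epsilon>_def by (intro Ob_diff Ob_z Ob_y snd_Pr; assumption)+

lemma Ob_chain: "Ob 0 (\<lambda>t \<omega>. F (m t \<omega>))"
proof (rule Ob_bound)
  fix t \<omega> assume "\<omega> \<in> space M"
  then show "\<bar>F (m t \<omega>)\<bar> \<le> (\<Sum>u\<in>{1..h}. \<bar>F u\<bar>)"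
    using m_range[of \<omega> t] by (intro member_le_sum) auto
qed

lemma Ob_0_mult: "Ob 0 f \<Longrightarrow> Ob k f' \<Longrightarrow> Ob k (\<lambda>t \<omega>. f t \<omega> * f' t \<omega>)"
  using Ob_mult[of 0 f k f'] by simp

lemma Ob_drift: "(\<And>p. p \<in> Pr \<Longrightarrow> Ob 0 (q p)) \<Longrightarrow> Ob 0 (drift q i)"
  unfolding drift_def by (intro Ob_diff Ob_sum Ob_0_mult Ob_\<delta> Ob_chain) auto

text \<open>The old estimate already lies in [-Mb, Mb], so the projection cannot lengthen the step,
  and the unprojected step has length at most \<beta>/t.\<close>

lemma Ob_\<epsilon>_e: "p \<in> Pr \<Longrightarrow> Ob 1 (\<lambda>t \<omega>. \<epsilon> p t \<omega> - e p t \<omega>)"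
proof (rule ObI[where C = \<beta>])
  fix t \<omega> assume p: "p \<in> Pr" and t: "t \<ge> Suc t0" and \<omega>: "\<omega> \<in> space M"
  have zb: "\<bar>z p (t - 1) \<omega>\<bar> \<le> Mb" using p t \<omega> by (intro z_bound) auto
  have "\<bar>\<epsilon> p t \<omega> - e p t \<omega>\<bar> = \<bar>z p t \<omega> - z p (t - 1) \<omega>\<bar>" by (simp add: \<epsilon>_def e_def)
  also have "\<dots> \<le> \<bar>(z p (t - 1) \<omega> + \<beta> / real t * g p t \<omega>) - z p (t - 1) \<omega>\<bar>"
    unfolding z_rec_g[OF p t \<omega>] by (rule proj_nonexpansive[OF zb])
  also have "\<dots> = \<beta> / real t * \<bar>g p t \<omega>\<bar>" using params by (simp add: abs_mult)
  also have "\<dots> \<le> \<beta> / real t * 1" using params g_bound by (intro mult_left_mono) auto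
  finally show "\<bar>\<epsilon> p t \<omega> - e p t \<omega>\<bar> \<le> \<beta> / real t ^ 1" by simp
qed

lemma Ob_drift_diff: "Ob 1 (\<lambda>t \<omega>. drift \<epsilon> i t \<omega> - drift e i t \<omega>)"
proof (rule Ob_cong)
  show "Ob 1 (\<lambda>t \<omega>. \<Sum>p\<in>Pr. Wmat E (m t \<omega>) i p * (\<epsilon> p t \<omega> - e p t \<omega>))"
    by (intro Ob_sum Ob_0_mult Ob_\<epsilon>_e Ob_chain) auto
qed (simp add: drift_def right_diff_distrib sum_subtractf)

text \<open>The true output lies in [-Mb, Mb], so projecting the estimate onto that interval cannot
  increase the error; only the unprojected step has to be expanded.\<close>

lemma \<epsilon>_sq_le:
  assumes p: "p \<in> Pr" and t: "t \<ge> Suc t0" and \<omega>: "\<omega> \<in> space M"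
  shows "(\<epsilon> p t \<omega>)\<^sup>2 \<le> (e p t \<omega>)\<^sup>2 + 2 * \<beta> / real t * (e p t \<omega> * g p t \<omega>) + \<beta>\<^sup>2 / (real t)\<^sup>2"
proof -
  have yb: "\<bar>y (snd p) t \<omega>\<bar> \<le> Mb" using y_bound snd_Pr[OF p] t \<omega> by auto
  have "\<bar>\<epsilon> p t \<omega>\<bar> \<le> \<bar>(z p (t - 1) \<omega> + \<beta> / real t * g p t \<omega>) - y (snd p) t \<omega>\<bar>"
    unfolding \<epsilon>_def z_rec_g[OF p t \<omega>] by (rule proj_nonexpansive[OF yb])
  also have "\<dots> = \<bar>e p t \<omega> + \<beta> / real t * g p t \<omega>\<bar>" by (simp add: e_def algebra_simps)
  finally have "(\<epsilon> p t \<omega>)\<^sup>2 \<le> (e p t \<omega> + \<beta> / real t * g p t \<omega>)\<^sup>2" by (simp add: abs_le_square_iff)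
  also have "\<dots> = (e p t \<omega>)\<^sup>2 + 2 * \<beta> / real t * (e p t \<omega> * g p t \<omega>) + (\<beta> / real t)\<^sup>2 * (g p t \<omega>)\<^sup>2"
  proof -
    have "(d + a * w)\<^sup>2 = d\<^sup>2 + 2 * a * (d * w) + a\<^sup>2 * w\<^sup>2" for d a w :: real
      by (simp add: power2_eq_square algebra_simps)
    then show ?thesis by (simp only: times_divide_eq_right)
  qed
  also have "\<dots> \<le> (e p t \<omega>)\<^sup>2 + 2 * \<beta> / real t * (e p t \<omega> * g p t \<omega>) + (\<beta> / real t)\<^sup>2 * 1"
    using g_bound[of p t \<omega>] by (intro add_left_mono mult_left_mono) (auto simp: abs_square_le_1)
  finally show ?thesis by (simp add: power_divide)
qed

definition Vf :: "nat \<Rightarrow> 'w \<Rightarrow> real" where "Vf t \<omega> = (\<Sum>i\<in>V. (\<delta> i t \<omega>)\<^sup>2)"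
definition Rf :: "nat \<Rightarrow> 'w \<Rightarrow> real" where "Rf t \<omega> = (\<Sum>p\<in>Pr. (e p t \<omega>)\<^sup>2)"

text \<open>Three discrepancies of order 1/t^2 are collected: the step \<gamma>/(t+1) against
  \<gamma>/t, the drift of \<open>\<epsilon>\<close> against that of \<open>e\<close>, and the
  square of the increment.\<close>

lemma Ob_Vf_step: "Ob 2 (\<lambda>t \<omega>. Vf (Suc t) \<omega> - Vf t \<omega> - 2 * \<gamma> / real t * (\<Sum>i\<in>V. \<delta> i t \<omega> * drift e i t \<omega>))"
proof (rule Ob_cong)
  let ?w = "drift \<epsilon>"
  let ?wb = "\<lambda>i t \<omega>. ?w i t \<omega> - inverse (real N) * (\<Sum>j\<in>V. ?w j t \<omega>)"
  have w: "Ob 0 (?w i)" for i by (intro Ob_drift Ob_\<epsilon>)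
  have wb: "Ob 0 (?wb i)" for i by (intro Ob_diff Ob_cmult Ob_sum w) auto
  have 1: "Ob 2 (\<lambda>t \<omega>. (2 * \<gamma> / real (Suc t) - 2 * \<gamma> / real t) * (\<Sum>i\<in>V. \<delta> i t \<omega> * ?w i t \<omega>))"
    using Ob_mult[OF Ob_inverse(3) Ob_sum[of V 0 "\<lambda>i t \<omega>. \<delta> i t \<omega> * ?w i t \<omega>"]] Ob_0_mult[OF Ob_\<delta> w] by simp
  have 2: "Ob 2 (\<lambda>t \<omega>. 2 * \<gamma> / real t * (\<Sum>i\<in>V. \<delta> i t \<omega> * (?w i t \<omega> - drift e i t \<omega>)))"
    using Ob_mult[OF Ob_inverse(1) Ob_sum[of V 1 "\<lambda>i t \<omega>. \<delta> i t \<omega> * (?w i t \<omega> - drift e i t \<omega>)"]]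
      Ob_0_mult[OF Ob_\<delta> Ob_drift_diff] by (simp add: numeral_2_eq_2 One_nat_def)
  have 3: "Ob 2 (\<lambda>t \<omega>. (\<gamma> / real (Suc t) * (\<gamma> / real (Suc t))) * (\<Sum>i\<in>V. ?wb i t \<omega> * ?wb i t \<omega>))"
    using Ob_mult[OF Ob_mult[OF Ob_inverse(2) Ob_inverse(2)] Ob_sum[of V 0 "\<lambda>i t \<omega>. ?wb i t \<omega> * ?wb i t \<omega>"]]
      Ob_0_mult[OF wb wb] by (simp add: numeral_2_eq_2 One_nat_def)
  show "Ob 2 (\<lambda>t \<omega>. (2 * \<gamma> / real (Suc t) - 2 * \<gamma> / real t) * (\<Sum>i\<in>V. \<delta> i t \<omega> * ?w i t \<omega>)
     + 2 * \<gamma> / real t * (\<Sum>i\<in>V. \<delta> i t \<omega> * (?w i t \<omega> - drift e i t \<omega>))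
     + (\<gamma> / real (Suc t) * (\<gamma> / real (Suc t))) * (\<Sum>i\<in>V. ?wb i t \<omega> * ?wb i t \<omega>))"
    by (intro Ob_add 1 2 3)
  fix t \<omega> assume t: "t \<ge> Suc t0" and \<omega>: "\<omega> \<in> space M"
  let ?a = "\<gamma> / real (Suc t)"
  have "Vf (Suc t) \<omega> = (\<Sum>i\<in>V. (\<delta> i t \<omega>)\<^sup>2 + 2 * ?a * (\<delta> i t \<omega> * ?wb i t \<omega>) + ?a * ?a * (?wb i t \<omega> * ?wb i t \<omega>))"
    unfolding Vf_def
  proof (intro sum.cong refl)
    fix i assume i: "i \<in> V"
    have "\<delta> i (Suc t) \<omega> = \<delta> i t \<omega> + ?a * ?wb i t \<omega>"
      using \<delta>_step[OF i t \<omega>] by (simp only: divide_inverse mult.commute)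
    moreover have "(d + a * w)\<^sup>2 = d\<^sup>2 + 2 * a * (d * w) + a * a * (w * w)" for d a w :: real
      by (simp add: power2_eq_square algebra_simps)
    ultimately show "(\<delta> i (Suc t) \<omega>)\<^sup>2 = (\<delta> i t \<omega>)\<^sup>2 + 2 * ?a * (\<delta> i t \<omega> * ?wb i t \<omega>) + ?a * ?a * (?wb i t \<omega> * ?wb i t \<omega>)"
      by (simp only:)
  qed
  also have "\<dots> = Vf t \<omega> + 2 * ?a * (\<Sum>i\<in>V. \<delta> i t \<omega> * ?wb i t \<omega>) + ?a * ?a * (\<Sum>i\<in>V. ?wb i t \<omega> * ?wb i t \<omega>)"
    by (simp only: sum.distrib sum_distrib_left Vf_def)
  \<comment> \<open>The common mean of the drifts is invisible to the sum-zero vector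
    \<open>\<delta>\<close>.\<close>
  also have "(\<Sum>i\<in>V. \<delta> i t \<omega> * ?wb i t \<omega>) = (\<Sum>i\<in>V. \<delta> i t \<omega> * ?w i t \<omega>)
      - (\<Sum>i\<in>V. \<delta> i t \<omega>) * (inverse (real N) * (\<Sum>j\<in>V. ?w j t \<omega>))"
    by (simp only: right_diff_distrib sum_subtractf sum_distrib_right)
  finally have eq: "Vf (Suc t) \<omega> = Vf t \<omega> + 2 * ?a * (\<Sum>i\<in>V. \<delta> i t \<omega> * ?w i t \<omega>)
      + ?a * ?a * (\<Sum>i\<in>V. ?wb i t \<omega> * ?wb i t \<omega>)" unfolding sum_\<delta> by simp
  have "(\<Sum>i\<in>V. \<delta> i t \<omega> * (?w i t \<omega> - drift e i t \<omega>)) = (\<Sum>i\<in>V. \<delta> i t \<omega> * ?w i t \<omega>) - (\<Sum>i\<in>V. \<delta> i t \<omega> * drift e i t \<omega>)"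
    by (simp only: right_diff_distrib sum_subtractf)
  then show "Vf (Suc t) \<omega> - Vf t \<omega> - 2 * \<gamma> / real t * (\<Sum>i\<in>V. \<delta> i t \<omega> * drift e i t \<omega>)
     = (2 * \<gamma> / real (Suc t) - 2 * \<gamma> / real t) * (\<Sum>i\<in>V. \<delta> i t \<omega> * ?w i t \<omega>)
     + 2 * \<gamma> / real t * (\<Sum>i\<in>V. \<delta> i t \<omega> * (?w i t \<omega> - drift e i t \<omega>))
     + (?a * ?a) * (\<Sum>i\<in>V. ?wb i t \<omega> * ?wb i t \<omega>)"
    unfolding eq by (simp add: left_diff_distrib right_diff_distrib)
qed

text \<open>Passing from \<open>\<epsilon>\<close> at t to \<open>e\<close> at t + 1 reflects the
  motion of the outputs only. The effect of updating the estimates stays in the sum of squares of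
  \<open>\<epsilon>\<close>, which \<open>\<epsilon>_sq_le\<close> treats, since there the
  projection allows an inequality but no expansion.\<close>

lemma Ob_Rf_step: "Ob 2 (\<lambda>t \<omega>. Rf (Suc t) \<omega> - (\<Sum>p\<in>Pr. (\<epsilon> p t \<omega>)\<^sup>2)
    + 2 * \<gamma> / real t * (\<Sum>p\<in>Pr. e p t \<omega> * drift e (snd p) t \<omega>))"
proof (rule Ob_cong)
  let ?w = "\<lambda>p. drift \<epsilon> (snd p)" and ?w' = "\<lambda>p. drift e (snd p)"
  have w: "Ob 0 (?w p)" for p by (intro Ob_drift Ob_\<epsilon>)
  have 1: "Ob 2 (\<lambda>t \<omega>. (2 * \<gamma> / real (Suc t) - 2 * \<gamma> / real t) * (\<epsilon> p t \<omega> * ?w p t \<omega>))" if "p \<in> Pr" for p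
    using Ob_mult[OF Ob_inverse(3) Ob_0_mult[OF Ob_\<epsilon>[OF that] w]] by simp
  have "Ob 1 (\<lambda>t \<omega>. ?w p t \<omega> * (\<epsilon> p t \<omega> - e p t \<omega>) + e p t \<omega> * (?w p t \<omega> - ?w' p t \<omega>))" if "p \<in> Pr" for p
    using that by (intro Ob_add Ob_0_mult w Ob_\<epsilon>_e Ob_e Ob_drift_diff)
  from Ob_mult[OF Ob_inverse(1) this]
  have 2: "Ob 2 (\<lambda>t \<omega>. 2 * \<gamma> / real t * (?w p t \<omega> * (\<epsilon> p t \<omega> - e p t \<omega>) + e p t \<omega> * (?w p t \<omega> - ?w' p t \<omega>)))"
    if "p \<in> Pr" for p using that by (simp add: numeral_2_eq_2 One_nat_def)
  have 3: "Ob 2 (\<lambda>t \<omega>. (\<gamma> / real (Suc t) * (\<gamma> / real (Suc t))) * (?w p t \<omega> * ?w p t \<omega>))" for p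
    using Ob_mult[OF Ob_mult[OF Ob_inverse(2) Ob_inverse(2)] Ob_0_mult[OF w w]]
    by (simp add: numeral_2_eq_2 One_nat_def)
  show "Ob 2 (\<lambda>t \<omega>. \<Sum>p\<in>Pr. (\<gamma> / real (Suc t) * (\<gamma> / real (Suc t))) * (?w p t \<omega> * ?w p t \<omega>)
      - (2 * \<gamma> / real (Suc t) - 2 * \<gamma> / real t) * (\<epsilon> p t \<omega> * ?w p t \<omega>)
      - 2 * \<gamma> / real t * (?w p t \<omega> * (\<epsilon> p t \<omega> - e p t \<omega>) + e p t \<omega> * (?w p t \<omega> - ?w' p t \<omega>)))"
    by (intro Ob_sum Ob_diff 1 2 3) auto
  fix t \<omega> assume t: "t \<ge> Suc t0" and \<omega>: "\<omega> \<in> space M"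
  have "Rf (Suc t) \<omega> - (\<Sum>p\<in>Pr. (\<epsilon> p t \<omega>)\<^sup>2) + 2 * \<gamma> / real t * (\<Sum>p\<in>Pr. e p t \<omega> * ?w' p t \<omega>)
    = (\<Sum>p\<in>Pr. (e p (Suc t) \<omega>)\<^sup>2 - (\<epsilon> p t \<omega>)\<^sup>2 + 2 * \<gamma> / real t * (e p t \<omega> * ?w' p t \<omega>))"
    by (simp only: Rf_def sum.distrib sum_subtractf sum_distrib_left)
  also have "\<dots> = (\<Sum>p\<in>Pr. (\<gamma> / real (Suc t) * (\<gamma> / real (Suc t))) * (?w p t \<omega> * ?w p t \<omega>)
      - (2 * \<gamma> / real (Suc t) - 2 * \<gamma> / real t) * (\<epsilon> p t \<omega> * ?w p t \<omega>)
      - 2 * \<gamma> / real t * (?w p t \<omega> * (\<epsilon> p t \<omega> - e p t \<omega>) + e p t \<omega> * (?w p t \<omega> - ?w' p t \<omega>)))"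
  proof (intro sum.cong refl)
    fix p assume p: "p \<in> Pr"
    define a where "a = \<gamma> / real (Suc t)"
    define b where "b = 2 * \<gamma> / real t"
    have a2: "2 * \<gamma> / real (Suc t) = 2 * a" by (simp add: a_def)
    show "(e p (Suc t) \<omega>)\<^sup>2 - (\<epsilon> p t \<omega>)\<^sup>2 + 2 * \<gamma> / real t * (e p t \<omega> * ?w' p t \<omega>)
     = (\<gamma> / real (Suc t) * (\<gamma> / real (Suc t))) * (?w p t \<omega> * ?w p t \<omega>)
      - (2 * \<gamma> / real (Suc t) - 2 * \<gamma> / real t) * (\<epsilon> p t \<omega> * ?w p t \<omega>)
      - 2 * \<gamma> / real t * (?w p t \<omega> * (\<epsilon> p t \<omega> - e p t \<omega>) + e p t \<omega> * (?w p t \<omega> - ?w' p t \<omega>))"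
      unfolding e_step[OF p t \<omega>] a2 a_def[symmetric] b_def[symmetric]
      by (simp add: power2_eq_square algebra_simps)
  qed
  finally show "Rf (Suc t) \<omega> - (\<Sum>p\<in>Pr. (\<epsilon> p t \<omega>)\<^sup>2) + 2 * \<gamma> / real t * (\<Sum>p\<in>Pr. e p t \<omega> * ?w' p t \<omega>)
    = (\<Sum>p\<in>Pr. (\<gamma> / real (Suc t) * (\<gamma> / real (Suc t))) * (?w p t \<omega> * ?w p t \<omega>)
      - (2 * \<gamma> / real (Suc t) - 2 * \<gamma> / real t) * (\<epsilon> p t \<omega> * ?w p t \<omega>)
      - 2 * \<gamma> / real t * (?w p t \<omega> * (\<epsilon> p t \<omega> - e p t \<omega>) + e p t \<omega> * (?w p t \<omega> - ?w' p t \<omega>)))" .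
qed

end

section \<open>Averaging along the chain\<close>

context consensus_scheme begin

text \<open>Outputs and estimates need a joint induction: the new estimate uses the current output,
  and the next output uses the new estimate. The lag in \<open>z p (t - 1)\<close> matches the
  exclusion of the noise at t from \<open>past t\<close>.\<close>

lemma state_measurable:
  assumes "t \<ge> Suc t0"
  shows "(\<forall>i\<in>V. y i t \<in> borel_measurable (past t)) \<and> (\<forall>p\<in>Pr. z p (t - 1) \<in> borel_measurable (past t))"
  using assms
proof (induction t rule: dec_induct)
  case base
  have "y i (Suc t0) = (\<lambda>_. y0 i)" if "i \<in> V" for i using y_init(1)[OF that] by auto
  moreover have "z p (Suc t0 - 1) = (\<lambda>_. z0 p)" if "p \<in> Pr" for p using z_init(1)[OF that] by auto
  ultimately show ?case by simp
next
  case (step t)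
  have yS: "y i t \<in> borel_measurable (past (Suc t))" if "i \<in> V" for i
    using step.IH that measurable_past_Suc by blast
  have zS: "z p (t - 1) \<in> borel_measurable (past (Suc t))" if "p \<in> Pr" for p
    using step.IH that measurable_past_Suc by blast
  have mS: "(\<lambda>\<omega>. F (m t \<omega>)) \<in> borel_measurable (past (Suc t))" for F :: "nat \<Rightarrow> real"
    using measurable_compose[OF m_measurable_past[of t "Suc t"], of F borel] by simp
  have zt: "z p t \<in> borel_measurable (past (Suc t))" if p: "p \<in> Pr" for p
  proof -
    note [measurable] = yS[OF snd_Pr[OF p]] zS[OF p] mS D_measurable_past[OF p, of t "Suc t", simplified]
    have "(\<lambda>\<omega>. proj Mb (z p (t - 1) \<omega> + \<beta> / real t * adj E (m t \<omega>) (fst p) (snd p) *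
         (gauss_F \<sigma> (c p - z p (t - 1) \<omega>) - (if y (snd p) t \<omega> + D p t \<omega> \<le> c p then 1 else 0))))
       \<in> borel_measurable (past (Suc t))"
      unfolding proj_def by measurable
    then show ?thesis
      using z_rec[OF p step.hyps(1)] by (subst measurable_cong) auto
  qed
  have ySS: "y i (Suc t) \<in> borel_measurable (past (Suc t))" if i: "i \<in> V" for i
  proof -
    have "(\<lambda>\<omega>. y i t \<omega> + \<gamma> / real (Suc t) * (\<Sum>p\<in>Pr. Wmat E (m t \<omega>) i p * (z p t \<omega> - y i t \<omega>)))
       \<in> borel_measurable (past (Suc t))"
      using yS[OF i] zt mS by (intro borel_measurable_add borel_measurable_times borel_measurable_sum
         borel_measurable_diff borel_measurable_const) auto
    moreover have "y i (Suc t) \<omega> = y i t \<omega> + \<gamma> / real (Suc t) * (\<Sum>p\<in>Pr. Wmat E (m t \<omega>) i p * (z p t \<omega> - y i t \<omega>))"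
      if \<omega>: "\<omega> \<in> space M" for \<omega>
      using y_rec[OF i step.hyps(1) \<omega>] sum_nbr_pairs[OF graphs m_range[OF \<omega>, of t] i, of "\<lambda>p. z p t \<omega> - y i t \<omega>"] by simp
    ultimately show ?thesis by (subst measurable_cong) auto
  qed
  show ?case using zt ySS by simp
qed

lemma \<delta>_measurable: "t \<ge> Suc t0 \<Longrightarrow> i \<in> V \<Longrightarrow> \<delta> i t \<in> borel_measurable (past t)"
  unfolding \<delta>_def using state_measurable
  by (intro borel_measurable_diff borel_measurable_divide borel_measurable_sum borel_measurable_const) auto

lemma y_measurable: "t \<ge> Suc t0 \<Longrightarrow> i \<in> V \<Longrightarrow> y i t \<in> borel_measurable (past t)"
  using state_measurable by auto

lemma z_measurable: "t \<ge> Suc t0 \<Longrightarrow> p \<in> Pr \<Longrightarrow> z p (t - 1) \<in> borel_measurable (past t)"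
  using state_measurable by auto

lemma e_measurable: "t \<ge> Suc t0 \<Longrightarrow> p \<in> Pr \<Longrightarrow> e p t \<in> borel_measurable (past t)"
  unfolding e_def using state_measurable snd_Pr by (intro borel_measurable_diff) auto

lemma chain_measurable: "(\<lambda>\<omega>. F (m t \<omega>)) \<in> borel_measurable (past t)" for F :: "nat \<Rightarrow> real"
  using measurable_compose[OF m_measurable_past[of t t], of F borel] by simp

lemma drift_e_measurable: "t \<ge> Suc t0 \<Longrightarrow> drift e i t \<in> borel_measurable (past t)"
  unfolding drift_def
  by (intro borel_measurable_diff borel_measurable_sum borel_measurable_times chain_measurable e_measurable \<delta>_measurable) auto

lemma Vf_measurable: "t \<ge> Suc t0 \<Longrightarrow> Vf t \<in> borel_measurable (past t)"
  unfolding Vf_def by (intro borel_measurable_sum borel_measurable_power \<delta>_measurable)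

lemma Rf_measurable: "t \<ge> Suc t0 \<Longrightarrow> Rf t \<in> borel_measurable (past t)"
  unfolding Rf_def by (intro borel_measurable_sum borel_measurable_power e_measurable)

lemma Ob_power2: "Ob 0 f \<Longrightarrow> Ob 0 (\<lambda>t \<omega>. (f t \<omega>)\<^sup>2)"
  unfolding power2_eq_square by (intro Ob_0_mult)

lemma Ob_Vf: "Ob 0 Vf" and Ob_Rf: "Ob 0 Rf"
  unfolding Vf_def Rf_def by (intro Ob_sum Ob_power2 Ob_\<delta> Ob_e; simp)+

lemma Ob_integrable:
  assumes "Ob k f" "t \<ge> Suc t0" "f t \<in> borel_measurable M"
  shows "integrable M (f t)"
proof -
  obtain C where "\<And>\<omega>. \<omega> \<in> space M \<Longrightarrow> \<bar>f t \<omega>\<bar> \<le> C / real t ^ k" using assms by (metis ObE)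
  then show ?thesis using assms(3) by (intro integrable_const_bound[of _ "C / real t ^ k"]) auto
qed

lemma Ob_integrable_past:
  "Ob k f \<Longrightarrow> t \<ge> Suc t0 \<Longrightarrow> f t \<in> borel_measurable (past t) \<Longrightarrow> integrable M (f t)"
  by (rule Ob_integrable[OF _ _ measurable_past_M])

lemma Ob_expectation:
  assumes "Ob k f" "\<And>t. t \<ge> Suc t0 \<Longrightarrow> f t \<in> borel_measurable M"
  shows "\<exists>C. \<forall>t\<ge>Suc t0. \<bar>\<integral>\<omega>. f t \<omega> \<partial>M\<bar> \<le> C / real t ^ k"
proof -
  obtain C where C: "\<And>t \<omega>. t \<ge> Suc t0 \<Longrightarrow> \<omega> \<in> space M \<Longrightarrow> \<bar>f t \<omega>\<bar> \<le> C / real t ^ k"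
    using assms(1) by (metis ObE)
  have "\<bar>\<integral>\<omega>. f t \<omega> \<partial>M\<bar> \<le> C / real t ^ k" if t: "t \<ge> Suc t0" for t
  proof -
    have i: "integrable M (f t)" by (rule Ob_integrable[OF assms(1) t assms(2)[OF t]])
    have "(\<integral>\<omega>. f t \<omega> \<partial>M) \<le> C / real t ^ k"
      by (rule integral_le_const[OF i]) (use C[OF t] in \<open>force simp: abs_le_iff\<close>)
    moreover have "- (C / real t ^ k) \<le> (\<integral>\<omega>. f t \<omega> \<partial>M)"
      by (rule integral_ge_const[OF i]) (use C[OF t] in \<open>force simp: abs_le_iff\<close>)
    ultimately show ?thesis by linarith
  qed
  then show ?thesis by blast
qed

text \<open>The averaging error along the chain is a telescoping term plus \<open>O(1/t)\<close>.\<close>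

definition tele :: "(nat \<Rightarrow> real) \<Rightarrow> bool" where
  "tele f \<longleftrightarrow> (\<exists>G C. \<forall>t\<ge>Suc t0. \<bar>G t\<bar> \<le> C \<and> \<bar>f t - (G (Suc t) - G t)\<bar> \<le> C / real t)"

lemma teleE:
  assumes "tele f"
  obtains G C where "\<And>t. t \<ge> Suc t0 \<Longrightarrow> \<bar>G t\<bar> \<le> C"
    "\<And>t. t \<ge> Suc t0 \<Longrightarrow> \<bar>f t - (G (Suc t) - G t)\<bar> \<le> C / real t"
  using assms unfolding tele_def by blast

lemma tele_add:
  assumes "tele f" "tele f'" shows "tele (\<lambda>t. f t + f' t)"
proof -
  obtain G C where 1: "\<And>t. t \<ge> Suc t0 \<Longrightarrow> \<bar>G t\<bar> \<le> C"
    "\<And>t. t \<ge> Suc t0 \<Longrightarrow> \<bar>f t - (G (Suc t) - G t)\<bar> \<le> C / real t" using assms(1) by (rule teleE) blast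
  obtain G' C' where 2: "\<And>t. t \<ge> Suc t0 \<Longrightarrow> \<bar>G' t\<bar> \<le> C'"
    "\<And>t. t \<ge> Suc t0 \<Longrightarrow> \<bar>f' t - (G' (Suc t) - G' t)\<bar> \<le> C' / real t" using assms(2) by (rule teleE) blast
  show ?thesis unfolding tele_def
  proof (intro exI[of _ "\<lambda>t. G t + G' t"] exI[of _ "C + C'"] allI impI conjI)
    fix t assume t: "t \<ge> Suc t0"
    show "\<bar>G t + G' t\<bar> \<le> C + C'" using 1(1)[OF t] 2(1)[OF t] by linarith
    show "\<bar>f t + f' t - (G (Suc t) + G' (Suc t) - (G t + G' t))\<bar> \<le> (C + C') / real t"
      using 1(2)[OF t] 2(2)[OF t] unfolding add_divide_distrib by linarith
  qed
qed

lemma tele_cmult: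
  assumes "tele f" shows "tele (\<lambda>t. r * f t)"
proof -
  obtain G C where 1: "\<And>t. t \<ge> Suc t0 \<Longrightarrow> \<bar>G t\<bar> \<le> C"
    "\<And>t. t \<ge> Suc t0 \<Longrightarrow> \<bar>f t - (G (Suc t) - G t)\<bar> \<le> C / real t" using assms(1) by (rule teleE) blast
  show ?thesis unfolding tele_def
  proof (intro exI[of _ "\<lambda>t. r * G t"] exI[of _ "\<bar>r\<bar> * C"] allI impI conjI)
    fix t assume t: "t \<ge> Suc t0"
    show "\<bar>r * G t\<bar> \<le> \<bar>r\<bar> * C" unfolding abs_mult using 1(1)[OF t] by (intro mult_left_mono) auto
    have "r * f t - (r * G (Suc t) - r * G t) = r * (f t - (G (Suc t) - G t))" by (simp add: algebra_simps)
    moreover have "\<bar>r\<bar> * \<bar>f t - (G (Suc t) - G t)\<bar> \<le> \<bar>r\<bar> * (C / real t)"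
      using 1(2)[OF t] by (intro mult_left_mono) auto
    ultimately show "\<bar>r * f t - (r * G (Suc t) - r * G t)\<bar> \<le> \<bar>r\<bar> * C / real t"
      by (simp add: abs_mult)
  qed
qed

lemma tele_sum: "finite A \<Longrightarrow> (\<And>a. a \<in> A \<Longrightarrow> tele (f a)) \<Longrightarrow> tele (\<lambda>t. \<Sum>a\<in>A. f a t)"
proof (induction A rule: finite_induct)
  case empty
  then show ?case by (auto simp: tele_def intro!: exI[of _ "\<lambda>_. 0"] exI[of _ 0])
next
  case (insert x F)
  then show ?case using tele_add[of "f x" "\<lambda>t. \<Sum>a\<in>F. f a t"] by simp
qed

text \<open>The weights that admit averaging: summation by parts moves the time increment from the
  chain, where it is of order 1, to the weight, where it is of order 1/t.\<close>

definition slow :: "(nat \<Rightarrow> 'w \<Rightarrow> real) \<Rightarrow> bool" where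
  "slow f \<longleftrightarrow> Ob 0 f \<and> Ob 1 (\<lambda>t \<omega>. f (Suc t) \<omega> - f t \<omega>)"

lemma Ob_0_Suc: "Ob 0 f \<Longrightarrow> Ob 0 (\<lambda>t. f (Suc t))"
  unfolding Ob_def by (auto intro: le_SucI)

lemma slow_mult: "slow f \<Longrightarrow> slow f' \<Longrightarrow> slow (\<lambda>t \<omega>. f t \<omega> * f' t \<omega>)"
proof -
  assume f: "slow f" and f': "slow f'"
  have "Ob 1 (\<lambda>t \<omega>. f' (Suc t) \<omega> * (f (Suc t) \<omega> - f t \<omega>) + f t \<omega> * (f' (Suc t) \<omega> - f' t \<omega>))"
    using f f' unfolding slow_def by (intro Ob_add Ob_0_mult Ob_0_Suc) auto
  then have "Ob 1 (\<lambda>t \<omega>. f (Suc t) \<omega> * f' (Suc t) \<omega> - f t \<omega> * f' t \<omega>)"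
    by (rule Ob_cong) (simp add: algebra_simps)
  then show ?thesis using f f' unfolding slow_def by (auto intro: Ob_0_mult)
qed

lemma slow_sum: "finite A \<Longrightarrow> (\<And>a. a \<in> A \<Longrightarrow> slow (f a)) \<Longrightarrow> slow (\<lambda>t \<omega>. \<Sum>a\<in>A. f a t \<omega>)"
  unfolding slow_def sum_subtractf[symmetric] by (auto intro!: Ob_sum)

lemma slow_const: "slow (\<lambda>_ _. r)"
  unfolding slow_def using Ob_const[of r] by (auto intro: ObI[where C = 0])

lemma slow_\<delta>: "i \<in> V \<Longrightarrow> slow (\<delta> i)"
  unfolding slow_def
proof (intro conjI Ob_\<delta>)
  assume i: "i \<in> V"
  have "Ob 0 (\<lambda>t \<omega>. drift \<epsilon> i t \<omega> - inverse (real N) * (\<Sum>j\<in>V. drift \<epsilon> j t \<omega>))"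
    by (intro Ob_diff Ob_cmult Ob_sum Ob_drift Ob_\<epsilon>) auto
  from Ob_mult[OF Ob_inverse(2) this]
  have "Ob 1 (\<lambda>t \<omega>. \<gamma> / real (Suc t) * (drift \<epsilon> i t \<omega> - inverse (real N) * (\<Sum>j\<in>V. drift \<epsilon> j t \<omega>)))" by simp
  then show "Ob 1 (\<lambda>t \<omega>. \<delta> i (Suc t) \<omega> - \<delta> i t \<omega>)"
    by (rule Ob_cong) (simp add: \<delta>_step[OF i] divide_inverse mult.commute)
qed

lemma slow_e: "p \<in> Pr \<Longrightarrow> slow (e p)"
  unfolding slow_def
proof (intro conjI Ob_e)
  assume p: "p \<in> Pr"
  have "Ob 1 (\<lambda>t \<omega>. \<gamma> / real (Suc t) * drift \<epsilon> (snd p) t \<omega>)"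
    using Ob_mult[OF Ob_inverse(2) Ob_drift[of \<epsilon>]] Ob_\<epsilon> by simp
  then have "Ob 1 (\<lambda>t \<omega>. (\<epsilon> p t \<omega> - e p t \<omega>) - \<gamma> / real (Suc t) * drift \<epsilon> (snd p) t \<omega>)"
    by (intro Ob_diff Ob_\<epsilon>_e p)
  then show "Ob 1 (\<lambda>t \<omega>. e p (Suc t) \<omega> - e p t \<omega>)"
    by (rule Ob_cong) (simp add: e_step[OF p])
qed

text \<open>Let \<nu> solve the Poisson equation for the centred indicator of u. Against a weight
  from \<open>past t\<close>, the Markov property replaces (P\<nu>)(m(t)) by \<nu>(m(t+1)). The
  resulting E \<phi>(t)\<nu>(m(t)) - E \<phi>(t)\<nu>(m(t+1)) telescopes once \<phi>(t) becomes
  \<phi>(t+1) in the second term, at the price of one increment of \<phi>.\<close>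

lemma averaging:
  assumes sl: "slow \<phi>" and meas: "\<And>t. t \<ge> Suc t0 \<Longrightarrow> \<phi> t \<in> borel_measurable (past t)"
    and u: "u \<in> {1..h}"
  shows "tele (\<lambda>t. (\<integral>\<omega>. \<phi> t \<omega> * (if m t \<omega> = u then 1 else 0) \<partial>M) - \<pi> u * (\<integral>\<omega>. \<phi> t \<omega> \<partial>M))"
proof -
  have "(\<Sum>v\<in>{1..h}. \<pi> v * ((if v = u then 1 else 0) - \<pi> u)) = (\<Sum>v\<in>{1..h}. (if v = u then \<pi> u else 0) - \<pi> v * \<pi> u)"
    by (intro sum.cong refl) (auto simp: algebra_simps)
  also have "\<dots> = \<pi> u - (\<Sum>v\<in>{1..h}. \<pi> v) * \<pi> u"
    using u by (simp add: sum_subtractf sum_distrib_right)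
  also have "\<dots> = 0" using station by (simp add: stationary_def)
  finally obtain \<nu> where \<nu>: "\<And>v. v \<in> {1..h} \<Longrightarrow> \<nu> v - (\<Sum>w\<in>{1..h}. P v w * \<nu> w) = (if v = u then 1 else 0) - \<pi> u"
    using Poisson_equation[OF h1 stoch irred station, of "\<lambda>v. (if v = u then 1 else 0) - \<pi> u"] by blast
  have Ob\<phi>: "Ob 0 \<phi>" and Ob\<phi>1: "Ob 1 (\<lambda>t \<omega>. \<phi> (Suc t) \<omega> - \<phi> t \<omega>)" using sl by (auto simp: slow_def)
  have \<phi>M: "\<phi> t \<in> borel_measurable M" if "t \<ge> Suc t0" for t using meas[OF that] by (rule measurable_past_M)
  have mM: "(\<lambda>\<omega>. F (m t \<omega>)) \<in> borel_measurable M" for t and F :: "nat \<Rightarrow> real"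
    using chain_measurable by (rule measurable_past_M)
  have mMS: "Ob 0 (\<lambda>t \<omega>. F (m (Suc t) \<omega>))" for F :: "nat \<Rightarrow> real"
    by (rule Ob_0_Suc[OF Ob_chain])
  have int: "integrable M (\<lambda>\<omega>. \<phi> t \<omega> * F (m t \<omega>))" "integrable M (\<lambda>\<omega>. \<phi> t \<omega> * F (m (Suc t) \<omega>))"
    if t: "t \<ge> Suc t0" for t and F :: "nat \<Rightarrow> real"
    using t \<phi>M[OF t] mM
    by (auto intro!: Ob_integrable[OF Ob_0_mult[OF Ob\<phi> Ob_chain]] Ob_integrable[OF Ob_0_mult[OF Ob\<phi> mMS]])
  \<comment> \<open>The sign fits the convention of \<open>tele\<close>, where the increment is
    \<open>G (Suc t) - G t\<close>.\<close>
  define G where "G t = - (\<integral>\<omega>. \<phi> t \<omega> * \<nu> (m t \<omega>) \<partial>M)" for t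
  have "\<exists>C. \<forall>t\<ge>Suc t0. \<bar>\<integral>\<omega>. \<phi> t \<omega> * \<nu> (m t \<omega>) \<partial>M\<bar> \<le> C / real t ^ 0"
    using \<phi>M mM by (intro Ob_expectation Ob_0_mult Ob\<phi> Ob_chain) auto
  then obtain C1 where C1: "\<And>t. t \<ge> Suc t0 \<Longrightarrow> \<bar>G t\<bar> \<le> C1" by (auto simp: G_def)
  have "Ob (0 + 1) (\<lambda>t \<omega>. \<nu> (m (Suc t) \<omega>) * (\<phi> (Suc t) \<omega> - \<phi> t \<omega>))"
    by (intro Ob_mult mMS Ob\<phi>1)
  then have "\<exists>C. \<forall>t\<ge>Suc t0. \<bar>\<integral>\<omega>. \<nu> (m (Suc t) \<omega>) * (\<phi> (Suc t) \<omega> - \<phi> t \<omega>) \<partial>M\<bar> \<le> C / real t ^ (0 + 1)"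
    using \<phi>M mM by (intro Ob_expectation) auto
  then obtain C2 where C2: "\<And>t. t \<ge> Suc t0 \<Longrightarrow> \<bar>\<integral>\<omega>. \<nu> (m (Suc t) \<omega>) * (\<phi> (Suc t) \<omega> - \<phi> t \<omega>) \<partial>M\<bar> \<le> C2 / real t"
    by auto
  have key: "(\<integral>\<omega>. \<phi> t \<omega> * (if m t \<omega> = u then 1 else 0) \<partial>M) - \<pi> u * (\<integral>\<omega>. \<phi> t \<omega> \<partial>M) - (G (Suc t) - G t)
      = (\<integral>\<omega>. \<nu> (m (Suc t) \<omega>) * (\<phi> (Suc t) \<omega> - \<phi> t \<omega>) \<partial>M)" if t: "t \<ge> Suc t0" for t
  proof -
    obtain B where B: "\<And>\<omega>. \<omega> \<in> space M \<Longrightarrow> \<bar>\<phi> t \<omega>\<bar> \<le> B" using Ob\<phi> t by (metis ObE power_0 div_by_1)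
    have split: "\<phi> t \<omega> * F (m (Suc t) \<omega>) = (\<Sum>w\<in>{1..h}. F w * (\<phi> t \<omega> * (if m (Suc t) \<omega> = w then 1 else 0)))"
      if \<omega>: "\<omega> \<in> space M" for F \<omega>
    proof -
      have "(\<Sum>w\<in>{1..h}. F w * (\<phi> t \<omega> * (if m (Suc t) \<omega> = w then 1 else 0)))
         = (\<Sum>w\<in>{1..h}. if w = m (Suc t) \<omega> then F w * \<phi> t \<omega> else 0)" by (intro sum.cong refl) auto
      then show ?thesis using m_range[OF \<omega>, of "Suc t"] by simp
    qed
    have "(\<integral>\<omega>. \<phi> t \<omega> * \<nu> (m (Suc t) \<omega>) \<partial>M) = (\<integral>\<omega>. (\<Sum>w\<in>{1..h}. \<nu> w * (\<phi> t \<omega> * (if m (Suc t) \<omega> = w then 1 else 0))) \<partial>M)"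
      by (intro Bochner_Integration.integral_cong refl split)
    also have "\<dots> = (\<Sum>w\<in>{1..h}. \<nu> w * (\<integral>\<omega>. \<phi> t \<omega> * (if m (Suc t) \<omega> = w then 1 else 0) \<partial>M))"
      using int(2)[OF t, of "\<lambda>v. if v = _ then 1 else 0"]
      by (subst Bochner_Integration.integral_sum) (auto intro!: integrable_mult_right)
    also have "\<dots> = (\<Sum>w\<in>{1..h}. \<nu> w * (\<integral>\<omega>. \<phi> t \<omega> * P (m t \<omega>) w \<partial>M))"
      using integral_past_step[OF meas[OF t] B] by simp
    also have "\<dots> = (\<integral>\<omega>. (\<Sum>w\<in>{1..h}. \<nu> w * (\<phi> t \<omega> * P (m t \<omega>) w)) \<partial>M)"
      using int(1)[OF t, of "\<lambda>v. P v _"]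
      by (subst Bochner_Integration.integral_sum) (auto intro!: integrable_mult_right)
    also have "\<dots> = (\<integral>\<omega>. \<phi> t \<omega> * (\<Sum>w\<in>{1..h}. P (m t \<omega>) w * \<nu> w) \<partial>M)"
      by (simp add: sum_distrib_left ac_simps)
    finally have A: "(\<integral>\<omega>. \<phi> t \<omega> * \<nu> (m (Suc t) \<omega>) \<partial>M) = (\<integral>\<omega>. \<phi> t \<omega> * (\<Sum>w\<in>{1..h}. P (m t \<omega>) w * \<nu> w) \<partial>M)" .
    have "(\<integral>\<omega>. \<phi> t \<omega> * (if m t \<omega> = u then 1 else 0) \<partial>M) - \<pi> u * (\<integral>\<omega>. \<phi> t \<omega> \<partial>M)
       = (\<integral>\<omega>. \<phi> t \<omega> * (if m t \<omega> = u then 1 else 0) - \<pi> u * \<phi> t \<omega> \<partial>M)"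
      using int(1)[OF t, of "\<lambda>v. if v = u then 1 else 0"] int(1)[OF t, of "\<lambda>_. 1"] by simp
    also have "\<dots> = (\<integral>\<omega>. \<phi> t \<omega> * \<nu> (m t \<omega>) - \<phi> t \<omega> * (\<Sum>w\<in>{1..h}. P (m t \<omega>) w * \<nu> w) \<partial>M)"
    proof (intro Bochner_Integration.integral_cong refl)
      fix \<omega> assume \<omega>: "\<omega> \<in> space M"
      show "\<phi> t \<omega> * (if m t \<omega> = u then 1 else 0) - \<pi> u * \<phi> t \<omega>
         = \<phi> t \<omega> * \<nu> (m t \<omega>) - \<phi> t \<omega> * (\<Sum>w\<in>{1..h}. P (m t \<omega>) w * \<nu> w)"
        using \<nu>[OF m_range[OF \<omega>, of t]] unfolding right_diff_distrib[symmetric]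
        by (simp only: right_diff_distrib mult.commute)
    qed
    also have "\<dots> = - G t - (\<integral>\<omega>. \<phi> t \<omega> * \<nu> (m (Suc t) \<omega>) \<partial>M)"
      unfolding A G_def using int(1)[OF t, of \<nu>] int(1)[OF t, of "\<lambda>v. \<Sum>w\<in>{1..h}. P v w * \<nu> w"] by simp
    finally have 1: "(\<integral>\<omega>. \<phi> t \<omega> * (if m t \<omega> = u then 1 else 0) \<partial>M) - \<pi> u * (\<integral>\<omega>. \<phi> t \<omega> \<partial>M)
       = - G t - (\<integral>\<omega>. \<phi> t \<omega> * \<nu> (m (Suc t) \<omega>) \<partial>M)" .
    have "(\<integral>\<omega>. \<nu> (m (Suc t) \<omega>) * (\<phi> (Suc t) \<omega> - \<phi> t \<omega>) \<partial>M)
       = (\<integral>\<omega>. \<phi> (Suc t) \<omega> * \<nu> (m (Suc t) \<omega>) - \<phi> t \<omega> * \<nu> (m (Suc t) \<omega>) \<partial>M)"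
      by (intro Bochner_Integration.integral_cong refl) (simp add: algebra_simps)
    also have "\<dots> = - G (Suc t) - (\<integral>\<omega>. \<phi> t \<omega> * \<nu> (m (Suc t) \<omega>) \<partial>M)"
      unfolding G_def using int(1)[of "Suc t" \<nu>] int(2)[OF t, of \<nu>] t by simp
    finally show ?thesis using 1 by simp
  qed
  show ?thesis unfolding tele_def
  proof (intro exI[of _ G] exI[of _ "max C1 C2"] allI impI conjI)
    fix t assume t: "t \<ge> Suc t0"
    show "\<bar>G t\<bar> \<le> max C1 C2" using C1[OF t] by simp
    have "C2 / real t \<le> max C1 C2 / real t" by (intro divide_right_mono) auto
    then show "\<bar>(\<integral>\<omega>. \<phi> t \<omega> * (if m t \<omega> = u then 1 else 0) \<partial>M) - \<pi> u * (\<integral>\<omega>. \<phi> t \<omega> \<partial>M) - (G (Suc t) - G t)\<bar>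
        \<le> max C1 C2 / real t"
      unfolding key[OF t] using C2[OF t] by linarith
  qed
qed

text \<open>Splitting by the value of \<open>m t\<close> leaves finitely many weights, one per
  topology, each covered by \<open>averaging\<close>. Both the Laplacian form and the activity of a
  pair have this shape.\<close>

lemma averaging_sum:
  assumes sl: "\<And>u. u \<in> {1..h} \<Longrightarrow> slow (\<phi> u)"
    and meas: "\<And>u t. u \<in> {1..h} \<Longrightarrow> t \<ge> Suc t0 \<Longrightarrow> \<phi> u t \<in> borel_measurable (past t)"
  obtains T where "tele T"
    "\<And>t. t \<ge> Suc t0 \<Longrightarrow> (\<integral>\<omega>. \<phi> (m t \<omega>) t \<omega> \<partial>M) = (\<integral>\<omega>. (\<Sum>u\<in>{1..h}. \<pi> u * \<phi> u t \<omega>) \<partial>M) + T t"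
proof
  let ?T = "\<lambda>t. \<Sum>u\<in>{1..h}. (\<integral>\<omega>. \<phi> u t \<omega> * (if m t \<omega> = u then 1 else 0) \<partial>M) - \<pi> u * (\<integral>\<omega>. \<phi> u t \<omega> \<partial>M)"
  show "tele ?T" using assms by (intro tele_sum averaging) auto
  fix t assume t: "t \<ge> Suc t0"
  have int: "integrable M (\<phi> u t)" if "u \<in> {1..h}" for u
    using sl[OF that] meas[OF that t] t by (intro Ob_integrable_past[of 0 "\<phi> u"]) (auto simp: slow_def)
  have int2: "integrable M (\<lambda>\<omega>. \<phi> u t \<omega> * (if m t \<omega> = u then 1 else 0))" if "u \<in> {1..h}" for u
    using sl[OF that] meas[OF that t] t chain_measurable[of "\<lambda>v. if v = u then 1 else 0" t]
    by (intro Ob_integrable_past[of 0 "\<lambda>t \<omega>. \<phi> u t \<omega> * (if m t \<omega> = u then 1 else 0)"] Ob_0_mult Ob_chain borel_measurable_times)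
       (auto simp: slow_def)
  have "(\<integral>\<omega>. \<phi> (m t \<omega>) t \<omega> \<partial>M) = (\<integral>\<omega>. (\<Sum>u\<in>{1..h}. \<phi> u t \<omega> * (if m t \<omega> = u then 1 else 0)) \<partial>M)"
  proof (intro Bochner_Integration.integral_cong refl)
    fix \<omega> assume \<omega>: "\<omega> \<in> space M"
    have "(\<Sum>u\<in>{1..h}. \<phi> u t \<omega> * (if m t \<omega> = u then 1 else 0)) = (\<Sum>u\<in>{1..h}. if u = m t \<omega> then \<phi> u t \<omega> else 0)"
      by (intro sum.cong refl) auto
    then show "\<phi> (m t \<omega>) t \<omega> = (\<Sum>u\<in>{1..h}. \<phi> u t \<omega> * (if m t \<omega> = u then 1 else 0))"
      using m_range[OF \<omega>, of t] by simp
  qed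
  also have "\<dots> = (\<Sum>u\<in>{1..h}. (\<integral>\<omega>. \<phi> u t \<omega> * (if m t \<omega> = u then 1 else 0) \<partial>M))"
    using int2 by (rule Bochner_Integration.integral_sum)
  also have "\<dots> = (\<Sum>u\<in>{1..h}. \<pi> u * (\<integral>\<omega>. \<phi> u t \<omega> \<partial>M)) + ?T t" by (simp add: sum_subtractf)
  also have "(\<Sum>u\<in>{1..h}. \<pi> u * (\<integral>\<omega>. \<phi> u t \<omega> \<partial>M)) = (\<integral>\<omega>. (\<Sum>u\<in>{1..h}. \<pi> u * \<phi> u t \<omega>) \<partial>M)"
    using int by (subst Bochner_Integration.integral_sum) auto
  finally show "(\<integral>\<omega>. \<phi> (m t \<omega>) t \<omega> \<partial>M) = (\<integral>\<omega>. (\<Sum>u\<in>{1..h}. \<pi> u * \<phi> u t \<omega>) \<partial>M) + ?T t" .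
qed

end

section \<open>The Lyapunov recursion\<close>

context consensus_scheme begin

definition fM :: real where "fM = Min ((\<lambda>p. normal_density 0 \<sigma> (\<bar>c p\<bar> + Mb)) ` Pr)"
definition pmin :: real where "pmin = Min (\<pi> ` {1..h})"
definition qL :: "nat \<Rightarrow> nat \<Rightarrow> 'w \<Rightarrow> real" where
  "qL u t \<omega> = (\<Sum>i\<in>V. \<delta> i t \<omega> * (\<Sum>k\<in>V. laplacian E u i k * \<delta> k t \<omega>))"

abbreviation l2 where "l2 \<equiv> lam2 N h E \<pi>"
abbreviation lG where "lG \<equiv> lamG N h E"
abbreviation al where "al \<equiv> alpha_const N h E \<pi>"

lemma l2_pos: "l2 > 0"
  by (rule spectral_gap_Lcheck[OF N2 graphs connected pi_pos])

lemma lG_pos: "lG > 0"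
  by (rule lamG_pos[OF N2 graphs connected])

lemma Pr_nonempty: "Pr \<noteq> {}"
  using exists_edge[OF N2 graphs connected] by blast

lemma fM_pos: "fM > 0"
  unfolding fM_def using Pr_nonempty \<sigma> by (subst Min_gr_iff) (auto intro: normal_density_pos)

lemma fM_le: "p \<in> Pr \<Longrightarrow> fM \<le> normal_density 0 \<sigma> (\<bar>c p\<bar> + Mb)"
  unfolding fM_def by (intro Min_le) auto

lemma pmin_pos: "pmin > 0"
  unfolding pmin_def using h1 pi_pos by (subst Min_gr_iff) auto

lemma pmin_le: "u \<in> {1..h} \<Longrightarrow> pmin \<le> \<pi> u"
  unfolding pmin_def by (intro Min_le) auto

lemma Ob_0D: "Ob 0 f \<Longrightarrow> t \<ge> Suc t0 \<Longrightarrow> \<exists>B. \<forall>\<omega>\<in>space M. \<bar>f t \<omega>\<bar> \<le> B"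
  unfolding Ob_def by auto

lemma noise_cdf:
  assumes p: "p \<in> Pr"
  shows "measure (distr M borel (D p t)) {..a} = gauss_F \<sigma> a"
proof -
  have "distr M lborel (D p t) = density lborel (\<lambda>x. ennreal (normal_density 0 \<sigma> x))"
    using noise_law[OF p] by (rule distributed_distr_eq_density)
  then have "gauss_F \<sigma> a = measure (distr M lborel (D p t)) {..a}" by (simp add: gauss_F_def)
  also have "\<dots> = measure (distr M borel (D p t)) {..a}"
    using D_measurable[OF p] by (simp add: measure_distr)
  finally show ?thesis by simp
qed

lemma adj_chain_measurable: "(\<lambda>\<omega>. adj E (m t \<omega>) i j) \<in> borel_measurable (past t)"
  by (rule chain_measurable)

text \<open>The weight \<open>e\<close> times the activity of the pair belongs to
  \<open>past t\<close>, so the fresh noise can be integrated out and the binary observation becomes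
  F(c - y). What is left, F(c - z) - F(c - y), pulls the estimate towards the output at rate at
  least \<open>fM\<close>.\<close>

lemma expectation_g:
  assumes p: "p \<in> Pr" and t: "t \<ge> Suc t0"
  shows "integrable M (\<lambda>\<omega>. e p t \<omega> * g p t \<omega>)"
    "integrable M (\<lambda>\<omega>. adj E (m t \<omega>) (fst p) (snd p) * (e p t \<omega>)\<^sup>2)"
    "(\<integral>\<omega>. e p t \<omega> * g p t \<omega> \<partial>M) \<le> - fM * (\<integral>\<omega>. adj E (m t \<omega>) (fst p) (snd p) * (e p t \<omega>)\<^sup>2 \<partial>M)"
proof -
  define \<phi> where "\<phi> \<omega> = e p t \<omega> * adj E (m t \<omega>) (fst p) (snd p)" for \<omega>
  have \<phi>m: "\<phi> \<in> borel_measurable (past t)"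
    unfolding \<phi>_def by (intro borel_measurable_times e_measurable t p adj_chain_measurable)
  have Ob\<phi>: "Ob 0 (\<lambda>t \<omega>. e p t \<omega> * adj E (m t \<omega>) (fst p) (snd p))"
    by (intro Ob_0_mult Ob_e p Ob_chain)
  from Ob_0D[OF this t]
  obtain B where B: "\<And>\<omega>. \<omega> \<in> space M \<Longrightarrow> \<bar>\<phi> \<omega>\<bar> \<le> B"
    unfolding \<phi>_def by blast
  have B0: "B \<ge> 0" using B not_empty by (metis abs_ge_zero ex_in_conv order_trans)
  note M = measurable_past_M
  have [measurable]: "\<phi> \<in> borel_measurable M" "z p (t - 1) \<in> borel_measurable M" "y (snd p) t \<in> borel_measurable M"
     "D p t \<in> borel_measurable M" "e p t \<in> borel_measurable M" "(\<lambda>\<omega>. adj E (m t \<omega>) (fst p) (snd p)) \<in> borel_measurable M"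
    using M[OF \<phi>m] M[OF z_measurable[OF t p]] M[OF y_measurable[OF t snd_Pr[OF p]]] D_measurable[OF p]
      M[OF e_measurable[OF t p]] M[OF adj_chain_measurable] by auto
  have b1: "\<bar>\<phi> \<omega> * x\<bar> \<le> B" if "\<omega> \<in> space M" "0 \<le> x" "x \<le> 1" for \<omega> x
    using mult_mono[OF B[OF that(1)] that(3)] that B0 by (simp add: abs_mult)
  have i1: "integrable M (\<lambda>\<omega>. \<phi> \<omega> * gauss_F \<sigma> (c p - z p (t - 1) \<omega>))"
    using b1 gauss_F_bounds[OF \<sigma>] by (intro integrable_const_bound[of _ B]) auto
  have i2: "integrable M (\<lambda>\<omega>. \<phi> \<omega> * gauss_F \<sigma> (c p - y (snd p) t \<omega>))"
    using b1 gauss_F_bounds[OF \<sigma>] by (intro integrable_const_bound[of _ B]) auto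
  have i3: "integrable M (\<lambda>\<omega>. \<phi> \<omega> * (if y (snd p) t \<omega> + D p t \<omega> \<le> c p then 1 else 0))"
    using b1 by (intro integrable_const_bound[of _ B]) auto
  have eg: "e p t \<omega> * g p t \<omega> = \<phi> \<omega> * gauss_F \<sigma> (c p - z p (t - 1) \<omega>)
      - \<phi> \<omega> * (if y (snd p) t \<omega> + D p t \<omega> \<le> c p then 1 else 0)" for \<omega>
    by (simp add: g_def \<phi>_def right_diff_distrib mult.assoc)
  show "integrable M (\<lambda>\<omega>. e p t \<omega> * g p t \<omega>)" unfolding eg using i1 i3 by simp
  have "Ob 0 (\<lambda>t \<omega>. adj E (m t \<omega>) (fst p) (snd p) * (e p t \<omega>)\<^sup>2)"
    by (intro Ob_0_mult Ob_chain Ob_power2 Ob_e p)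
  then show i4: "integrable M (\<lambda>\<omega>. adj E (m t \<omega>) (fst p) (snd p) * (e p t \<omega>)\<^sup>2)"
    using t by (rule Ob_integrable) measurable
  have "(\<integral>\<omega>. e p t \<omega> * g p t \<omega> \<partial>M) = (\<integral>\<omega>. \<phi> \<omega> * gauss_F \<sigma> (c p - z p (t - 1) \<omega>) \<partial>M)
      - (\<integral>\<omega>. \<phi> \<omega> * (if y (snd p) t \<omega> + D p t \<omega> \<le> c p then 1 else 0) \<partial>M)"
    unfolding eg using i1 i3 by (rule Bochner_Integration.integral_diff)
  also have "(\<integral>\<omega>. \<phi> \<omega> * (if y (snd p) t \<omega> + D p t \<omega> \<le> c p then 1 else 0) \<partial>M)
      = (\<integral>\<omega>. \<phi> \<omega> * gauss_F \<sigma> (c p - y (snd p) t \<omega>) \<partial>M)"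
    using integral_indep_threshold[OF subalgebra_past D_measurable[OF p] noise_indep_past[OF p, of t] \<phi>m
        y_measurable[OF t snd_Pr[OF p]] B, of "c p"]
    unfolding noise_cdf[OF p] .
  also have "(\<integral>\<omega>. \<phi> \<omega> * gauss_F \<sigma> (c p - z p (t - 1) \<omega>) \<partial>M) - (\<integral>\<omega>. \<phi> \<omega> * gauss_F \<sigma> (c p - y (snd p) t \<omega>) \<partial>M)
      = (\<integral>\<omega>. \<phi> \<omega> * gauss_F \<sigma> (c p - z p (t - 1) \<omega>) - \<phi> \<omega> * gauss_F \<sigma> (c p - y (snd p) t \<omega>) \<partial>M)"
    using i1 i2 by (rule Bochner_Integration.integral_diff[symmetric])
  also have "\<dots> \<le> (\<integral>\<omega>. - fM * (adj E (m t \<omega>) (fst p) (snd p) * (e p t \<omega>)\<^sup>2) \<partial>M)"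
  proof (rule integral_mono)
    show "integrable M (\<lambda>\<omega>. \<phi> \<omega> * gauss_F \<sigma> (c p - z p (t - 1) \<omega>) - \<phi> \<omega> * gauss_F \<sigma> (c p - y (snd p) t \<omega>))"
      using i1 i2 by (rule Bochner_Integration.integrable_diff)
    show "integrable M (\<lambda>\<omega>. - fM * (adj E (m t \<omega>) (fst p) (snd p) * (e p t \<omega>)\<^sup>2))"
      by (rule integrable_mult_right, rule i4)
    fix \<omega> assume \<omega>: "\<omega> \<in> space M"
    let ?a = "adj E (m t \<omega>) (fst p) (snd p)"
    have zb: "\<bar>z p (t - 1) \<omega>\<bar> \<le> Mb" using p t \<omega> by (intro z_bound) auto
    have yb: "\<bar>y (snd p) t \<omega>\<bar> \<le> Mb" using y_bound snd_Pr[OF p] t \<omega> by auto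
    have "e p t \<omega> * (gauss_F \<sigma> (c p - z p (t - 1) \<omega>) - gauss_F \<sigma> (c p - y (snd p) t \<omega>)) \<le> - fM * (e p t \<omega>)\<^sup>2"
      unfolding e_def by (rule gauss_F_contraction[OF \<sigma> zb yb fM_le[OF p]])
    then have "?a * (e p t \<omega> * (gauss_F \<sigma> (c p - z p (t - 1) \<omega>) - gauss_F \<sigma> (c p - y (snd p) t \<omega>))) \<le> ?a * (- fM * (e p t \<omega>)\<^sup>2)"
      using adj_bounds by (intro mult_left_mono)
    then show "\<phi> \<omega> * gauss_F \<sigma> (c p - z p (t - 1) \<omega>) - \<phi> \<omega> * gauss_F \<sigma> (c p - y (snd p) t \<omega>) \<le> - fM * (?a * (e p t \<omega>)\<^sup>2)"
      unfolding \<phi>_def by (simp add: algebra_simps)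
  qed
  also have "\<dots> = - fM * (\<integral>\<omega>. adj E (m t \<omega>) (fst p) (snd p) * (e p t \<omega>)\<^sup>2 \<partial>M)"
    by (rule integral_mult_right_zero)
  finally show "(\<integral>\<omega>. e p t \<omega> * g p t \<omega> \<partial>M) \<le> - fM * (\<integral>\<omega>. adj E (m t \<omega>) (fst p) (snd p) * (e p t \<omega>)\<^sup>2 \<partial>M)" .
qed

definition EV :: "nat \<Rightarrow> real" where "EV t = (\<integral>\<omega>. Vf t \<omega> \<partial>M)"
definition ER :: "nat \<Rightarrow> real" where "ER t = (\<integral>\<omega>. Rf t \<omega> \<partial>M)"

lemma Vf_nonneg: "Vf t \<omega> \<ge> 0" and Rf_nonneg: "Rf t \<omega> \<ge> 0"
  by (auto simp: Vf_def Rf_def sum_nonneg)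

lemma EV_nonneg: "EV t \<ge> 0" and ER_nonneg: "ER t \<ge> 0"
  by (auto simp: EV_def ER_def intro!: Bochner_Integration.integral_nonneg Vf_nonneg Rf_nonneg)

lemma Vf_integrable: "t \<ge> Suc t0 \<Longrightarrow> integrable M (Vf t)"
  using Ob_integrable_past[OF Ob_Vf] Vf_measurable by blast

lemma Rf_integrable: "t \<ge> Suc t0 \<Longrightarrow> integrable M (Rf t)"
  using Ob_integrable_past[OF Ob_Rf] Rf_measurable by blast

text \<open>Young's inequality with weight \<open>l2\<close>: the cross term consumes half of the
  dissipation 2 \<open>l2\<close> that \<open>qL\<close> supplies on average, and costs
  \<open>lG / l2\<close> on the estimation side.\<close>

lemma V_drift_le:
  assumes \<omega>: "\<omega> \<in> space M"
  shows "2 * (\<Sum>i\<in>V. \<delta> i t \<omega> * drift e i t \<omega>) \<le> - 2 * qL (m t \<omega>) t \<omega> + l2 * Vf t \<omega> + lG / l2 * Rf t \<omega>"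
proof -
  let ?W = "\<Sum>i\<in>V. \<delta> i t \<omega> * (\<Sum>p\<in>Pr. Wmat E (m t \<omega>) i p * e p t \<omega>)"
  have "?W \<le> sqrt lG * sqrt (Vf t \<omega>) * sqrt (Rf t \<omega>)"
    unfolding Vf_def Rf_def
    using JW_form[OF graphs m_range[OF \<omega>, of t] _ sum_\<delta>, of t \<omega> "\<lambda>p. e p t \<omega>"] N2 by simp
  moreover have "2 * (sqrt lG * sqrt (Vf t \<omega>) * sqrt (Rf t \<omega>)) \<le> l2 * Vf t \<omega> + lG / l2 * Rf t \<omega>"
    using lG_pos l2_pos by (intro Young_sqrt Vf_nonneg Rf_nonneg) auto
  moreover have "(\<Sum>i\<in>V. \<delta> i t \<omega> * drift e i t \<omega>) = ?W - qL (m t \<omega>) t \<omega>"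
    unfolding drift_def qL_def by (simp add: right_diff_distrib sum_subtractf)
  ultimately show ?thesis by simp
qed

lemma lamQL_nonneg: "lamQL N h E \<ge> 0"
proof -
  have "0 \<le> (opnorm Pr V (mprod V Qmat (laplacian E 1)))\<^sup>2" by simp
  also have "\<dots> \<le> lamQL N h E" unfolding lamQL_def using h1 by (intro Max_ge) auto
  finally show ?thesis .
qed

text \<open>The Young weight \<open>lG / l2\<close> is chosen to equal the coupling in
  \<open>V_drift_le\<close>, which makes the coupling matrix symmetric. The complementary factor is
  the second summand of \<open>al\<close>; the first comes from the term with QW.\<close>

lemma R_drift_le:
  assumes \<omega>: "\<omega> \<in> space M"
  shows "- 2 * (\<Sum>p\<in>Pr. e p t \<omega> * drift e (snd p) t \<omega>) \<le> al * Rf t \<omega> + lG / l2 * Vf t \<omega>"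
proof -
  let ?W = "\<Sum>p\<in>Pr. e p t \<omega> * (\<Sum>q\<in>Pr. Wmat E (m t \<omega>) (snd p) q * e q t \<omega>)"
  let ?L = "\<Sum>p\<in>Pr. e p t \<omega> * (\<Sum>k\<in>V. laplacian E (m t \<omega>) (snd p) k * \<delta> k t \<omega>)"
  have N1: "N \<ge> 1" using N2 by simp
  have 1: "\<bar>?W\<bar> \<le> sqrt (lamQW N h E) * Rf t \<omega>"
    unfolding Rf_def by (rule QW_form[OF graphs m_range[OF \<omega>] N1])
  have 2: "\<bar>?L\<bar> \<le> sqrt (lamQL N h E) * sqrt (Rf t \<omega>) * sqrt (Vf t \<omega>)"
    unfolding Rf_def Vf_def by (rule QL_form[OF graphs m_range[OF \<omega>] N1])
  have "2 * (sqrt (lamQL N h E) * sqrt (Vf t \<omega>) * sqrt (Rf t \<omega>)) \<le> lG / l2 * Vf t \<omega> + lamQL N h E / (lG / l2) * Rf t \<omega>"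
    using lG_pos l2_pos lamQL_nonneg by (intro Young_sqrt Vf_nonneg Rf_nonneg) auto
  then have 3: "2 * (sqrt (lamQL N h E) * sqrt (Rf t \<omega>) * sqrt (Vf t \<omega>)) \<le> lG / l2 * Vf t \<omega> + lamQL N h E * l2 / lG * Rf t \<omega>"
    by (simp add: ac_simps)
  have "(\<Sum>p\<in>Pr. e p t \<omega> * drift e (snd p) t \<omega>) = ?W - ?L"
    unfolding drift_def by (simp add: right_diff_distrib sum_subtractf)
  moreover have "al * Rf t \<omega> = 2 * (sqrt (lamQW N h E) * Rf t \<omega>) + lamQL N h E * l2 / lG * Rf t \<omega>"
    unfolding alpha_const_def by (simp add: distrib_right)
  ultimately show ?thesis using 1 2 3 by linarith
qed

text \<open>For a single topology the form can vanish on a nonzero disagreement; only its stationary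
  mean is the form of the averaged Laplacian, to which the spectral gap applies.\<close>

lemma expectation_qL:
  obtains T where "tele T" "\<And>t. t \<ge> Suc t0 \<Longrightarrow> (\<integral>\<omega>. qL (m t \<omega>) t \<omega> \<partial>M) \<ge> l2 * EV t + T t"
proof -
  have sl: "slow (qL u)" for u
    unfolding qL_def by (intro slow_sum slow_mult slow_\<delta> slow_const) auto
  have me: "qL u t \<in> borel_measurable (past t)" if "t \<ge> Suc t0" for u t
    unfolding qL_def using that
    by (intro borel_measurable_sum borel_measurable_times \<delta>_measurable borel_measurable_const) auto
  obtain T where T: "tele T"
    "\<And>t. t \<ge> Suc t0 \<Longrightarrow> (\<integral>\<omega>. qL (m t \<omega>) t \<omega> \<partial>M) = (\<integral>\<omega>. (\<Sum>u\<in>{1..h}. \<pi> u * qL u t \<omega>) \<partial>M) + T t"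
    using averaging_sum[of qL] sl me by blast
  have "(\<integral>\<omega>. qL (m t \<omega>) t \<omega> \<partial>M) \<ge> l2 * EV t + T t" if t: "t \<ge> Suc t0" for t
  proof -
    have "l2 * EV t = (\<integral>\<omega>. l2 * Vf t \<omega> \<partial>M)" by (simp add: EV_def)
    also have "\<dots> \<le> (\<integral>\<omega>. (\<Sum>u\<in>{1..h}. \<pi> u * qL u t \<omega>) \<partial>M)"
    proof (rule integral_mono)
      show "integrable M (\<lambda>\<omega>. l2 * Vf t \<omega>)" using Vf_integrable[OF t] by simp
      have "integrable M (qL u t)" for u
        using sl me[OF t] t by (intro Ob_integrable_past[of 0 "qL u"]) (auto simp: slow_def)
      then show "integrable M (\<lambda>\<omega>. \<Sum>u\<in>{1..h}. \<pi> u * qL u t \<omega>)" by simp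
      fix \<omega>
      show "l2 * Vf t \<omega> \<le> (\<Sum>u\<in>{1..h}. \<pi> u * qL u t \<omega>)"
        unfolding Vf_def qL_def by (rule spectral_gap_Lcheck(2)[OF N2 graphs connected pi_pos sum_\<delta>])
    qed
    finally show ?thesis using T(2)[OF t] by simp
  qed
  then show ?thesis using that T(1) by blast
qed

text \<open>Every pair of the union graph is active in at least one topology, hence with stationary
  probability at least \<open>pmin\<close>.\<close>

lemma expectation_active:
  obtains T where "tele T" "\<And>t. t \<ge> Suc t0 \<Longrightarrow>
    (\<Sum>p\<in>Pr. (\<integral>\<omega>. adj E (m t \<omega>) (fst p) (snd p) * (e p t \<omega>)\<^sup>2 \<partial>M)) \<ge> pmin * ER t + T t"
proof -
  have ex: "\<exists>T. tele T \<and> (\<forall>t\<ge>Suc t0. (\<integral>\<omega>. adj E (m t \<omega>) (fst p) (snd p) * (e p t \<omega>)\<^sup>2 \<partial>M)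
      \<ge> pmin * (\<integral>\<omega>. (e p t \<omega>)\<^sup>2 \<partial>M) + T t)" if p: "p \<in> Pr" for p
  proof -
    let ?\<phi> = "\<lambda>u t \<omega>. adj E u (fst p) (snd p) * (e p t \<omega>)\<^sup>2"
    have sl: "slow (?\<phi> u)" for u
      unfolding power2_eq_square by (intro slow_mult slow_e slow_const p)
    have me: "?\<phi> u t \<in> borel_measurable (past t)" if "t \<ge> Suc t0" for u t
      using that p by (intro borel_measurable_times borel_measurable_power e_measurable borel_measurable_const) auto
    obtain T where T: "tele T"
      "\<And>t. t \<ge> Suc t0 \<Longrightarrow> (\<integral>\<omega>. ?\<phi> (m t \<omega>) t \<omega> \<partial>M) = (\<integral>\<omega>. (\<Sum>u\<in>{1..h}. \<pi> u * ?\<phi> u t \<omega>) \<partial>M) + T t"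
      using averaging_sum[of ?\<phi>] sl me by blast
    obtain u where u: "u \<in> {1..h}" "{fst p, snd p} \<in> E u"
      using p pairs_iff[of "fst p" "snd p"] by auto
    have "(\<integral>\<omega>. ?\<phi> (m t \<omega>) t \<omega> \<partial>M) \<ge> pmin * (\<integral>\<omega>. (e p t \<omega>)\<^sup>2 \<partial>M) + T t" if t: "t \<ge> Suc t0" for t
    proof -
      have "pmin * (\<integral>\<omega>. (e p t \<omega>)\<^sup>2 \<partial>M) = (\<integral>\<omega>. pmin * (e p t \<omega>)\<^sup>2 \<partial>M)" by simp
      also have "\<dots> \<le> (\<integral>\<omega>. (\<Sum>u\<in>{1..h}. \<pi> u * ?\<phi> u t \<omega>) \<partial>M)"
      proof (rule integral_mono)
        have "integrable M (\<lambda>\<omega>. (e p t \<omega>)\<^sup>2)"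
          using t p by (intro Ob_integrable_past[of 0 "\<lambda>t \<omega>. (e p t \<omega>)\<^sup>2"] Ob_power2 Ob_e borel_measurable_power e_measurable)
        then show "integrable M (\<lambda>\<omega>. pmin * (e p t \<omega>)\<^sup>2)" by simp
        have i\<phi>: "integrable M (?\<phi> u t)" for u
          using sl me[OF t] t by (intro Ob_integrable_past[of 0 "?\<phi> u"]) (auto simp: slow_def)
        show "integrable M (\<lambda>\<omega>. \<Sum>u\<in>{1..h}. \<pi> u * ?\<phi> u t \<omega>)"
          by (intro Bochner_Integration.integrable_sum) (rule integrable_mult_right, rule i\<phi>)
        fix \<omega>
        have "pmin * (e p t \<omega>)\<^sup>2 \<le> \<pi> u * ?\<phi> u t \<omega>"
          using pmin_le[OF u(1)] u(2) by (simp add: adj_def mult_right_mono)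
        also have "\<dots> \<le> (\<Sum>u\<in>{1..h}. \<pi> u * ?\<phi> u t \<omega>)"
          using u pi_pos by (intro member_le_sum mult_nonneg_nonneg adj_bounds) (auto simp: less_imp_le)
        finally show "pmin * (e p t \<omega>)\<^sup>2 \<le> (\<Sum>u\<in>{1..h}. \<pi> u * ?\<phi> u t \<omega>)" .
      qed
      finally show ?thesis using T(2)[OF t] by simp
    qed
    then show ?thesis using T(1) by blast
  qed
  have "\<exists>T. \<forall>p\<in>Pr. tele (T p) \<and> (\<forall>t\<ge>Suc t0. (\<integral>\<omega>. adj E (m t \<omega>) (fst p) (snd p) * (e p t \<omega>)\<^sup>2 \<partial>M)
      \<ge> pmin * (\<integral>\<omega>. (e p t \<omega>)\<^sup>2 \<partial>M) + T p t)"
    by (rule bchoice, rule ballI, rule ex)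
  then obtain T where T0: "\<forall>p\<in>Pr. tele (T p) \<and> (\<forall>t\<ge>Suc t0. (\<integral>\<omega>. adj E (m t \<omega>) (fst p) (snd p) * (e p t \<omega>)\<^sup>2 \<partial>M)
      \<ge> pmin * (\<integral>\<omega>. (e p t \<omega>)\<^sup>2 \<partial>M) + T p t)" by (rule exE)
  have T: "\<And>p. p \<in> Pr \<Longrightarrow> tele (T p)"
    "\<And>p t. p \<in> Pr \<Longrightarrow> t \<ge> Suc t0 \<Longrightarrow> (\<integral>\<omega>. adj E (m t \<omega>) (fst p) (snd p) * (e p t \<omega>)\<^sup>2 \<partial>M)
      \<ge> pmin * (\<integral>\<omega>. (e p t \<omega>)\<^sup>2 \<partial>M) + T p t"
    using T0 by auto
  have "(\<Sum>p\<in>Pr. (\<integral>\<omega>. adj E (m t \<omega>) (fst p) (snd p) * (e p t \<omega>)\<^sup>2 \<partial>M)) \<ge> pmin * ER t + (\<Sum>p\<in>Pr. T p t)"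
    if t: "t \<ge> Suc t0" for t
  proof -
    have "integrable M (\<lambda>\<omega>. (e p t \<omega>)\<^sup>2)" if "p \<in> Pr" for p
      using t that by (intro Ob_integrable_past[of 0 "\<lambda>t \<omega>. (e p t \<omega>)\<^sup>2"] Ob_power2 Ob_e borel_measurable_power e_measurable)
    then have "ER t = (\<Sum>p\<in>Pr. \<integral>\<omega>. (e p t \<omega>)\<^sup>2 \<partial>M)"
      unfolding ER_def Rf_def by (rule Bochner_Integration.integral_sum)
    then have "pmin * ER t + (\<Sum>p\<in>Pr. T p t) = (\<Sum>p\<in>Pr. pmin * (\<integral>\<omega>. (e p t \<omega>)\<^sup>2 \<partial>M) + T p t)"
      by (simp add: sum.distrib sum_distrib_left)
    also have "\<dots> \<le> (\<Sum>p\<in>Pr. (\<integral>\<omega>. adj E (m t \<omega>) (fst p) (snd p) * (e p t \<omega>)\<^sup>2 \<partial>M))"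
      using T(2) t by (intro sum_mono) auto
    finally show ?thesis .
  qed
  then show ?thesis using that[of "\<lambda>t. \<Sum>p\<in>Pr. T p t"] T(1) by (simp add: tele_sum)
qed

text \<open>The Laplacian form is exchanged for \<open>l2\<close> only after expectations are taken;
  of the dissipation 2 \<open>l2\<close>, the part \<open>l2\<close> survives the cross
  term.\<close>

lemma EV_recursion:
  obtains T C where "tele T" "\<And>t. t \<ge> Suc t0 \<Longrightarrow>
    EV (Suc t) \<le> EV t + (\<gamma> * (lG / l2) * ER t - \<gamma> * l2 * EV t) / real t + T t / real t + C / (real t)\<^sup>2"
proof -
  obtain T where T: "tele T" "\<And>t. t \<ge> Suc t0 \<Longrightarrow> (\<integral>\<omega>. qL (m t \<omega>) t \<omega> \<partial>M) \<ge> l2 * EV t + T t"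
    using expectation_qL by blast
  define S where "S t \<omega> = (\<Sum>i\<in>V. \<delta> i t \<omega> * drift e i t \<omega>)" for t \<omega>
  define res where "res t \<omega> = Vf (Suc t) \<omega> - Vf t \<omega> - 2 * \<gamma> / real t * S t \<omega>" for t \<omega>
  have ObS: "Ob 0 S" unfolding S_def by (intro Ob_sum Ob_0_mult Ob_\<delta> Ob_drift Ob_e) auto
  have Sm: "S t \<in> borel_measurable M" if "t \<ge> Suc t0" for t
    unfolding S_def using that
    by (intro borel_measurable_sum borel_measurable_times measurable_past_M[OF \<delta>_measurable] measurable_past_M[OF drift_e_measurable])
  have Si: "integrable M (S t)" if "t \<ge> Suc t0" for t using Ob_integrable[OF ObS that Sm[OF that]] .
  have resi: "integrable M (res t)" if "t \<ge> Suc t0" for t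
    unfolding res_def using Vf_integrable[of t] Vf_integrable[of "Suc t"] Si[OF that] that by simp
  have "\<exists>C. \<forall>t\<ge>Suc t0. \<bar>\<integral>\<omega>. res t \<omega> \<partial>M\<bar> \<le> C / real t ^ 2"
    using Ob_Vf_step resi unfolding res_def S_def by (intro Ob_expectation) auto
  then obtain C where C: "\<And>t. t \<ge> Suc t0 \<Longrightarrow> \<bar>\<integral>\<omega>. res t \<omega> \<partial>M\<bar> \<le> C / (real t)\<^sup>2" by blast
  have "EV (Suc t) \<le> EV t + (\<gamma> * (lG / l2) * ER t - \<gamma> * l2 * EV t) / real t + (- (2 * \<gamma>) * T t) / real t + C / (real t)\<^sup>2"
    if t: "t \<ge> Suc t0" for t
  proof -
    have t1: "real t > 0" using t by simp
    have "EV (Suc t) = (\<integral>\<omega>. Vf t \<omega> + 2 * \<gamma> / real t * S t \<omega> + res t \<omega> \<partial>M)"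
      unfolding EV_def by (intro Bochner_Integration.integral_cong refl) (simp add: res_def)
    also have "\<dots> = EV t + 2 * \<gamma> / real t * (\<integral>\<omega>. S t \<omega> \<partial>M) + (\<integral>\<omega>. res t \<omega> \<partial>M)"
      unfolding EV_def using Vf_integrable[OF t] Si[OF t] resi[OF t] by simp
    finally have 1: "EV (Suc t) = EV t + \<gamma> / real t * (2 * (\<integral>\<omega>. S t \<omega> \<partial>M)) + (\<integral>\<omega>. res t \<omega> \<partial>M)" by simp
    have qm: "integrable M (\<lambda>\<omega>. qL (m t \<omega>) t \<omega>)"
    proof (rule Ob_integrable_past[of 0 "\<lambda>t \<omega>. qL (m t \<omega>) t \<omega>"])
      show "Ob 0 (\<lambda>t \<omega>. qL (m t \<omega>) t \<omega>)"
        unfolding qL_def by (intro Ob_sum Ob_0_mult Ob_\<delta> Ob_chain) auto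
      show "(\<lambda>\<omega>. qL (m t \<omega>) t \<omega>) \<in> borel_measurable (past t)"
        unfolding qL_def using t
        by (intro borel_measurable_sum borel_measurable_times \<delta>_measurable chain_measurable) auto
    qed (rule t)
    have "2 * (\<integral>\<omega>. S t \<omega> \<partial>M) = (\<integral>\<omega>. 2 * S t \<omega> \<partial>M)" by simp
    also have "\<dots> \<le> (\<integral>\<omega>. - 2 * qL (m t \<omega>) t \<omega> + l2 * Vf t \<omega> + lG / l2 * Rf t \<omega> \<partial>M)"
    proof (rule integral_mono)
      show "integrable M (\<lambda>\<omega>. 2 * S t \<omega>)" using Si[OF t] by simp
      show "integrable M (\<lambda>\<omega>. - 2 * qL (m t \<omega>) t \<omega> + l2 * Vf t \<omega> + lG / l2 * Rf t \<omega>)"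
        using qm Vf_integrable[OF t] Rf_integrable[OF t]
        by (intro Bochner_Integration.integrable_add integrable_mult_right)
    qed (unfold S_def, rule V_drift_le)
    also have "\<dots> = - 2 * (\<integral>\<omega>. qL (m t \<omega>) t \<omega> \<partial>M) + l2 * EV t + lG / l2 * ER t"
      unfolding EV_def ER_def using qm Vf_integrable[OF t] Rf_integrable[OF t]
      by (subst Bochner_Integration.integral_add; (subst Bochner_Integration.integral_add)?; simp)
    also have "\<dots> \<le> - 2 * (l2 * EV t + T t) + l2 * EV t + lG / l2 * ER t" using T(2)[OF t] by simp
    also have "\<dots> = lG / l2 * ER t - l2 * EV t - 2 * T t" by simp
    finally have 2: "2 * (\<integral>\<omega>. S t \<omega> \<partial>M) \<le> lG / l2 * ER t - l2 * EV t - 2 * T t" .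
    have "EV (Suc t) \<le> EV t + \<gamma> / real t * (lG / l2 * ER t - l2 * EV t - 2 * T t) + C / (real t)\<^sup>2"
      unfolding 1 using mult_left_mono[OF 2, of "\<gamma> / real t"] C[OF t] params t1 by (simp add: abs_le_iff)
    also have "\<gamma> / real t * (lG / l2 * ER t - l2 * EV t - 2 * T t)
       = (\<gamma> * (lG / l2) * ER t - \<gamma> * l2 * EV t) / real t + (- (2 * \<gamma>) * T t) / real t"
      using t1 l2_pos by (simp add: field_simps)
    finally show ?thesis by simp
  qed
  then show ?thesis using that[OF tele_cmult[OF T(1)], of "- (2 * \<gamma>)" C] by blast
qed

text \<open>The step is taken in two halves: updating the estimates contracts, by
  \<open>expectation_g\<close> and \<open>expectation_active\<close>, and moving the outputs acts
  back through the drift, by \<open>R_drift_le\<close>.\<close>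

lemma ER_recursion:
  obtains T C where "tele T" "\<And>t. t \<ge> Suc t0 \<Longrightarrow>
    ER (Suc t) \<le> ER t + (\<gamma> * (lG / l2) * EV t - (2 * \<beta> * fM * pmin - \<gamma> * al) * ER t) / real t
      + T t / real t + C / (real t)\<^sup>2"
proof -
  obtain T where T: "tele T" "\<And>t. t \<ge> Suc t0 \<Longrightarrow>
    (\<Sum>p\<in>Pr. (\<integral>\<omega>. adj E (m t \<omega>) (fst p) (snd p) * (e p t \<omega>)\<^sup>2 \<partial>M)) \<ge> pmin * ER t + T t"
    using expectation_active by blast
  define S where "S t \<omega> = (\<Sum>p\<in>Pr. e p t \<omega> * drift e (snd p) t \<omega>)" for t \<omega>
  define Z where "Z t \<omega> = (\<Sum>p\<in>Pr. (\<epsilon> p t \<omega>)\<^sup>2)" for t \<omega>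
  define res where "res t \<omega> = Rf (Suc t) \<omega> - Z t \<omega> + 2 * \<gamma> / real t * S t \<omega>" for t \<omega>
  have ObS: "Ob 0 S" unfolding S_def by (intro Ob_sum Ob_0_mult Ob_e Ob_drift) auto
  have Sm: "S t \<in> borel_measurable M" if "t \<ge> Suc t0" for t
    unfolding S_def using that
    by (intro borel_measurable_sum borel_measurable_times measurable_past_M[OF e_measurable] measurable_past_M[OF drift_e_measurable])
  have Si: "integrable M (S t)" if "t \<ge> Suc t0" for t using Ob_integrable[OF ObS that Sm[OF that]] .
  have ObZ: "Ob 0 Z" unfolding Z_def by (intro Ob_sum Ob_power2 Ob_\<epsilon>) auto
  have Zm: "Z t \<in> borel_measurable M" if t: "t \<ge> Suc t0" for t
  proof -
    have "z p t \<in> borel_measurable M" if "p \<in> Pr" for p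
      using measurable_past_M[OF z_measurable[of "Suc t" p]] that t by simp
    moreover have "y (snd p) t \<in> borel_measurable M" if "p \<in> Pr" for p
      using measurable_past_M[OF y_measurable[OF t snd_Pr[OF that]]] .
    ultimately show ?thesis unfolding Z_def \<epsilon>_def
      by (intro borel_measurable_sum borel_measurable_power borel_measurable_diff)
  qed
  have Zi: "integrable M (Z t)" if "t \<ge> Suc t0" for t using Ob_integrable[OF ObZ that Zm[OF that]] .
  have resi: "integrable M (res t)" if "t \<ge> Suc t0" for t
    unfolding res_def using Zi[OF that] Rf_integrable[of "Suc t"] Si[OF that] that by simp
  have "\<exists>C. \<forall>t\<ge>Suc t0. \<bar>\<integral>\<omega>. res t \<omega> \<partial>M\<bar> \<le> C / real t ^ 2"
    using Ob_Rf_step resi unfolding res_def S_def Z_def by (intro Ob_expectation) auto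
  then obtain C where C: "\<And>t. t \<ge> Suc t0 \<Longrightarrow> \<bar>\<integral>\<omega>. res t \<omega> \<partial>M\<bar> \<le> C / (real t)\<^sup>2" by blast
  \<comment> \<open>The first summand collects the squared innovations, each at most 1, over all
    pairs.\<close>
  define C' where "C' = real (card Pr) * \<beta>\<^sup>2 + C"
  have "ER (Suc t) \<le> ER t + (\<gamma> * (lG / l2) * EV t - (2 * \<beta> * fM * pmin - \<gamma> * al) * ER t) / real t
      + (- (2 * \<beta> * fM) * T t) / real t + C' / (real t)\<^sup>2"
    if t: "t \<ge> Suc t0" for t
  proof -
    have t1: "real t > 0" using t by simp
    have "ER (Suc t) = (\<integral>\<omega>. Z t \<omega> - 2 * \<gamma> / real t * S t \<omega> + res t \<omega> \<partial>M)"
      unfolding ER_def by (intro Bochner_Integration.integral_cong refl) (simp add: res_def)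
    also have "\<dots> = (\<integral>\<omega>. Z t \<omega> \<partial>M) - 2 * \<gamma> / real t * (\<integral>\<omega>. S t \<omega> \<partial>M) + (\<integral>\<omega>. res t \<omega> \<partial>M)"
      using Zi[OF t] Si[OF t] resi[OF t] by simp
    finally have 1: "ER (Suc t) = (\<integral>\<omega>. Z t \<omega> \<partial>M) + \<gamma> / real t * (- 2 * (\<integral>\<omega>. S t \<omega> \<partial>M)) + (\<integral>\<omega>. res t \<omega> \<partial>M)" by simp
    have "- 2 * (\<integral>\<omega>. S t \<omega> \<partial>M) = (\<integral>\<omega>. - 2 * S t \<omega> \<partial>M)" by simp
    also have "\<dots> \<le> (\<integral>\<omega>. al * Rf t \<omega> + lG / l2 * Vf t \<omega> \<partial>M)"
    proof (rule integral_mono)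
      show "integrable M (\<lambda>\<omega>. - 2 * S t \<omega>)" using Si[OF t] by simp
      show "integrable M (\<lambda>\<omega>. al * Rf t \<omega> + lG / l2 * Vf t \<omega>)"
        using Vf_integrable[OF t] Rf_integrable[OF t]
        by (intro Bochner_Integration.integrable_add integrable_mult_right)
    qed (unfold S_def, rule R_drift_le)
    also have "\<dots> = al * ER t + lG / l2 * EV t"
      unfolding EV_def ER_def using Vf_integrable[OF t] Rf_integrable[OF t] by simp
    finally have 2: "- 2 * (\<integral>\<omega>. S t \<omega> \<partial>M) \<le> al * ER t + lG / l2 * EV t" .
    have eg: "integrable M (\<lambda>\<omega>. \<Sum>p\<in>Pr. e p t \<omega> * g p t \<omega>)"
      using expectation_g(1)[OF _ t] by (intro Bochner_Integration.integrable_sum)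
    have "(\<integral>\<omega>. Z t \<omega> \<partial>M) \<le> (\<integral>\<omega>. Rf t \<omega> + 2 * \<beta> / real t * (\<Sum>p\<in>Pr. e p t \<omega> * g p t \<omega>) + real (card Pr) * (\<beta>\<^sup>2 / (real t)\<^sup>2) \<partial>M)"
    proof (rule integral_mono)
      show "integrable M (\<lambda>\<omega>. Rf t \<omega> + 2 * \<beta> / real t * (\<Sum>p\<in>Pr. e p t \<omega> * g p t \<omega>) + real (card Pr) * (\<beta>\<^sup>2 / (real t)\<^sup>2))"
        using eg Rf_integrable[OF t] by (intro Bochner_Integration.integrable_add integrable_mult_right integrable_const)
      fix \<omega> assume \<omega>: "\<omega> \<in> space M"
      have "Z t \<omega> \<le> (\<Sum>p\<in>Pr. (e p t \<omega>)\<^sup>2 + 2 * \<beta> / real t * (e p t \<omega> * g p t \<omega>) + \<beta>\<^sup>2 / (real t)\<^sup>2)"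
        unfolding Z_def using t \<omega> by (intro sum_mono \<epsilon>_sq_le)
      also have "\<dots> = Rf t \<omega> + 2 * \<beta> / real t * (\<Sum>p\<in>Pr. e p t \<omega> * g p t \<omega>) + real (card Pr) * (\<beta>\<^sup>2 / (real t)\<^sup>2)"
        by (simp only: Rf_def sum.distrib sum_distrib_left sum_constant)
      finally show "Z t \<omega> \<le> \<dots>" .
    qed (rule Zi[OF t])
    also have "\<dots> = ER t + 2 * \<beta> / real t * (\<Sum>p\<in>Pr. \<integral>\<omega>. e p t \<omega> * g p t \<omega> \<partial>M) + real (card Pr) * (\<beta>\<^sup>2 / (real t)\<^sup>2)"
      unfolding ER_def using Rf_integrable[OF t] eg expectation_g(1)[OF _ t] by (simp add: prob_space)
    also have "\<dots> \<le> ER t + 2 * \<beta> / real t * (- fM * (pmin * ER t + T t)) + real (card Pr) * (\<beta>\<^sup>2 / (real t)\<^sup>2)"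
    proof -
      have "(\<Sum>p\<in>Pr. \<integral>\<omega>. e p t \<omega> * g p t \<omega> \<partial>M) \<le> (\<Sum>p\<in>Pr. - fM * (\<integral>\<omega>. adj E (m t \<omega>) (fst p) (snd p) * (e p t \<omega>)\<^sup>2 \<partial>M))"
        using t by (intro sum_mono expectation_g(3))
      also have "\<dots> = - fM * (\<Sum>p\<in>Pr. (\<integral>\<omega>. adj E (m t \<omega>) (fst p) (snd p) * (e p t \<omega>)\<^sup>2 \<partial>M))"
        by (simp only: sum_distrib_left)
      also have "\<dots> \<le> - fM * (pmin * ER t + T t)" using T(2)[OF t] fM_pos by simp
      finally show ?thesis using params t1 by (intro add_mono mult_left_mono order_refl) auto
    qed
    finally have 3: "(\<integral>\<omega>. Z t \<omega> \<partial>M) \<le> ER t + 2 * \<beta> / real t * (- fM * (pmin * ER t + T t)) + real (card Pr) * (\<beta>\<^sup>2 / (real t)\<^sup>2)" .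
    have "ER (Suc t) \<le> ER t + 2 * \<beta> / real t * (- fM * (pmin * ER t + T t)) + real (card Pr) * (\<beta>\<^sup>2 / (real t)\<^sup>2)
       + \<gamma> / real t * (al * ER t + lG / l2 * EV t) + C / (real t)\<^sup>2"
      unfolding 1 using 3 mult_left_mono[OF 2, of "\<gamma> / real t"] C[OF t] params t1 by (simp add: abs_le_iff)
    also have "\<dots> = ER t + (\<gamma> * (lG / l2) * EV t - (2 * \<beta> * fM * pmin - \<gamma> * al) * ER t) / real t
      + (- (2 * \<beta> * fM) * T t) / real t + C' / (real t)\<^sup>2"
      unfolding C'_def using t1 by (simp add: add_divide_distrib diff_divide_distrib algebra_simps)
    finally show ?thesis .
  qed
  then show ?thesis using that[OF tele_cmult[OF T(1)], of "- (2 * \<beta> * fM)" C'] by blast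
qed

text \<open>The weighted sum decays at a rate above l if p - w q > l and r - q/w > l, that is, if w
  lies strictly between q/(r - l) and (p - l)/q. The determinant condition says that this interval
  is nonempty, and the strict inequalities leave room for \<open>l' > l\<close>.\<close>

lemma Lyapunov_recursion:
  fixes l :: real
  assumes pl: "\<gamma> * l2 > l"
    and det: "(\<gamma> * l2 - l) * (2 * \<beta> * fM * pmin - \<gamma> * al - l) > (\<gamma> * (lG / l2))\<^sup>2"
  obtains w l' G B C where "w > 0" "l' > l" "\<And>t. t \<ge> Suc t0 \<Longrightarrow> \<bar>G t\<bar> \<le> B"
    "\<And>t. t \<ge> Suc t0 \<Longrightarrow> EV (Suc t) + w * ER (Suc t)
       \<le> (1 - l' / real t) * (EV t + w * ER t) + (G (Suc t) - G t) / real t + C / (real t)\<^sup>2"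
proof -
  define p where "p = \<gamma> * l2"
  define q where "q = \<gamma> * (lG / l2)"
  define r where "r = 2 * \<beta> * fM * pmin - \<gamma> * al"
  have q: "q > 0" using params lG_pos l2_pos by (simp add: q_def)
  have pl': "p - l > 0" using pl by (simp add: p_def)
  have d: "(p - l) * (r - l) > q\<^sup>2" using det by (simp add: p_def q_def r_def)
  then have rl: "r - l > 0" using pl' q by (metis less_trans zero_less_mult_pos zero_less_power)
  have int: "q / (r - l) < (p - l) / q"
    using d q rl by (simp add: field_simps power2_eq_square)
  obtain w where w: "q / (r - l) < w" "w < (p - l) / q" using dense[OF int] by blast
  have w0: "w > 0" using w(1) q rl by (meson divide_pos_pos less_trans)
  have 1: "p - w * q > l" using w(2) q by (simp add: field_simps)
  have 2: "r - q / w > l" using w(1) w0 rl by (simp add: field_simps)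
  define l' where "l' = min (p - w * q) (r - q / w)"
  have l': "l' > l" "l' \<le> p - w * q" "l' \<le> r - q / w" using 1 2 by (auto simp: l'_def)
  have l'w: "w * l' \<le> w * r - q"
    using mult_left_mono[OF l'(3), of w] w0 by (simp add: right_diff_distrib)
  obtain T1 C1 where T1: "tele T1" "\<And>t. t \<ge> Suc t0 \<Longrightarrow>
    EV (Suc t) \<le> EV t + (q * ER t - p * EV t) / real t + T1 t / real t + C1 / (real t)\<^sup>2"
    unfolding p_def q_def using EV_recursion by blast
  obtain T2 C2 where T2: "tele T2" "\<And>t. t \<ge> Suc t0 \<Longrightarrow>
    ER (Suc t) \<le> ER t + (q * EV t - r * ER t) / real t + T2 t / real t + C2 / (real t)\<^sup>2"
    unfolding q_def r_def using ER_recursion by blast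
  have "tele (\<lambda>t. T1 t + w * T2 t)" using T1(1) T2(1) by (intro tele_add tele_cmult)
  then obtain G B where G: "\<And>t. t \<ge> Suc t0 \<Longrightarrow> \<bar>G t\<bar> \<le> B"
    "\<And>t. t \<ge> Suc t0 \<Longrightarrow> \<bar>T1 t + w * T2 t - (G (Suc t) - G t)\<bar> \<le> B / real t" by (rule teleE) blast
  have "EV (Suc t) + w * ER (Suc t)
       \<le> (1 - l' / real t) * (EV t + w * ER t) + (G (Suc t) - G t) / real t + (C1 + w * C2 + B) / (real t)\<^sup>2"
    if t: "t \<ge> Suc t0" for t
  proof -
    have t1: "real t > 0" using t by simp
    have "(T1 t + w * T2 t) / real t \<le> ((G (Suc t) - G t) + B / real t) / real t"
      using G(2)[OF t] t1 by (intro divide_right_mono) (auto simp: abs_le_iff)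
    also have "\<dots> = (G (Suc t) - G t) / real t + B / (real t)\<^sup>2"
      by (simp add: add_divide_distrib power2_eq_square)
    finally have T: "(T1 t + w * T2 t) / real t \<le> (G (Suc t) - G t) / real t + B / (real t)\<^sup>2" .
    have "l' * EV t \<le> (p - w * q) * EV t" using l'(2) EV_nonneg by (intro mult_right_mono)
    moreover have "w * l' * ER t \<le> (w * r - q) * ER t" using l'w ER_nonneg by (intro mult_right_mono)
    ultimately have "(q * ER t - p * EV t) + w * (q * EV t - r * ER t) \<le> - (l' * (EV t + w * ER t))"
      by (simp add: algebra_simps)
    then have X: "((q * ER t - p * EV t) + w * (q * EV t - r * ER t)) / real t \<le> - (l' * (EV t + w * ER t)) / real t"
      using t1 by (intro divide_right_mono) auto
    have "EV (Suc t) + w * ER (Suc t) \<le> (EV t + (q * ER t - p * EV t) / real t + T1 t / real t + C1 / (real t)\<^sup>2)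
       + w * (ER t + (q * EV t - r * ER t) / real t + T2 t / real t + C2 / (real t)\<^sup>2)"
      using T1(2)[OF t] T2(2)[OF t] w0 by (intro add_mono mult_left_mono) auto
    also have "\<dots> = EV t + w * ER t + ((q * ER t - p * EV t) + w * (q * EV t - r * ER t)) / real t
       + (T1 t + w * T2 t) / real t + (C1 + w * C2) / (real t)\<^sup>2"
      by (simp add: add_divide_distrib distrib_left)
    also have "\<dots> \<le> EV t + w * ER t + - (l' * (EV t + w * ER t)) / real t
       + ((G (Suc t) - G t) / real t + B / (real t)\<^sup>2) + (C1 + w * C2) / (real t)\<^sup>2"
      using X T by simp
    also have "\<dots> = (1 - l' / real t) * (EV t + w * ER t) + (G (Suc t) - G t) / real t + (C1 + w * C2 + B) / (real t)\<^sup>2"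
      by (simp add: add_divide_distrib left_diff_distrib)
    finally show ?thesis .
  qed
  then show ?thesis
    by (intro that[of w l' G B "C1 + w * C2 + B"] w0 l'(1) G(1))
qed

text \<open>After clearing the positive factor 2 \<open>fM\<close> \<open>pmin\<close>,
  multiplication by \<gamma> \<open>l2\<close> turns the bound on \<beta> into the determinant
  condition for l = 0.\<close>

theorem EV_tendsto_0:
  assumes "\<beta> > 1 / (2 * fM * pmin) * (\<gamma> * lG\<^sup>2 / l2 ^ 3 + \<gamma> * al)"
  shows "EV \<longlonglongrightarrow> 0"
proof -
  have "\<gamma> * lG\<^sup>2 / l2 ^ 3 + \<gamma> * al < 2 * \<beta> * fM * pmin"
    using assms fM_pos pmin_pos by (simp add: field_simps)
  then have "\<gamma> * lG\<^sup>2 / l2 ^ 3 < 2 * \<beta> * fM * pmin - \<gamma> * al" by simp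
  then have "\<gamma> * l2 * (\<gamma> * lG\<^sup>2 / l2 ^ 3) < \<gamma> * l2 * (2 * \<beta> * fM * pmin - \<gamma> * al)"
    using params l2_pos by (intro mult_strict_left_mono) auto
  moreover have "\<gamma> * l2 * (\<gamma> * lG\<^sup>2 / l2 ^ 3) = (\<gamma> * (lG / l2))\<^sup>2"
    using l2_pos by (simp add: power2_eq_square power3_eq_cube)
  ultimately have "(\<gamma> * (lG / l2))\<^sup>2 < (\<gamma> * l2 - 0) * (2 * \<beta> * fM * pmin - \<gamma> * al - 0)" by simp
  from Lyapunov_recursion[OF _ this] params l2_pos
  obtain w l' G B C where w: "w > 0" "l' > 0" "\<And>t. t \<ge> Suc t0 \<Longrightarrow> \<bar>G t\<bar> \<le> B"
    "\<And>t. t \<ge> Suc t0 \<Longrightarrow> EV (Suc t) + w * ER (Suc t)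
       \<le> (1 - l' / real t) * (EV t + w * ER t) + (G (Suc t) - G t) / real t + C / (real t)\<^sup>2"
    by (metis mult_pos_pos)
  have nn: "0 \<le> EV t + w * ER t" for t using EV_nonneg ER_nonneg w(1) by simp
  have lim: "(\<lambda>t. EV t + w * ER t) \<longlonglongrightarrow> 0"
    by (rule perturbed_recursion_tendsto_0[OF w(2) nn _ w(3) w(4)]) auto
  show ?thesis
    by (rule tendsto_sandwich[OF _ _ tendsto_const lim]) (use EV_nonneg ER_nonneg w(1) in auto)
qed

text \<open>With l = 1 the bound on \<gamma> is the first diagonal condition and the bound on
  \<beta> the determinant condition. The resulting rate is strictly above 1, as the supersolution
  K/t requires.\<close>

theorem EV_bigo:
  assumes g1: "\<gamma> > 1 / l2"
    and "\<beta> > 1 / (2 * fM * pmin) * (\<gamma>\<^sup>2 * lG\<^sup>2 / (l2\<^sup>2 * (\<gamma> * l2 - 1)) + \<gamma> * al + 1)"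
  shows "\<exists>K. \<forall>t\<ge>Suc t0. EV t \<le> K / real t"
proof -
  have p1: "\<gamma> * l2 > 1" using g1 l2_pos by (simp add: field_simps)
  have "A < 2 * \<beta> * fM * pmin" if "\<beta> > 1 / (2 * fM * pmin) * A" for A
    using that fM_pos pmin_pos by (simp add: field_simps)
  from this[OF assms(2)]
  have "\<gamma>\<^sup>2 * lG\<^sup>2 / (l2\<^sup>2 * (\<gamma> * l2 - 1)) + \<gamma> * al + 1 < 2 * \<beta> * fM * pmin" .
  then have "\<gamma>\<^sup>2 * lG\<^sup>2 / (l2\<^sup>2 * (\<gamma> * l2 - 1)) < 2 * \<beta> * fM * pmin - \<gamma> * al - 1" by simp
  then have "(\<gamma> * l2 - 1) * (\<gamma>\<^sup>2 * lG\<^sup>2 / (l2\<^sup>2 * (\<gamma> * l2 - 1))) < (\<gamma> * l2 - 1) * (2 * \<beta> * fM * pmin - \<gamma> * al - 1)"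
    using p1 by (intro mult_strict_left_mono) auto
  moreover have "(\<gamma> * l2 - 1) * (\<gamma>\<^sup>2 * lG\<^sup>2 / (l2\<^sup>2 * (\<gamma> * l2 - 1))) = (\<gamma> * (lG / l2))\<^sup>2"
    using p1 by (simp add: power_mult_distrib power_divide)
  ultimately have "(\<gamma> * (lG / l2))\<^sup>2 < (\<gamma> * l2 - 1) * (2 * \<beta> * fM * pmin - \<gamma> * al - 1)" by simp
  from Lyapunov_recursion[OF p1 this]
  obtain w l' G B C where w: "w > 0" "l' > 1" "\<And>t. t \<ge> Suc t0 \<Longrightarrow> \<bar>G t\<bar> \<le> B"
    "\<And>t. t \<ge> Suc t0 \<Longrightarrow> EV (Suc t) + w * ER (Suc t)
       \<le> (1 - l' / real t) * (EV t + w * ER t) + (G (Suc t) - G t) / real t + C / (real t)\<^sup>2"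
    by metis
  have "\<exists>K. \<forall>t\<ge>Suc t0. EV t + w * ER t \<le> K / real t"
    by (rule perturbed_recursion_bigo[OF w(2) _ w(3) w(4)]) auto
  then obtain K where K: "\<And>t. t \<ge> Suc t0 \<Longrightarrow> EV t + w * ER t \<le> K / real t" by blast
  have "EV t \<le> K / real t" if "t \<ge> Suc t0" for t
    using K[OF that] ER_nonneg[of t] w(1) mult_nonneg_nonneg[of w "ER t"] by linarith
  then show ?thesis by blast
qed

end

declare One_nat_def [simp]

section \<open>From the outputs to the states\<close>

lemma sys_step_index:
  assumes n: "n \<ge> 2" and v: "v \<in> carrier_vec n"
  shows "k < n - 1 \<Longrightarrow> (sysA n a *\<^sub>v v + w \<cdot>\<^sub>v sysB n) $ k = v $ (k + 1)"
    and "(sysA n a *\<^sub>v v + w \<cdot>\<^sub>v sysB n) $ (n - 1) = (\<Sum>l<n. a (l + 1) * v $ l) + w"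
proof -
  have A: "(sysA n a *\<^sub>v v + w \<cdot>\<^sub>v sysB n) $ k
    = (\<Sum>l<n. sysA n a $$ (k, l) * v $ l) + w * (if k = n - 1 then 1 else 0)" if "k < n" for k
    using that v by (auto simp: sysA_def sysB_def scalar_prod_def atLeast0LessThan intro!: sum.cong)
  show "(sysA n a *\<^sub>v v + w \<cdot>\<^sub>v sysB n) $ k = v $ (k + 1)" if k: "k < n - 1"
  proof -
    have kn: "k < n" "k + 1 < n" using k by auto
    have "(\<Sum>l<n. sysA n a $$ (k, l) * v $ l) = (\<Sum>l<n. if l = k + 1 then v $ (k + 1) else 0)"
      using k kn by (intro sum.cong refl) (auto simp: sysA_def)
    then show ?thesis using A[OF kn(1)] kn k by simp
  qed
  have n1: "n - 1 < n" using n by simp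
  have "(\<Sum>l<n. sysA n a $$ (n - 1, l) * v $ l) = (\<Sum>l<n. a (l + 1) * v $ l)"
    using n1 by (intro sum.cong refl) (auto simp: sysA_def)
  then show "(sysA n a *\<^sub>v v + w \<cdot>\<^sub>v sysB n) $ (n - 1) = (\<Sum>l<n. a (l + 1) * v $ l) + w"
    using A[OF n1] by simp
qed

lemma gainK2_prod: "v \<in> carrier_vec n \<Longrightarrow> gainK2 n b \<bullet> v = (\<Sum>k<n. bext n b (k + 1) * v $ k)"
  by (auto simp: gainK2_def scalar_prod_def atLeast0LessThan intro!: sum.cong)

lemma gainK1_prod:
  "v \<in> carrier_vec n \<Longrightarrow> gainK1 n a b \<bullet> v = (\<Sum>k<n. (- a (k + 1) + bext n b (k + 1) - bext n b k) * v $ k)"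
  by (auto simp: gainK1_def scalar_prod_def atLeast0LessThan intro!: sum.cong)

text \<open>In companion form the components shift, so K2 x(t+1) pairs b_k with the next component
  of x(t). K1 cancels the last row of A and supplies the difference between the two alignments of
  the b's; the conventions b_0 = 0 and b_n = 1 make both ends fit. The closed loop output is thus a
  pure integrator of w.\<close>

lemma gainK2_step:
  assumes n: "n \<ge> 2" and v: "v \<in> carrier_vec n"
  shows "gainK2 n b \<bullet> (sysA n a *\<^sub>v v + (gainK1 n a b \<bullet> v + w) \<cdot>\<^sub>v sysB n) = gainK2 n b \<bullet> v + w"
proof -
  obtain n' where n': "n = Suc n'" using n by (cases n) auto
  let ?u = "gainK1 n a b \<bullet> v + w"
  let ?x = "sysA n a *\<^sub>v v + ?u \<cdot>\<^sub>v sysB n"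
  have xc: "?x \<in> carrier_vec n" by (rule carrier_vecI) (simp add: sysB_def)
  have idx: "?x $ k = v $ Suc k" if "k < n'" for k
    using sys_step_index(1)[OF n v, of k a ?u] that n' by simp
  have idl: "?x $ n' = (\<Sum>l<n. a (l + 1) * v $ l) + ?u"
    using sys_step_index(2)[OF n v, of a ?u] n' by simp
  have b0: "bext n b 0 = 0" and bn: "bext n b (Suc n') = 1" by (auto simp: bext_def n')
  have "gainK2 n b \<bullet> ?x = (\<Sum>k<n'. bext n b (Suc k) * ?x $ k) + ?x $ n'"
    unfolding gainK2_prod[OF xc] using bn by (simp add: n' del: index_add_vec)
  also have "(\<Sum>k<n'. bext n b (Suc k) * ?x $ k) = (\<Sum>k<n'. bext n b (Suc k) * v $ Suc k)"
    using idx by (intro sum.cong refl) (simp del: index_add_vec)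
  also have "\<dots> = (\<Sum>k<n. bext n b k * v $ k)"
    unfolding n' sum.lessThan_Suc_shift using b0 by (simp add: n')
  also have "(\<Sum>k<n. bext n b k * v $ k) + ?x $ n' = (\<Sum>k<n. bext n b (k + 1) * v $ k) + w"
  proof -
    have "?x $ n' = (\<Sum>k<n. bext n b (k + 1) * v $ k) - (\<Sum>k<n. bext n b k * v $ k) + w"
      unfolding idl unfolding gainK1_prod[OF v]
      by (simp add: sum.distrib sum_subtractf sum_negf algebra_simps)
    then show ?thesis by linarith
  qed
  finally show ?thesis unfolding gainK2_prod[OF v] .
qed

lemma gain_poly_coeff: "n \<ge> 2 \<Longrightarrow> k < n \<Longrightarrow> coeff (gain_poly n b) k = bext n b (k + 1)"
proof -
  assume n: "n \<ge> 2" and k: "k < n"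
  have "coeff (gain_poly n b) k = (if k = n - 1 then 1 else 0) + (\<Sum>l<n - 1. if l = k then b (l + 1) else 0)"
    by (simp add: gain_poly_def coeff_sum eq_commute)
  then show ?thesis using n k by (auto simp: bext_def)
qed

lemma gain_poly_degree: "n \<ge> 2 \<Longrightarrow> degree (gain_poly n b) \<le> n - 1"
  unfolding gain_poly_def by (intro degree_add_le degree_sum_le) (auto simp: degree_monom_eq intro: order_trans[OF degree_monom_le])

text \<open>The components of the deviation are the shifts of its first component, so K2 applied to
  the deviation is \<open>gain_poly\<close>, read in the shift operator, acting on one scalar
  sequence. Its roots lie inside the unit disc, so \<open>stable_shift_poly\<close> carries the rate
  from the output to that sequence.\<close>

lemma (in rate_class) state_error_from_output:
  fixes X :: "nat \<Rightarrow> nat \<Rightarrow> 'w \<Rightarrow> real vec"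
  assumes M: "finite_measure M" and n: "n \<ge> 2"
    and roots: "\<forall>z. poly (map_poly complex_of_real (gain_poly n b)) z = 0 \<longrightarrow> cmod z < 1"
    and car: "\<And>j t \<omega>. j \<in> {1..N} \<Longrightarrow> \<omega> \<in> space M \<Longrightarrow> X j t \<omega> \<in> carrier_vec n"
    and shiftX: "\<And>j t \<omega> k. j \<in> {1..N} \<Longrightarrow> \<omega> \<in> space M \<Longrightarrow> k < n - 1 \<Longrightarrow> X j (Suc t) \<omega> $ k = X j t \<omega> $ (k + 1)"
    and init: "\<And>j \<omega>. j \<in> {1..N} \<Longrightarrow> \<omega> \<in> space M \<Longrightarrow> X j 0 \<omega> = X0 j"
    and out_meas: "\<And>j t. j \<in> {1..N} \<Longrightarrow> (\<lambda>\<omega>. gainK2 n b \<bullet> X j t \<omega>) \<in> borel_measurable M"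
    and out_bd: "\<And>j t \<omega>. j \<in> {1..N} \<Longrightarrow> \<omega> \<in> space M \<Longrightarrow> \<bar>gainK2 n b \<bullet> X j t \<omega>\<bar> \<le> B"
    and i: "i \<in> {1..N}"
    and good: "Good (\<lambda>t. \<integral>\<omega>. (gainK2 n b \<bullet> X i t \<omega> - (\<Sum>j\<in>{1..N}. gainK2 n b \<bullet> X j t \<omega>) / real N)\<^sup>2 \<partial>M)"
  shows "(\<forall>t. integrable M (\<lambda>\<omega>. cons_err n N (\<lambda>j. X j t \<omega>) i)) \<and>
    Good (\<lambda>t. \<integral>\<omega>. cons_err n N (\<lambda>j. X j t \<omega>) i \<partial>M)"
proof -
  obtain n' where n': "n = Suc n'" using n by (cases n) auto
  \<comment> \<open>All components but the last are shifted from the previous time, and the last is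
    recovered from the bounded output because its coefficient in K2 is 1. The bounds obtained may
    depend on t.\<close>
  have comp: "\<forall>j\<in>{1..N}. \<forall>k<n. (\<lambda>\<omega>. X j t \<omega> $ k) \<in> borel_measurable M \<and> (\<exists>B. \<forall>\<omega>\<in>space M. \<bar>X j t \<omega> $ k\<bar> \<le> B)" for t
  proof (induction t)
    case 0
    show ?case
    proof (intro ballI allI impI conjI)
      fix j k assume j: "j \<in> {1..N}"
      show "(\<lambda>\<omega>. X j 0 \<omega> $ k) \<in> borel_measurable M"
        using init[OF j] by (subst measurable_cong[where g = "\<lambda>_. X0 j $ k"]) auto
      show "\<exists>B. \<forall>\<omega>\<in>space M. \<bar>X j 0 \<omega> $ k\<bar> \<le> B"
        using init[OF j] by (intro exI[of _ "\<bar>X0 j $ k\<bar>"]) auto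
    qed
  next
    case (Suc t)
    have low: "(\<lambda>\<omega>. X j (Suc t) \<omega> $ k) \<in> borel_measurable M \<and> (\<exists>B. \<forall>\<omega>\<in>space M. \<bar>X j (Suc t) \<omega> $ k\<bar> \<le> B)"
      if j: "j \<in> {1..N}" and k: "k < n'" for j k
    proof -
      have "k + 1 < n" "k < n - 1" using k n' by auto
      then show ?thesis using Suc.IH j shiftX[OF j _ \<open>k < n - 1\<close>, of _ t]
        by (subst measurable_cong[where g = "\<lambda>\<omega>. X j t \<omega> $ (k + 1)"]) auto
    qed
    have top: "X j (Suc t) \<omega> $ n' = gainK2 n b \<bullet> X j (Suc t) \<omega> - (\<Sum>k<n'. bext n b (k + 1) * X j (Suc t) \<omega> $ k)"
      if j: "j \<in> {1..N}" and \<omega>: "\<omega> \<in> space M" for j \<omega>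
      unfolding gainK2_prod[OF car[OF j \<omega>]] by (simp add: n' bext_def)
    show ?case
    proof (intro ballI allI impI)
      fix j k assume j: "j \<in> {1..N}" and k: "k < n"
      show "(\<lambda>\<omega>. X j (Suc t) \<omega> $ k) \<in> borel_measurable M \<and> (\<exists>B. \<forall>\<omega>\<in>space M. \<bar>X j (Suc t) \<omega> $ k\<bar> \<le> B)"
      proof (cases "k < n'")
        case True
        then show ?thesis using low[OF j] by blast
      next
        case False
        then have kn: "k = n'" using k n' by simp
        have meas: "(\<lambda>\<omega>. gainK2 n b \<bullet> X j (Suc t) \<omega> - (\<Sum>k<n'. bext n b (k + 1) * X j (Suc t) \<omega> $ k)) \<in> borel_measurable M"
          using low[OF j] out_meas[OF j, of "Suc t"]
          by (intro borel_measurable_diff borel_measurable_sum borel_measurable_times borel_measurable_const) auto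
        obtain Bk where Bk: "\<And>k \<omega>. k < n' \<Longrightarrow> \<omega> \<in> space M \<Longrightarrow> \<bar>X j (Suc t) \<omega> $ k\<bar> \<le> Bk k"
        proof -
          have "\<exists>Bk. \<forall>k\<in>{..<n'}. \<forall>\<omega>\<in>space M. \<bar>X j (Suc t) \<omega> $ k\<bar> \<le> Bk k"
            using low[OF j] by (intro bchoice) auto
          then show ?thesis using that by blast
        qed
        have "\<bar>X j (Suc t) \<omega> $ k\<bar> \<le> B + (\<Sum>k<n'. \<bar>bext n b (k + 1)\<bar> * Bk k)" if \<omega>: "\<omega> \<in> space M" for \<omega>
        proof -
          have "\<bar>\<Sum>k<n'. bext n b (k + 1) * X j (Suc t) \<omega> $ k\<bar> \<le> (\<Sum>k<n'. \<bar>bext n b (k + 1)\<bar> * Bk k)"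
            using Bk \<omega> by (intro order_trans[OF sum_abs] sum_mono) (auto simp: abs_mult intro!: mult_left_mono)
          then show ?thesis unfolding kn top[OF j \<omega>] using out_bd[OF j \<omega>, of "Suc t"] by linarith
        qed
        moreover have "(\<lambda>\<omega>. X j (Suc t) \<omega> $ k) \<in> borel_measurable M"
          using meas top[OF j] unfolding kn by (subst measurable_cong) auto
        ultimately show ?thesis by blast
      qed
    qed
  qed
  define \<xi> where "\<xi> k t \<omega> = X i t \<omega> $ k - (\<Sum>j\<in>{1..N}. X j t \<omega> $ k) / real N" for k t \<omega>
  have \<xi>m: "\<xi> k t \<in> borel_measurable M" if "k < n" for k t
    unfolding \<xi>_def using comp[of t] that i
    by (intro borel_measurable_diff borel_measurable_divide borel_measurable_sum borel_measurable_const) auto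
  have \<xi>b: "\<exists>B. \<forall>\<omega>\<in>space M. \<bar>\<xi> k t \<omega>\<bar> \<le> B" if k: "k < n" for k t
  proof -
    have "\<exists>Bj. \<forall>j\<in>{1..N}. \<forall>\<omega>\<in>space M. \<bar>X j t \<omega> $ k\<bar> \<le> Bj j"
      using comp[of t] k by (intro bchoice) auto
    then obtain Bj where Bj: "\<And>j \<omega>. j \<in> {1..N} \<Longrightarrow> \<omega> \<in> space M \<Longrightarrow> \<bar>X j t \<omega> $ k\<bar> \<le> Bj j" by blast
    have "\<bar>\<xi> k t \<omega>\<bar> \<le> Bj i + (\<Sum>j\<in>{1..N}. Bj j) / real N" if \<omega>: "\<omega> \<in> space M" for \<omega>
    proof -
      have "\<bar>(\<Sum>j\<in>{1..N}. X j t \<omega> $ k) / real N\<bar> = \<bar>\<Sum>j\<in>{1..N}. X j t \<omega> $ k\<bar> / real N" by simp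
      also have "\<dots> \<le> (\<Sum>j\<in>{1..N}. Bj j) / real N"
        using Bj \<omega> by (intro divide_right_mono order_trans[OF sum_abs] sum_mono) auto
      finally show ?thesis unfolding \<xi>_def using Bj[OF i \<omega>] by linarith
    qed
    then show ?thesis by blast
  qed
  have \<xi>int: "integrable M (\<lambda>\<omega>. (\<xi> k t \<omega>)\<^sup>2)" if k: "k < n" for k t
  proof -
    obtain B where B: "\<And>\<omega>. \<omega> \<in> space M \<Longrightarrow> \<bar>\<xi> k t \<omega>\<bar> \<le> B" using \<xi>b[OF k, of t] by blast
    have "(\<xi> k t \<omega>)\<^sup>2 \<le> B\<^sup>2" if "\<omega> \<in> space M" for \<omega>
      using power_mono[OF B[OF that], of 2] by simp
    moreover have "(\<lambda>\<omega>. (\<xi> k t \<omega>)\<^sup>2) \<in> borel_measurable M" using \<xi>m[OF k] by measurable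
    ultimately show ?thesis
      by (intro finite_measure.integrable_const_bound[OF M, of _ "B\<^sup>2"]) auto
  qed
  have ce: "cons_err n N (\<lambda>j. X j t \<omega>) i = (\<Sum>k<n. (\<xi> k t \<omega>)\<^sup>2)" for t \<omega>
    by (simp add: cons_err_def \<xi>_def)
  have ceint: "integrable M (\<lambda>\<omega>. cons_err n N (\<lambda>j. X j t \<omega>) i)" for t
    unfolding ce using \<xi>int by (intro Bochner_Integration.integrable_sum) auto
  have \<xi>shift: "\<xi> k t \<omega> = \<xi> 0 (t + k) \<omega>" if "k < n" "\<omega> \<in> space M" for k t \<omega>
    using that(1)
  proof (induction k arbitrary: t)
    case 0
    then show ?case by simp
  next
    case (Suc k)
    have k1: "k < n - 1" using Suc.prems by simp
    have "\<xi> (Suc k) t \<omega> = \<xi> k (Suc t) \<omega>"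
      unfolding \<xi>_def using shiftX[OF _ that(2) k1, of _ t] i by simp
    then show ?case using Suc.IH[of "Suc t"] Suc.prems by simp
  qed
  have n0: "0 < n" using n by simp
  let ?p = "map_poly complex_of_real (gain_poly n b)"
  have dp: "degree ?p \<le> n'" using gain_poly_degree[OF n, of b] n' by (metis degree_map_poly_le diff_Suc_1 order_trans)
  have cp: "coeff ?p k = complex_of_real (bext n b (k + 1))" if "k < n" for k
    using gain_poly_coeff[OF n that, of b] by (simp add: coeff_map_poly)
  have p0: "?p \<noteq> 0"
  proof
    assume "?p = 0"
    then have "coeff ?p n' = 0" by simp
    then show False using cp[of n'] n' by (simp add: bext_def)
  qed
  have app: "shift_app ?p (\<lambda>t. complex_of_real (\<xi> 0 t \<omega>)) t
      = complex_of_real (gainK2 n b \<bullet> X i t \<omega> - (\<Sum>j\<in>{1..N}. gainK2 n b \<bullet> X j t \<omega>) / real N)"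
    if \<omega>: "\<omega> \<in> space M" for t \<omega>
  proof -
    have "shift_app ?p (\<lambda>t. complex_of_real (\<xi> 0 t \<omega>)) t = (\<Sum>k\<le>n'. coeff ?p k * complex_of_real (\<xi> 0 (t + k) \<omega>))"
      by (rule shift_app_eq[OF dp])
    also have "\<dots> = (\<Sum>k<n. complex_of_real (bext n b (k + 1) * \<xi> k t \<omega>))"
    proof (rule sum.cong)
      show "{..n'} = {..<n}" by (auto simp: n')
      fix k assume "k \<in> {..<n}"
      then show "coeff ?p k * complex_of_real (\<xi> 0 (t + k) \<omega>) = complex_of_real (bext n b (k + 1) * \<xi> k t \<omega>)"
        using cp[of k] \<xi>shift[of k \<omega> t] \<omega> by simp
    qed
    also have "\<dots> = complex_of_real (\<Sum>k<n. bext n b (k + 1) * \<xi> k t \<omega>)" by simp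
    also have "(\<Sum>k<n. bext n b (k + 1) * \<xi> k t \<omega>) = (\<Sum>k<n. bext n b (k + 1) * X i t \<omega> $ k)
        - (\<Sum>k<n. \<Sum>j\<in>{1..N}. bext n b (k + 1) * X j t \<omega> $ k) / real N"
      unfolding \<xi>_def by (simp add: right_diff_distrib sum_subtractf sum_divide_distrib sum_distrib_left)
    also have "(\<Sum>k<n. \<Sum>j\<in>{1..N}. bext n b (k + 1) * X j t \<omega> $ k) = (\<Sum>j\<in>{1..N}. \<Sum>k<n. bext n b (k + 1) * X j t \<omega> $ k)"
      by (rule sum.swap)
    also have "\<dots> = (\<Sum>j\<in>{1..N}. gainK2 n b \<bullet> X j t \<omega>)"
      using gainK2_prod[OF car[OF _ \<omega>]] by (intro sum.cong refl) simp
    finally show ?thesis using gainK2_prod[OF car[OF i \<omega>]] by simp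
  qed
  have "Good (\<lambda>t. \<integral>\<omega>. (cmod (complex_of_real (\<xi> 0 t \<omega>)))\<^sup>2 \<partial>M)"
  proof (rule stable_shift_poly[where p = ?p])
    show "finite_measure M" by (rule M)
    show "?p \<noteq> 0" by (rule p0)
    show "(\<lambda>\<omega>. complex_of_real (\<xi> 0 t \<omega>)) \<in> borel_measurable M" for t
      using \<xi>m[OF n0, of t] by measurable
    show "\<exists>B. \<forall>\<omega>\<in>space M. cmod (complex_of_real (\<xi> 0 t \<omega>)) \<le> B" for t
      using \<xi>b[OF n0, of t] by simp
    have "(\<integral>\<omega>. (cmod (shift_app ?p (\<lambda>t. complex_of_real (\<xi> 0 t \<omega>)) t))\<^sup>2 \<partial>M)
      = (\<integral>\<omega>. (gainK2 n b \<bullet> X i t \<omega> - (\<Sum>j\<in>{1..N}. gainK2 n b \<bullet> X j t \<omega>) / real N)\<^sup>2 \<partial>M)" for t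
      using app by (intro Bochner_Integration.integral_cong refl) (simp del: of_real_diff)
    then show "Good (\<lambda>t. \<integral>\<omega>. (cmod (shift_app ?p (\<lambda>t. complex_of_real (\<xi> 0 t \<omega>)) t))\<^sup>2 \<partial>M)" using good by simp
    show "cmod a < 1" if "poly ?p a = 0" for a using roots that by blast
  qed
  then have g0: "Good (\<lambda>t. \<integral>\<omega>. (\<xi> 0 t \<omega>)\<^sup>2 \<partial>M)" by simp
  have gshift: "Good (\<lambda>t. \<integral>\<omega>. (\<xi> 0 (t + k) \<omega>)\<^sup>2 \<partial>M)" for k
  proof (induction k)
    case 0
    then show ?case using g0 by simp
  next
    case (Suc k)
    show ?case using shift[OF Suc.IH] by simp
  qed
  have "Good (\<lambda>t. \<Sum>k<l. \<integral>\<omega>. (\<xi> 0 (t + k) \<omega>)\<^sup>2 \<partial>M)" for l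
  proof (induction l)
    case 0
    then show ?case using zero by simp
  next
    case (Suc l)
    show ?case using add[OF Suc.IH gshift[of l]] by simp
  qed
  moreover have "(\<integral>\<omega>. cons_err n N (\<lambda>j. X j t \<omega>) i \<partial>M) = (\<Sum>k<n. \<integral>\<omega>. (\<xi> 0 (t + k) \<omega>)\<^sup>2 \<partial>M)" for t
  proof -
    have "(\<integral>\<omega>. cons_err n N (\<lambda>j. X j t \<omega>) i \<partial>M) = (\<Sum>k<n. \<integral>\<omega>. (\<xi> k t \<omega>)\<^sup>2 \<partial>M)"
      unfolding ce using \<xi>int by (intro Bochner_Integration.integral_sum) auto
    also have "\<dots> = (\<Sum>k<n. \<integral>\<omega>. (\<xi> 0 (t + k) \<omega>)\<^sup>2 \<partial>M)"
    proof (intro sum.cong refl Bochner_Integration.integral_cong)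
      fix k \<omega> assume "k \<in> {..<n}" "\<omega> \<in> space M"
      then show "(\<xi> k t \<omega>)\<^sup>2 = (\<xi> 0 (t + k) \<omega>)\<^sup>2" using \<xi>shift[of k \<omega> t] by simp
    qed
    finally show ?thesis .
  qed
  ultimately have "Good (\<lambda>t. \<integral>\<omega>. cons_err n N (\<lambda>j. X j t \<omega>) i \<partial>M)" by simp
  then show ?thesis using ceint by blast
qed

theorem theorem4:
  fixes n N h t0 :: nat
    and a b :: "nat \<Rightarrow> real"
    and E :: "nat \<Rightarrow> nat set set"
    and P :: "nat \<Rightarrow> nat \<Rightarrow> real" and \<pi> :: "nat \<Rightarrow> real"
    and c :: "nat \<Rightarrow> nat \<Rightarrow> real" and \<sigma> \<beta> \<gamma> Mb :: real
    and x0 :: "nat \<Rightarrow> real vec" and z0 :: "nat \<Rightarrow> nat \<Rightarrow> real"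
    and Mp :: "'w measure"
    and m :: "nat \<Rightarrow> 'w \<Rightarrow> nat"
    and d :: "nat \<Rightarrow> nat \<Rightarrow> nat \<Rightarrow> 'w \<Rightarrow> real"
    and x :: "nat \<Rightarrow> nat \<Rightarrow> 'w \<Rightarrow> real vec"
    and zh :: "nat \<Rightarrow> nat \<Rightarrow> nat \<Rightarrow> 'w \<Rightarrow> real"
    and s :: "nat \<Rightarrow> nat \<Rightarrow> nat \<Rightarrow> 'w \<Rightarrow> real"
    and u :: "nat \<Rightarrow> nat \<Rightarrow> 'w \<Rightarrow> real"
  assumes n2: "n \<ge> 2" and N2: "N \<ge> 2"
    and graphs: "h \<ge> 1" "undirected_graphs N h E" "union_connected N h E"
    and chain: "prob_space Mp" "hom_markov_chain Mp h P m"
      "stochastic h P" "irreducible_tm h P" "aperiodic_tm h P" "stationary h P \<pi>"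
    and noise: "\<sigma> > 0"
      "\<forall>(i, j)\<in>pairs N h E. \<forall>t. distributed Mp lborel (d i j t) (\<lambda>y. ennreal (normal_density 0 \<sigma> y))"
      "prob_space.indep_vars Mp (\<lambda>_. borel) (\<lambda>((i, j), t). d i j t) (pairs N h E \<times> UNIV)"
    and chain_noise_indep:
      "prob_space.indep_set Mp
         (sets (vimage_algebra (space Mp) (\<lambda>\<omega> t. m t \<omega>) (Pi\<^sub>M UNIV (\<lambda>_. count_space UNIV))))
         (sets (vimage_algebra (space Mp)
            (\<lambda>\<omega>. restrict (\<lambda>((i, j), t). d i j t \<omega>) (pairs N h E \<times> UNIV))
            (Pi\<^sub>M (pairs N h E \<times> UNIV) (\<lambda>_. borel))))"
    and roots: "\<forall>z. poly (map_poly complex_of_real (gain_poly n b)) z = 0 \<longrightarrow> cmod z < 1"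
    and params: "\<beta> > 0" "\<gamma> > 0" "real t0 > \<gamma> * real (dmax N h E) - 1" "Mb > 0"
    and init: "\<forall>i\<in>{1..N}. x0 i \<in> carrier_vec n \<and> \<bar>gainK2 n b \<bullet> x0 i\<bar> \<le> Mb"
      "\<forall>(i, j)\<in>pairs N h E. \<bar>z0 i j\<bar> \<le> Mb"
      "\<forall>i\<in>{1..N}. \<forall>\<omega>. x i (t0 + 1) \<omega> = x0 i"
      "\<forall>(i, j)\<in>pairs N h E. \<forall>\<omega>. zh i j t0 \<omega> = z0 i j"
    and s_def: "\<forall>(i, j)\<in>pairs N h E. \<forall>t \<omega>.
       s i j t \<omega> = (if gainK2 n b \<bullet> x j t \<omega> + d i j t \<omega> \<le> c i j then 1 else 0)"
    and zh_rec: "\<forall>(i, j)\<in>pairs N h E. \<forall>t\<ge>t0 + 1. \<forall>\<omega>.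
       zh i j t \<omega> = proj Mb (zh i j (t - 1) \<omega> + \<beta> / real t *
          (if j \<in> nbr E (m t \<omega>) i then 1 else 0) *
          (gauss_F \<sigma> (c i j - zh i j (t - 1) \<omega>) - s i j t \<omega>))"
    and u_def: "\<forall>i\<in>{1..N}. \<forall>t\<ge>t0 + 1. \<forall>\<omega>.
       u i t \<omega> = gainK1 n a b \<bullet> x i t \<omega> + \<gamma> / real (t + 1) *
          (\<Sum>j\<in>nbr E (m t \<omega>) i. zh i j t \<omega> - gainK2 n b \<bullet> x i t \<omega>)"
    and x_rec: "\<forall>i\<in>{1..N}. \<forall>t\<ge>t0 + 1. \<forall>\<omega>.
       x i (t + 1) \<omega> = sysA n a *\<^sub>v x i t \<omega> + u i t \<omega> \<cdot>\<^sub>v sysB n"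
  shows
    "(\<beta> > 1 / (2 * fM_const N h E \<sigma> c Mb * Min (\<pi> ` {1..h})) *
          (\<gamma> * (lamG N h E)\<^sup>2 / (lam2 N h E \<pi>) ^ 3 + \<gamma> * alpha_const N h E \<pi>)
       \<longrightarrow> (\<forall>i\<in>{1..N}.
             (\<forall>t\<ge>t0 + 1. integrable Mp (\<lambda>\<omega>. cons_err n N (\<lambda>j. x j t \<omega>) i)) \<and>
             (\<lambda>t. integral\<^sup>L Mp (\<lambda>\<omega>. cons_err n N (\<lambda>j. x j t \<omega>) i)) \<longlonglongrightarrow> 0))
     \<and>
     (\<gamma> > 1 / lam2 N h E \<pi> \<and>
      \<beta> > 1 / (2 * fM_const N h E \<sigma> c Mb * Min (\<pi> ` {1..h})) *
          (\<gamma>\<^sup>2 * (lamG N h E)\<^sup>2 / ((lam2 N h E \<pi>)\<^sup>2 * (\<gamma> * lam2 N h E \<pi> - 1))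
           + \<gamma> * alpha_const N h E \<pi> + 1)
       \<longrightarrow> (\<forall>i\<in>{1..N}.
             (\<forall>t\<ge>t0 + 1. integrable Mp (\<lambda>\<omega>. cons_err n N (\<lambda>j. x j t \<omega>) i)) \<and>
             (\<exists>C. \<forall>t\<ge>t0 + 1. integral\<^sup>L Mp (\<lambda>\<omega>. cons_err n N (\<lambda>j. x j t \<omega>) i) \<le> C / real t)))"
proof -
  define D where "D p t = d (fst p) (snd p) t" for p t
  define y where "y i t \<omega> = gainK2 n b \<bullet> x i t \<omega>" for i t \<omega>
  define z where "z p t \<omega> = zh (fst p) (snd p) t \<omega>" for p t \<omega>
  have xcar: "x i t \<omega> \<in> carrier_vec n" if i: "i \<in> {1..N}" and t: "t \<ge> Suc t0" for i t \<omega>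
    using t
  proof (induction t rule: dec_induct)
    case base
    then show ?case using init i by simp
  next
    case (step t)
    have "x i (Suc t) \<omega> = sysA n a *\<^sub>v x i t \<omega> + u i t \<omega> \<cdot>\<^sub>v sysB n" using x_rec i step by simp
    then show ?case by (auto simp: sysB_def intro!: carrier_vecI)
  qed
  have DI: "(\<lambda>((i, j), t). d i j t) = (\<lambda>(p, t). D p t)"
    by (auto simp: D_def fun_eq_iff)
  have DI2: "(\<lambda>((i, j), t). d i j t \<omega>) = (\<lambda>(p, t). D p t \<omega>)" for \<omega>
    by (auto simp: D_def fun_eq_iff)
  interpret prob_space Mp by (rule chain(1))
  interpret consensus_scheme Mp h P m N E D t0 \<pi> "\<lambda>p. c (fst p) (snd p)" \<sigma> \<beta> \<gamma> Mb
    "\<lambda>i. gainK2 n b \<bullet> x0 i" "\<lambda>p. z0 (fst p) (snd p)" y z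
  proof
    show "hom_markov_chain Mp h P m" by (rule chain)
    show "indep_vars (\<lambda>_. borel) (\<lambda>(p, t). D p t) (pairs N h E \<times> UNIV)" using noise(3) unfolding DI .
    show "indep_set
         (sets (vimage_algebra (space Mp) (\<lambda>\<omega> t. m t \<omega>) (Pi\<^sub>M UNIV (\<lambda>_. count_space UNIV))))
         (sets (vimage_algebra (space Mp)
            (\<lambda>\<omega>. restrict (\<lambda>(p, t). D p t \<omega>) (pairs N h E \<times> UNIV)) (Pi\<^sub>M (pairs N h E \<times> UNIV) (\<lambda>_. borel))))"
      using chain_noise_indep unfolding DI2 .
    show "distributed Mp lborel (D p t) (\<lambda>x. ennreal (normal_density 0 \<sigma> x))" if "p \<in> pairs N h E" for p t
      using noise(2) that by (cases p) (auto simp: D_def)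
    show "y i (Suc t0) \<omega> = gainK2 n b \<bullet> x0 i" if "i \<in> {1..N}" for i \<omega> using init(3) that by (simp add: y_def)
    show "\<bar>gainK2 n b \<bullet> x0 i\<bar> \<le> Mb" if "i \<in> {1..N}" for i using init(1) that by simp
    show "z p t0 \<omega> = z0 (fst p) (snd p)" if "p \<in> pairs N h E" for p \<omega>
      using init(4) that by (cases p) (auto simp: z_def)
    show "\<bar>z0 (fst p) (snd p)\<bar> \<le> Mb" if "p \<in> pairs N h E" for p
      using init(2) that by (cases p) auto
    show "z p t \<omega> = proj Mb (z p (t - 1) \<omega> + \<beta> / real t * adj E (m t \<omega>) (fst p) (snd p) *
         (gauss_F \<sigma> (c (fst p) (snd p) - z p (t - 1) \<omega>) - (if y (snd p) t \<omega> + D p t \<omega> \<le> c (fst p) (snd p) then 1 else 0)))"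
      if p: "p \<in> pairs N h E" and t: "t \<ge> Suc t0" for p t \<omega>
    proof (cases p)
      case (Pair i j)
      have ij: "(i, j) \<in> pairs N h E" using p Pair by simp
      have s: "s i j t \<omega> = (if y j t \<omega> + D (i, j) t \<omega> \<le> c i j then 1 else 0)"
        using bspec[OF s_def ij] by (simp add: y_def D_def)
      have "zh i j t \<omega> = proj Mb (zh i j (t - 1) \<omega> + \<beta> / real t *
          (if j \<in> nbr E (m t \<omega>) i then 1 else 0) *
          (gauss_F \<sigma> (c i j - zh i j (t - 1) \<omega>) - s i j t \<omega>))"
        using bspec[OF zh_rec ij] t by simp
      then show ?thesis unfolding s by (simp add: Pair z_def adj_def nbr_def)
    qed
    show "y i (Suc t) \<omega> = y i t \<omega> + \<gamma> / real (Suc t) * (\<Sum>j\<in>nbr E (m t \<omega>) i. z (i, j) t \<omega> - y i t \<omega>)"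
      if i: "i \<in> {1..N}" and t: "t \<ge> Suc t0" for i t \<omega>
    proof -
      define w where "w = \<gamma> / real (Suc t) * (\<Sum>j\<in>nbr E (m t \<omega>) i. z (i, j) t \<omega> - y i t \<omega>)"
      have "u i t \<omega> = gainK1 n a b \<bullet> x i t \<omega> + w"
        using u_def i t by (simp add: w_def z_def y_def)
      then have "x i (Suc t) \<omega> = sysA n a *\<^sub>v x i t \<omega> + (gainK1 n a b \<bullet> x i t \<omega> + w) \<cdot>\<^sub>v sysB n"
        using x_rec i t by simp
      then have "gainK2 n b \<bullet> x i (Suc t) \<omega> = gainK2 n b \<bullet> x i t \<omega> + w"
        using gainK2_step[OF n2 xcar[OF i t, of \<omega>], of b a w] by (simp only:)
      then show ?thesis unfolding w_def by (simp only: y_def)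
    qed
  qed (rule n2 N2 graphs chain noise(1) params)+
  have fM_eq: "fM_const N h E \<sigma> c Mb = fM"
    by (simp add: fM_const_def fM_def case_prod_unfold)
  have pmin_eq: "Min (\<pi> ` {1..h}) = pmin" by (simp add: pmin_def)
  \<comment> \<open>Time restarts at t0 + 1, where the recursions set in, because a rate class
    speaks about all indices of a sequence.\<close>
  define X where "X j \<tau> \<omega> = x j (Suc t0 + \<tau>) \<omega>" for j \<tau> \<omega>
  have Xshift: "X j (Suc \<tau>) \<omega> $ k = X j \<tau> \<omega> $ (k + 1)" if j: "j \<in> {1..N}" and k: "k < n - 1" for j \<tau> \<omega> k
    unfolding X_def using x_rec j sys_step_index(1)[OF n2 xcar[OF j] k, of "Suc t0 + \<tau>"] by simp
  have delta: "gainK2 n b \<bullet> X i \<tau> \<omega> - (\<Sum>j\<in>{1..N}. gainK2 n b \<bullet> X j \<tau> \<omega>) / real N = \<delta> i (Suc t0 + \<tau>) \<omega>" for i \<tau> \<omega>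
    by (simp add: \<delta>_def X_def y_def)
  have delta_EV: "(\<integral>\<omega>. (\<delta> i (Suc t0 + \<tau>) \<omega>)\<^sup>2 \<partial>Mp) \<le> 1 * EV (Suc t0 + \<tau>)" if i: "i \<in> {1..N}" for i \<tau>
  proof -
    have "(\<integral>\<omega>. (\<delta> i (Suc t0 + \<tau>) \<omega>)\<^sup>2 \<partial>Mp) \<le> EV (Suc t0 + \<tau>)"
      unfolding EV_def
    proof (rule integral_mono)
      show "integrable Mp (\<lambda>\<omega>. (\<delta> i (Suc t0 + \<tau>) \<omega>)\<^sup>2)"
        using i by (intro Ob_integrable_past[of 0 "\<lambda>t \<omega>. (\<delta> i t \<omega>)\<^sup>2"] Ob_power2 Ob_\<delta> borel_measurable_power \<delta>_measurable) auto
      show "integrable Mp (Vf (Suc t0 + \<tau>))" by (rule Vf_integrable) simp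
      show "(\<delta> i (Suc t0 + \<tau>) \<omega>)\<^sup>2 \<le> Vf (Suc t0 + \<tau>) \<omega>" for \<omega>
        unfolding Vf_def using i by (intro member_le_sum) auto
    qed
    then show ?thesis by simp
  qed
  \<comment> \<open>For an arbitrary rate class, so that one argument serves both the convergence
    and the rate.\<close>
  have transfer: "(\<forall>\<tau>. integrable Mp (\<lambda>\<omega>. cons_err n N (\<lambda>j. X j \<tau> \<omega>) i)) \<and>
      Good (\<lambda>\<tau>. \<integral>\<omega>. cons_err n N (\<lambda>j. X j \<tau> \<omega>) i \<partial>Mp)"
    if i: "i \<in> {1..N}" and EV: "Good (\<lambda>\<tau>. EV (Suc t0 + \<tau>))" and rc: "rate_class Good"
    for i and Good :: "(nat \<Rightarrow> real) \<Rightarrow> bool"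
  proof -
    have good: "Good (\<lambda>\<tau>. \<integral>\<omega>. (gainK2 n b \<bullet> X i \<tau> \<omega> - (\<Sum>j\<in>{1..N}. gainK2 n b \<bullet> X j \<tau> \<omega>) / real N)\<^sup>2 \<partial>Mp)"
      unfolding delta by (rule rate_class.dom[OF rc EV, of 1]) (auto intro!: delta_EV[OF i, simplified] Bochner_Integration.integral_nonneg)
    show ?thesis
    proof (rule rate_class.state_error_from_output[OF rc finite_measure_axioms n2 roots _ _ _ _ _ i good])
      show "X j \<tau> \<omega> \<in> carrier_vec n" if "j \<in> {1..N}" for j \<tau> \<omega>
        unfolding X_def using that by (intro xcar) auto
      show "X j (Suc \<tau>) \<omega> $ k = X j \<tau> \<omega> $ (k + 1)" if "j \<in> {1..N}" "k < n - 1" for j \<tau> \<omega> k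
        using that by (rule Xshift)
      show "X j 0 \<omega> = x0 j" if "j \<in> {1..N}" for j \<omega>
        unfolding X_def using init(3) that by simp
      show "(\<lambda>\<omega>. gainK2 n b \<bullet> X j \<tau> \<omega>) \<in> borel_measurable Mp" if "j \<in> {1..N}" for j \<tau>
        using measurable_past_M[OF y_measurable[of "Suc t0 + \<tau>" j]] that unfolding X_def y_def[abs_def] by simp
      show "\<bar>gainK2 n b \<bullet> X j \<tau> \<omega>\<bar> \<le> Mb" if "j \<in> {1..N}" "\<omega> \<in> space Mp" for j \<tau> \<omega>
        using y_bound[of j "Suc t0 + \<tau>" \<omega>] that by (simp add: X_def y_def)
    qed
  qed
  have integ: "integrable Mp (\<lambda>\<omega>. cons_err n N (\<lambda>j. x j t \<omega>) i)"
    if "\<forall>\<tau>. integrable Mp (\<lambda>\<omega>. cons_err n N (\<lambda>j. X j \<tau> \<omega>) i)" "t \<ge> t0 + 1" for t i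
    using that(1)[rule_format, of "t - Suc t0"] that(2) by (simp add: X_def)
  show ?thesis unfolding fM_eq pmin_eq
  proof (intro conjI impI ballI)
    fix i assume i: "i \<in> {1..N}"
    assume "1 / (2 * fM * pmin) * (\<gamma> * (lamG N h E)\<^sup>2 / (lam2 N h E \<pi>) ^ 3 + \<gamma> * alpha_const N h E \<pi>) < \<beta>"
    then have EV: "EV \<longlonglongrightarrow> 0" by (rule EV_tendsto_0)
    have *: "(\<forall>\<tau>. integrable Mp (\<lambda>\<omega>. cons_err n N (\<lambda>j. X j \<tau> \<omega>) i)) \<and>
      (\<lambda>\<tau>. \<integral>\<omega>. cons_err n N (\<lambda>j. X j \<tau> \<omega>) i \<partial>Mp) \<longlonglongrightarrow> 0"
    proof (rule transfer[OF i _ rate_class_tendsto_0])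
      show "(\<lambda>\<tau>. EV (Suc t0 + \<tau>)) \<longlonglongrightarrow> 0"
        using LIMSEQ_ignore_initial_segment[OF EV, of "Suc t0"] by (simp add: add.commute)
    qed
    show "\<forall>t\<ge>t0 + 1. integrable Mp (\<lambda>\<omega>. cons_err n N (\<lambda>j. x j t \<omega>) i)"
      using integ * by blast
    have "(\<lambda>\<tau>. \<integral>\<omega>. cons_err n N (\<lambda>j. x j (\<tau> + Suc t0) \<omega>) i \<partial>Mp) \<longlonglongrightarrow> 0"
      using * by (simp add: X_def add.commute)
    then show "(\<lambda>t. \<integral>\<omega>. cons_err n N (\<lambda>j. x j t \<omega>) i \<partial>Mp) \<longlonglongrightarrow> 0"
      by (rule LIMSEQ_offset)
  next
    fix i assume i: "i \<in> {1..N}"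
    assume A: "1 / lam2 N h E \<pi> < \<gamma> \<and> 1 / (2 * fM * pmin) *
          (\<gamma>\<^sup>2 * (lamG N h E)\<^sup>2 / ((lam2 N h E \<pi>)\<^sup>2 * (\<gamma> * lam2 N h E \<pi> - 1))
           + \<gamma> * alpha_const N h E \<pi> + 1) < \<beta>"
    obtain K where K: "\<And>t. t \<ge> Suc t0 \<Longrightarrow> EV t \<le> K / real t"
      using EV_bigo[OF conjunct1[OF A] conjunct2[OF A]] by blast
    let ?G = "\<lambda>V. \<exists>K. \<forall>t. V t \<le> K / real (Suc t)"
    have *: "(\<forall>\<tau>. integrable Mp (\<lambda>\<omega>. cons_err n N (\<lambda>j. X j \<tau> \<omega>) i)) \<and>
      ?G (\<lambda>\<tau>. \<integral>\<omega>. cons_err n N (\<lambda>j. X j \<tau> \<omega>) i \<partial>Mp)"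
    proof (rule transfer[OF i _ rate_class_inverse])
      show "?G (\<lambda>\<tau>. EV (Suc t0 + \<tau>))"
      proof (intro exI[of _ "\<bar>K\<bar>"] allI)
        fix \<tau>
        have "EV (Suc t0 + \<tau>) \<le> K / real (Suc t0 + \<tau>)" by (rule K) simp
        also have "\<dots> \<le> \<bar>K\<bar> / real (Suc \<tau>)" by (intro frac_le) auto
        finally show "EV (Suc t0 + \<tau>) \<le> \<bar>K\<bar> / real (Suc \<tau>)" .
      qed
    qed
    show "\<forall>t\<ge>t0 + 1. integrable Mp (\<lambda>\<omega>. cons_err n N (\<lambda>j. x j t \<omega>) i)"
      using integ * by blast
    obtain K2 where K2: "\<And>\<tau>. (\<integral>\<omega>. cons_err n N (\<lambda>j. X j \<tau> \<omega>) i \<partial>Mp) \<le> K2 / real (Suc \<tau>)" using * by blast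
    show "\<exists>C. \<forall>t\<ge>t0 + 1. (\<integral>\<omega>. cons_err n N (\<lambda>j. x j t \<omega>) i \<partial>Mp) \<le> C / real t"
    \<comment> \<open>Returning from \<tau> + 1 to t = t0 + 1 + \<tau> costs the factor t0 + 1,
      since t <= (t0 + 1)(\<tau> + 1); the absolute value covers a negative K2.\<close>
    proof (intro exI[of _ "\<bar>K2\<bar> * real (Suc t0)"] allI impI)
      fix t assume "t \<ge> t0 + 1"
      then obtain \<tau> where t: "t = Suc t0 + \<tau>" using le_Suc_ex by force
      have "(\<integral>\<omega>. cons_err n N (\<lambda>j. x j t \<omega>) i \<partial>Mp) \<le> K2 / real (Suc \<tau>)" using K2[of \<tau>] by (simp add: X_def t)
      also have "\<dots> \<le> \<bar>K2\<bar> / real (Suc \<tau>)" by (intro divide_right_mono) auto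
      also have "\<dots> \<le> \<bar>K2\<bar> * real (Suc t0) / real t"
      proof -
        have "t \<le> Suc t0 * Suc \<tau>" by (simp add: t)
        then have "real t \<le> real (Suc t0) * real (Suc \<tau>)" by (metis of_nat_le_iff of_nat_mult)
        then have "\<bar>K2\<bar> * real t \<le> \<bar>K2\<bar> * (real (Suc t0) * real (Suc \<tau>))" by (intro mult_left_mono) auto
        then show ?thesis using t by (simp add: divide_simps mult.assoc)
      qed
      finally show "(\<integral>\<omega>. cons_err n N (\<lambda>j. x j t \<omega>) i \<partial>Mp) \<le> \<bar>K2\<bar> * real (Suc t0) / real t" .
    qed
  qed
qed

end
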